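(* Let $G$ be a group with identity $e$ and let $(A,\Delta)$ be a regular $G$-cograded multiplier Hopf algebra with decomposition $A=\bigoplus_{p\in G}A_p$, where every $A_p$ is a finite-dimensional algebra with identity. Let $S$ be the antipode. For each $p\in G$ let $(e_{p,i})_i$ be a basis of $A_p$ and $(f_{p,i})_i$ the dual basis of the dual space $A_p'$. For any $f\in A_e'$, the linear functional $\varphi_f$ on $A$ defined by $$\varphi_f(a)=\sum_{p,i}(f_{p,i}f)(a\,S^2(e_{p,i}))\qquad(a\in A)$$ is left invariant on $(A,\Delta)$, that is, $(\iota\otimes\varphi_f)\Delta(a)=\varphi_f(a)1$ in $M(A)$ for all $a\in A$.
   Context: All algebras are over $\mathbb{C}$ with non-degenerate product. $M(A)$ is the multiplier algebra of $A$; $\iota$ denotes identity maps. A multiplier Hopf algebra is a pair $(A,\Delta)$, where $\Delta:A\to M(A\otimes A)$ is a homomorphism such that $\Delta(a)(1\otimes b)\in A\otimes A$ and $(a\otimes 1)\Delta(b)\in A\otimes A$ for all $a,b\in A$, such that $(a\otimes1\otimes1)(\Delta\otimes\iota)(\Delta(b)(1\otimes c))=((\iota\otimes\Delta)((a\otimes1)\Delta(b)))(1\otimes1\otimes c)$ for all $a,b,c$, and such that the linear maps $a\otimes b\mapsto\Delta(a)(1\otimes b)$ and $a\otimes b\mapsto(a\otimes1)\Delta(b)$ are bijections of $A\otimes A$ onto itself. It has a unique counit $\varepsilon:A\to\mathbb{C}$ (a homomorphism with $(\varepsilon\otimes\iota)(\Delta(a)(1\otimes b))=ab$, $(\iota\otimes\varepsilon)((a\otimes1)\Delta(b))=ab$)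 and a unique antipode $S:A\to M(A)$ (an anti-homomorphism with $m((S\otimes\iota)(\Delta(a)(1\otimes b)))=\varepsilon(a)b$, $m((\iota\otimes S)((b\otimes1)\Delta(a)))=\varepsilon(a)b$, $m$ being multiplication). It is regular if $(A,\Delta^{\mathrm{op}})$ is also a multiplier Hopf algebra; equivalently $S$ is a bijection of $A$ onto $A$. $(A,\Delta)$ is $G$-cograded if there are non-trivial subalgebras $(A_p)_{p\in G}$ with $A=\bigoplus_{p\in G}A_p$, $A_pA_q=0$ for $p\ne q$, and $\Delta(A_{pq})(1\otimes A_q)=A_p\otimes A_q=(A_p\otimes1)\Delta(A_{pq})$ (linear spans) for all $p,q$. Then $M(A\otimes A)=\prod_{p,q}M(A_p\otimes A_q)$, and $\Delta_{p,q}:A_{pq}\to A_p\otimes A_q$ denotes the $(p,q)$-component of $\Delta$ restricted to $A_{pq}$ (in the unital finite-dimensional case it takes values in $A_p\otimes A_q$). In the regular case $S(A_p)=A_{p^{-1}}$, so $S^2(A_p)=A_p$. For $f\in A_p'$ and $g\in A_q'$, the product $fg\in A_{pq}'$ is $(fg)(x)=(f\otimes g)(\Delta_{p,q}(x))$, $x\in A_{pq}$ (functionals on $A_p$ are extended by $0$ to the other components). In particular $f_{p,i}f\in A_p'$ for $f\in A_e'$; since $a\in A$ has only finitely many non-zero components, the sum defining $\varphi_f(a)$ is finite. For a functional $\varphi$ on $A$ and $a\in A$, the multiplier $(\iota\otimes\varphi)\Delta(a)\in M(A)$ is defined by $((\iota\otimes\varphi)\Delta(a))b=(\iota\otimes\varphi)(\Delta(a)(b\otimes1))$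 and $b((\iota\otimes\varphi)\Delta(a))=(\iota\otimes\varphi)((b\otimes1)\Delta(a))$ for $b\in A$. *)

theory Defs
  imports Complex_Main "HOL-Library.Poly_Mapping" "HOL-Algebra.Group"
begin

section \<open>Complex vector spaces and algebras\<close>

class scaleC =
  fixes scaleC :: "complex \<Rightarrow> 'a \<Rightarrow> 'a"  (infixr "*\<^sub>C" 75)

class complex_vector = scaleC + ab_group_add +
  assumes scaleC_right_distrib: "c *\<^sub>C (x + y) = c *\<^sub>C x + c *\<^sub>C y"
    and scaleC_left_distrib: "(c + d) *\<^sub>C x = c *\<^sub>C x + d *\<^sub>C x"
    and scaleC_scaleC: "c *\<^sub>C (d *\<^sub>C x) = (c * d) *\<^sub>C x"
    and scaleC_one: "1 *\<^sub>C x = x"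

text \<open>Algebras are associative; neither commutativity nor a unit is required.\<close>

class complex_algebra = complex_vector + ring +
  assumes mult_scaleC_left: "(c *\<^sub>C x) * y = c *\<^sub>C (x * y)"
    and mult_scaleC_right: "x * (c *\<^sub>C y) = c *\<^sub>C (x * y)"

instantiation complex :: complex_algebra
begin
definition scaleC_complex :: "complex \<Rightarrow> complex \<Rightarrow> complex" where
  "scaleC_complex c x = c * x"
instance by standard (simp_all add: scaleC_complex_def algebra_simps)
end

global_interpretation cvs: vector_space "scaleC :: complex \<Rightarrow> 'a \<Rightarrow> 'a::complex_vector"
  by standard (simp_all add: scaleC_right_distrib scaleC_left_distrib scaleC_scaleC scaleC_one)

abbreviation clinear :: "('a::complex_vector \<Rightarrow> 'b::complex_vector) \<Rightarrow> bool" where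
  "clinear \<equiv> Vector_Spaces.linear scaleC scaleC"

lemma clinear_zero: "clinear f \<Longrightarrow> f 0 = 0"
  by (metis Vector_Spaces.linear_iff cvs.scale_zero_left)

lemma clinear_iff:
  "clinear f \<longleftrightarrow> (\<forall>x y. f (x + y) = f x + f y) \<and> (\<forall>c x. f (c *\<^sub>C x) = c *\<^sub>C f x)"
  by (simp add: Vector_Spaces.linear_iff cvs.vector_space_axioms)

definition cbilinear :: "('a::complex_vector \<Rightarrow> 'b::complex_vector \<Rightarrow> 'c::complex_vector) \<Rightarrow> bool" where
  "cbilinear h \<longleftrightarrow> (\<forall>x. clinear (h x)) \<and> (\<forall>y. clinear (\<lambda>x. h x y))"

definition nondegenerate :: "'a::complex_algebra itself \<Rightarrow> bool" where
  "nondegenerate _ \<longleftrightarrow>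
     (\<forall>a::'a. (\<forall>b. a * b = 0) \<longrightarrow> a = 0) \<and> (\<forall>b::'a. (\<forall>a. a * b = 0) \<longrightarrow> b = 0)"


section \<open>The algebraic tensor product\<close>

text \<open>
  The free vector space on \<open>'a \<times> 'b\<close> modulo the subspace generated by the bilinearity relations.
  All coefficients \<open>c\<close> are admitted in the generators, so that the additive subgroup generated
  by them is automatically a subspace.
\<close>

inductive_set tensor_null :: "('a::complex_vector \<times> 'b::complex_vector \<Rightarrow>\<^sub>0 complex) set" where
  add_left: "Poly_Mapping.single (a + a', b) c - Poly_Mapping.single (a, b) c
      - Poly_Mapping.single (a', b) c \<in> tensor_null"
| add_right: "Poly_Mapping.single (a, b + b') c - Poly_Mapping.single (a, b) c
      - Poly_Mapping.single (a, b') c \<in> tensor_null"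
| scale_left: "Poly_Mapping.single (r *\<^sub>C a, b) c - Poly_Mapping.single (a, b) (r * c) \<in> tensor_null"
| scale_right: "Poly_Mapping.single (a, r *\<^sub>C b) c - Poly_Mapping.single (a, b) (r * c) \<in> tensor_null"
| zero: "0 \<in> tensor_null"
| diff: "x \<in> tensor_null \<Longrightarrow> y \<in> tensor_null \<Longrightarrow> x - y \<in> tensor_null"

lemma tensor_null_uminus: "x \<in> tensor_null \<Longrightarrow> - x \<in> tensor_null"
  using tensor_null.diff[OF tensor_null.zero, of x] by simp

lemma tensor_null_add: "x \<in> tensor_null \<Longrightarrow> y \<in> tensor_null \<Longrightarrow> x + y \<in> tensor_null"
  using tensor_null.diff[of x "- y"] tensor_null_uminus[of y] by simp

definition free_scale :: "complex \<Rightarrow> ('k \<Rightarrow>\<^sub>0 complex) \<Rightarrow> ('k \<Rightarrow>\<^sub>0 complex)" where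
  "free_scale r = Poly_Mapping.map ((*) r)"

lemma lookup_free_scale [simp]: "Poly_Mapping.lookup (free_scale r p) k = r * Poly_Mapping.lookup p k"
  by (simp add: free_scale_def Poly_Mapping.map.rep_eq when_def)

lemma free_scale_diff: "free_scale r (p - q) = free_scale r p - free_scale r q"
  by (rule poly_mapping_eqI) (simp add: lookup_minus right_diff_distrib)

lemma free_scale_add: "free_scale r (p + q) = free_scale r p + free_scale r q"
  by (rule poly_mapping_eqI) (simp add: lookup_add distrib_left)

lemma free_scale_add_left: "free_scale (r + s) p = free_scale r p + free_scale s p"
  by (rule poly_mapping_eqI) (simp add: lookup_add distrib_right)

lemma free_scale_free_scale: "free_scale r (free_scale s p) = free_scale (r * s) p"
  by (rule poly_mapping_eqI) (simp add: mult.assoc)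

lemma free_scale_one: "free_scale 1 p = p"
  by (rule poly_mapping_eqI) simp

lemma free_scale_single [simp]:
  "free_scale r (Poly_Mapping.single k c) = Poly_Mapping.single k (r * c)"
  by (rule poly_mapping_eqI) (simp add: lookup_single when_def)

lemma tensor_null_scale: "x \<in> tensor_null \<Longrightarrow> free_scale r x \<in> tensor_null"
proof (induction rule: tensor_null.induct)
  case (scale_left s a b c)
  then show ?case using tensor_null.scale_left[of s a b "r * c"]
    by (simp add: free_scale_diff mult.left_commute)
next
  case (scale_right a s b c)
  then show ?case using tensor_null.scale_right[of a s b "r * c"]
    by (simp add: free_scale_diff mult.left_commute)
next
  case zero
  have "free_scale r 0 = 0" by (rule poly_mapping_eqI) simp
  then show ?case using tensor_null.zero by metis
qed (auto simp: free_scale_diff intro: tensor_null.intros)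

quotient_type (overloaded) ('a, 'b) tensor  (infixr "\<otimes>" 70) =
  "'a::complex_vector \<times> 'b::complex_vector \<Rightarrow>\<^sub>0 complex" / "\<lambda>p q. p - q \<in> tensor_null"
proof (rule equivpI)
  show "reflp (\<lambda>p q. p - q \<in> tensor_null)"
    by (simp add: reflp_def tensor_null.zero)
  show "symp (\<lambda>p q. p - q \<in> tensor_null)"
    using tensor_null_uminus by (fastforce simp: symp_def)
  show "transp (\<lambda>p q. p - q \<in> tensor_null)"
    using tensor_null_add by (fastforce simp: transp_def)
qed

instantiation tensor :: (complex_vector, complex_vector) complex_vector
begin

lift_definition zero_tensor :: "'a \<otimes> 'b" is 0 .

lift_definition plus_tensor :: "'a \<otimes> 'b \<Rightarrow> 'a \<otimes> 'b \<Rightarrow> 'a \<otimes> 'b" is "(+)"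
  by (metis add_diff_add tensor_null_add)

lift_definition uminus_tensor :: "'a \<otimes> 'b \<Rightarrow> 'a \<otimes> 'b" is uminus
  by (metis minus_diff_eq minus_diff_minus tensor_null_uminus)

lift_definition minus_tensor :: "'a \<otimes> 'b \<Rightarrow> 'a \<otimes> 'b \<Rightarrow> 'a \<otimes> 'b" is "(-)"
proof -
  fix p p' q q' :: "'a \<times> 'b \<Rightarrow>\<^sub>0 complex"
  assume "p - p' \<in> tensor_null" "q - q' \<in> tensor_null"
  then have "(p - p') - (q - q') \<in> tensor_null" by (rule tensor_null.diff)
  then show "p - q - (p' - q') \<in> tensor_null" by (simp add: algebra_simps)
qed

lift_definition scaleC_tensor :: "complex \<Rightarrow> 'a \<otimes> 'b \<Rightarrow> 'a \<otimes> 'b" is free_scale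
  by (metis free_scale_diff tensor_null_scale)

instance
proof
  fix x y z :: "'a \<otimes> 'b" and c d :: complex
  show "x + y + z = x + (y + z)" by transfer (simp add: add.assoc tensor_null.zero)
  show "x + y = y + x" by transfer (simp add: add.commute tensor_null.zero)
  show "0 + x = x" by transfer (simp add: tensor_null.zero)
  show "- x + x = 0" by transfer (simp add: tensor_null.zero)
  show "x - y = x + - y" by transfer (simp add: tensor_null.zero)
  show "c *\<^sub>C (x + y) = c *\<^sub>C x + c *\<^sub>C y"
    by transfer (simp add: free_scale_add tensor_null.zero)
  show "(c + d) *\<^sub>C x = c *\<^sub>C x + d *\<^sub>C x"
    by transfer (simp add: free_scale_add_left tensor_null.zero)
  show "c *\<^sub>C (d *\<^sub>C x) = (c * d) *\<^sub>C x"
    by transfer (simp add: free_scale_free_scale tensor_null.zero)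
  show "1 *\<^sub>C x = x" by transfer (simp add: free_scale_one tensor_null.zero)
qed

end

lift_definition pure_tensor :: "'a::complex_vector \<Rightarrow> 'b::complex_vector \<Rightarrow> 'a \<otimes> 'b"  (infixr "\<otimes>\<^sub>t" 72)
  is "\<lambda>a b. Poly_Mapping.single (a, b) 1" .

lemma pure_tensor_add_right: "x \<otimes>\<^sub>t (y + z) = x \<otimes>\<^sub>t y + x \<otimes>\<^sub>t z"
  using tensor_null.add_right[of x y z 1]
  by (simp add: pure_tensor.abs_eq plus_tensor.abs_eq scaleC_tensor.abs_eq tensor.abs_eq_iff diff_diff_eq)

lemma pure_tensor_add_left: "(x + y) \<otimes>\<^sub>t z = x \<otimes>\<^sub>t z + y \<otimes>\<^sub>t z"
  using tensor_null.add_left[of x y z 1]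
  by (simp add: pure_tensor.abs_eq plus_tensor.abs_eq scaleC_tensor.abs_eq tensor.abs_eq_iff diff_diff_eq)

lemma pure_tensor_scale_right: "x \<otimes>\<^sub>t (c *\<^sub>C y) = c *\<^sub>C (x \<otimes>\<^sub>t y)"
  using tensor_null.scale_right[of x c y 1]
  by (simp add: pure_tensor.abs_eq plus_tensor.abs_eq scaleC_tensor.abs_eq tensor.abs_eq_iff)

lemma pure_tensor_scale_left: "(c *\<^sub>C x) \<otimes>\<^sub>t y = c *\<^sub>C (x \<otimes>\<^sub>t y)"
  using tensor_null.scale_left[of c x y 1]
  by (simp add: pure_tensor.abs_eq plus_tensor.abs_eq scaleC_tensor.abs_eq tensor.abs_eq_iff)

lemmas pure_tensor_linear =
  pure_tensor_add_left pure_tensor_add_right pure_tensor_scale_left pure_tensor_scale_right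

lemma tensor_induct [case_names zero add pure]:
  fixes t :: "'a::complex_vector \<otimes> 'b::complex_vector"
  assumes zero: "P 0" and add: "\<And>s t. P s \<Longrightarrow> P t \<Longrightarrow> P (s + t)" and pure: "\<And>a b. P (a \<otimes>\<^sub>t b)"
  shows "P t"
proof -
  have scaled: "P (c *\<^sub>C (a \<otimes>\<^sub>t b))" for c a b
    using pure[of "c *\<^sub>C a" b] by (simp add: pure_tensor_scale_left)
  have abs_single: "abs_tensor (Poly_Mapping.single (a, b) c) = c *\<^sub>C (a \<otimes>\<^sub>t b)"
    for c and a :: 'a and b :: 'b
    by (simp add: pure_tensor.abs_eq scaleC_tensor.abs_eq)
  have "P (abs_tensor (\<Sum>k\<in>K. Poly_Mapping.single k (Poly_Mapping.lookup p k)))" if "finite K" for K p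
    using that
  proof (induction K)
    case empty
    show ?case using zero by (simp add: zero_tensor_def)
  next
    case (insert k K)
    have "abs_tensor (\<Sum>k\<in>insert k K. Poly_Mapping.single k (Poly_Mapping.lookup p k))
        = Poly_Mapping.lookup p k *\<^sub>C (fst k \<otimes>\<^sub>t snd k)
          + abs_tensor (\<Sum>k\<in>K. Poly_Mapping.single k (Poly_Mapping.lookup p k))"
      using insert.hyps by (cases k) (simp add: plus_tensor.abs_eq abs_single[symmetric])
    then show ?case
      using add[OF scaled insert.IH] by simp
  qed
  note fin = this
  have expand: "(\<Sum>k\<in>Poly_Mapping.keys p. Poly_Mapping.single k (Poly_Mapping.lookup p k)) = p"
    for p :: "'a \<times> 'b \<Rightarrow>\<^sub>0 complex"
  proof (rule poly_mapping_eqI)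
    fix x
    have "Poly_Mapping.lookup (\<Sum>k\<in>Poly_Mapping.keys p. Poly_Mapping.single k (Poly_Mapping.lookup p k)) x
        = (\<Sum>k\<in>Poly_Mapping.keys p. if k = x then Poly_Mapping.lookup p k else 0)"
      unfolding lookup_sum by (intro sum.cong refl) (auto simp: lookup_single when_def)
    also have "\<dots> = Poly_Mapping.lookup p x"
      by (subst sum.delta) (auto simp: not_in_keys_iff_lookup_eq_zero)
    finally show "Poly_Mapping.lookup (\<Sum>k\<in>Poly_Mapping.keys p. Poly_Mapping.single k (Poly_Mapping.lookup p k)) x
        = Poly_Mapping.lookup p x" .
  qed
  have "P (abs_tensor p)" for p
    using fin[OF finite_keys, of p p] unfolding expand .
  then show ?thesis by (induction t rule: tensor.abs_induct)
qed

text \<open>The linear map on \<open>A \<otimes> B\<close> induced by a bilinear map \<open>h\<close>; unspecified if \<open>h\<close> is not bilinear.\<close>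

definition tensor_lift ::
  "('a::complex_vector \<Rightarrow> 'b::complex_vector \<Rightarrow> 'c::complex_vector) \<Rightarrow> 'a \<otimes> 'b \<Rightarrow> 'c" where
  "tensor_lift h = (THE g. clinear g \<and> (\<forall>a b. g (a \<otimes>\<^sub>t b) = h a b))"

lemma tensor_linear_unique:
  assumes "clinear g" "clinear g'" "\<And>a b. g (a \<otimes>\<^sub>t b) = g' (a \<otimes>\<^sub>t b)"
  shows "g t = g' t"
proof (induction t rule: tensor_induct)
  case zero
  show ?case using assms(1,2) by (simp add: clinear_zero)
next
  case (add s t)
  then show ?case using assms(1,2) by (simp add: clinear_iff)
next
  case (pure a b)
  show ?case by (rule assms(3))
qed

lemma tensor_lift_exists:
  fixes h :: "'a::complex_vector \<Rightarrow> 'b::complex_vector \<Rightarrow> 'c::complex_vector"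
  assumes h: "cbilinear h"
  shows "\<exists>!g. clinear g \<and> (\<forall>a b. g (a \<otimes>\<^sub>t b) = h a b)"
proof (rule ex_ex1I)
  define F :: "('a \<times> 'b \<Rightarrow>\<^sub>0 complex) \<Rightarrow> 'c"
    where "F p = (\<Sum>k\<in>Poly_Mapping.keys p. Poly_Mapping.lookup p k *\<^sub>C h (fst k) (snd k))" for p
  have F_super: "F p = (\<Sum>k\<in>K. Poly_Mapping.lookup p k *\<^sub>C h (fst k) (snd k))" if "finite K" "Poly_Mapping.keys p \<subseteq> K" for p K
    unfolding F_def using that
    by (intro sum.mono_neutral_left)
       (auto simp: in_keys_iff simp del: lookup_not_eq_zero_eq_in_keys)
  have F_diff: "F (p - q) = F p - F q" for p q
  proof -
    let ?K = "Poly_Mapping.keys p \<union> Poly_Mapping.keys q \<union> Poly_Mapping.keys (p - q)"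
    have "finite ?K" by simp
    then show ?thesis
      by (subst (1 2 3) F_super[of ?K])
         (auto simp: lookup_minus cvs.scale_left_diff_distrib sum_subtractf)
  qed
  have F_scale: "F (free_scale r p) = r *\<^sub>C F p" for r p
    by (subst F_super[of "Poly_Mapping.keys p"])
       (auto simp: in_keys_iff F_def cvs.scale_sum_right scaleC_scaleC simp del: lookup_not_eq_zero_eq_in_keys)
  have F_single: "F (Poly_Mapping.single (a, b) c) = c *\<^sub>C h a b" for a b c
    by (subst F_super[of "{(a, b)}"]) (auto simp: keys_single)
  have F0: "F 0 = 0" by (simp add: F_def)
  have F_null: "F p = 0" if "p \<in> tensor_null" for p
    using that h
    by induction
       (simp_all add: F_diff F_single F0 cbilinear_def clinear_iff scaleC_scaleC
         scaleC_right_distrib mult.commute)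
  have F_cong: "F p = F q" if "p - q \<in> tensor_null" for p q
    using F_null[OF that] by (simp add: F_diff)
  define g :: "'a \<otimes> 'b \<Rightarrow> 'c" where "g t = F (rep_tensor t)" for t
  have g_abs: "g (abs_tensor p) = F p" for p
    unfolding g_def
    by (rule F_cong) (rule Quotient3_rep_abs[OF Quotient3_tensor], simp add: tensor_null.zero)
  have F_add: "F (p + q) = F p + F q" for p q
    using F_diff[of p "- q"] F_diff[of 0 q] by (simp add: F0)
  have "g (s + t) = g s + g t" for s t
    by (induction s rule: tensor.abs_induct; induction t rule: tensor.abs_induct)
       (simp add: plus_tensor.abs_eq g_abs F_add)
  moreover have "g (c *\<^sub>C t) = c *\<^sub>C g t" for c t
    by (induction t rule: tensor.abs_induct) (simp add: scaleC_tensor.abs_eq g_abs F_scale)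
  moreover have "g (a \<otimes>\<^sub>t b) = h a b" for a b
    by (simp add: pure_tensor.abs_eq g_abs F_single scaleC_one)
  ultimately show "\<exists>g. clinear g \<and> (\<forall>a b. g (a \<otimes>\<^sub>t b) = h a b)"
    by (auto simp: clinear_iff)
next
  fix g g' :: "'a \<otimes> 'b \<Rightarrow> 'c"
  assume g: "clinear g \<and> (\<forall>a b. g (a \<otimes>\<^sub>t b) = h a b)"
    and g': "clinear g' \<and> (\<forall>a b. g' (a \<otimes>\<^sub>t b) = h a b)"
  show "g = g'"
    by (rule ext, rule tensor_linear_unique) (use g g' in simp_all)
qed

lemma
  assumes "cbilinear h"
  shows clinear_tensor_lift: "clinear (tensor_lift h)"
    and tensor_lift_pure: "tensor_lift h (a \<otimes>\<^sub>t b) = h a b"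
  using theI'[OF tensor_lift_exists[OF assms]] by (simp_all add: tensor_lift_def)

definition tensor_map :: "('a::complex_vector \<Rightarrow> 'c::complex_vector) \<Rightarrow> ('b::complex_vector \<Rightarrow> 'd::complex_vector)
    \<Rightarrow> 'a \<otimes> 'b \<Rightarrow> 'c \<otimes> 'd" where
  "tensor_map f g = tensor_lift (\<lambda>a b. f a \<otimes>\<^sub>t g b)"

lemma cbilinear_tensor_map:
  "clinear f \<Longrightarrow> clinear g \<Longrightarrow> cbilinear (\<lambda>a b. f a \<otimes>\<^sub>t g b)"
  by (simp add: cbilinear_def clinear_iff pure_tensor_linear)

lemma clinear_tensor_map: "clinear f \<Longrightarrow> clinear g \<Longrightarrow> clinear (tensor_map f g)"
  unfolding tensor_map_def by (rule clinear_tensor_lift[OF cbilinear_tensor_map])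

lemma tensor_map_pure: "clinear f \<Longrightarrow> clinear g \<Longrightarrow> tensor_map f g (a \<otimes>\<^sub>t b) = f a \<otimes>\<^sub>t g b"
  unfolding tensor_map_def by (rule tensor_lift_pure[OF cbilinear_tensor_map])

lemma clinear_times: "clinear ((*) (a :: 'a::complex_algebra))"
  by (simp add: clinear_iff distrib_left mult_scaleC_right)

lemma cbilinear_left_mult:
  "cbilinear (\<lambda>(a :: 'a::complex_algebra) (b :: 'b::complex_algebra). tensor_map ((*) a) ((*) b) t)"
proof -
  have rhs: "clinear (tensor_map ((*) a) ((*) b))" for a :: 'a and b :: 'b
    by (intro clinear_tensor_map clinear_times)
  have pp: "tensor_map ((*) a) ((*) b) (c \<otimes>\<^sub>t d) = (a * c) \<otimes>\<^sub>t (b * d)" for a c :: 'a and b d :: 'b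
    by (simp add: tensor_map_pure clinear_times)
  have sum_lin: "clinear (\<lambda>t. f t + g t)" if "clinear f" "clinear g" for f g :: "'a \<otimes> 'b \<Rightarrow> 'a \<otimes> 'b"
    using that by (simp add: clinear_iff scaleC_right_distrib ac_simps)
  have scale_lin: "clinear (\<lambda>t. c *\<^sub>C f t)" if "clinear f" for f :: "'a \<otimes> 'b \<Rightarrow> 'a \<otimes> 'b" and c
    using that by (simp add: clinear_iff scaleC_right_distrib scaleC_scaleC mult.commute)
  have add_l: "tensor_map ((*) (a + a')) ((*) b) t
      = tensor_map ((*) a) ((*) b) t + tensor_map ((*) a') ((*) b) t" for a a' :: 'a and b :: 'b and t
    by (rule tensor_linear_unique[OF rhs sum_lin[OF rhs rhs]]) (unfold pp, simp add: distrib_right pure_tensor_linear)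
  have add_r: "tensor_map ((*) a) ((*) (b + b')) t
      = tensor_map ((*) a) ((*) b) t + tensor_map ((*) a) ((*) b') t" for a :: 'a and b b' :: 'b and t
    by (rule tensor_linear_unique[OF rhs sum_lin[OF rhs rhs]]) (unfold pp, simp add: distrib_right pure_tensor_linear)
  have sc_l: "tensor_map ((*) (c *\<^sub>C a)) ((*) b) t
      = c *\<^sub>C tensor_map ((*) a) ((*) b) t" for c and a :: 'a and b :: 'b and t
    by (rule tensor_linear_unique[OF rhs scale_lin[OF rhs]]) (unfold pp, simp add: mult_scaleC_left pure_tensor_linear)
  have sc_r: "tensor_map ((*) a) ((*) (c *\<^sub>C b)) t
      = c *\<^sub>C tensor_map ((*) a) ((*) b) t" for c and a :: 'a and b :: 'b and t
    by (rule tensor_linear_unique[OF rhs scale_lin[OF rhs]]) (unfold pp, simp add: mult_scaleC_left pure_tensor_linear)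
  show ?thesis
    by (simp add: cbilinear_def clinear_iff add_l add_r sc_l sc_r)
qed

instantiation tensor :: (complex_algebra, complex_algebra) complex_algebra
begin

definition times_tensor :: "'a \<otimes> 'b \<Rightarrow> 'a \<otimes> 'b \<Rightarrow> 'a \<otimes> 'b" where
  "s * t = tensor_lift (\<lambda>a b. tensor_map ((*) a) ((*) b) t) s"

lemma times_pure_tensor_left: "(a \<otimes>\<^sub>t b) * t = tensor_map ((*) a) ((*) b) t" for a :: 'a and b :: 'b
  unfolding times_tensor_def by (rule tensor_lift_pure[OF cbilinear_left_mult])

lemma times_pure_tensor: "(a \<otimes>\<^sub>t b) * (c \<otimes>\<^sub>t d) = (a * c) \<otimes>\<^sub>t (b * d)"
  for a c :: 'a and b d :: 'b
  by (simp add: times_pure_tensor_left tensor_map_pure clinear_times)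

instance
proof
  have L: "clinear (\<lambda>s. s * t)" for t :: "'a \<otimes> 'b"
    unfolding times_tensor_def using clinear_tensor_lift[OF cbilinear_left_mult] .
  have rhs: "clinear (tensor_map ((*) a) ((*) b))" for a :: 'a and b :: 'b
    by (intro clinear_tensor_map clinear_times)
  have L0: "0 * t = 0" for t :: "'a \<otimes> 'b"
    using clinear_zero[OF L[of t]] .
  have La: "(s + s') * t = s * t + s' * t" and Ls: "(c *\<^sub>C s) * t = c *\<^sub>C (s * t)"
    for s s' t :: "'a \<otimes> 'b" and c
    using L[of t] by (simp_all add: clinear_iff)
  have Ra: "s * (t + t') = s * t + s * t'" for s t t' :: "'a \<otimes> 'b"
    by (induction s rule: tensor_induct)
       (use rhs in \<open>simp_all add: L0 La times_pure_tensor_left clinear_iff ac_simps\<close>)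
  have Rs: "s * (c *\<^sub>C t) = c *\<^sub>C (s * t)" for s t :: "'a \<otimes> 'b" and c
    by (induction s rule: tensor_induct)
       (use rhs in \<open>simp_all add: L0 La times_pure_tensor_left clinear_iff scaleC_right_distrib\<close>)
  have R0: "s * 0 = 0" for s :: "'a \<otimes> 'b"
    using Rs[of s 0 0] by simp
  have a1: "(a \<otimes>\<^sub>t b) * (c \<otimes>\<^sub>t d) * z = (a \<otimes>\<^sub>t b) * ((c \<otimes>\<^sub>t d) * z)"
    for a c :: 'a and b d :: 'b and z
    by (induction z rule: tensor_induct) (simp_all add: R0 Ra times_pure_tensor mult.assoc)
  have a2: "(a \<otimes>\<^sub>t b) * y * z = (a \<otimes>\<^sub>t b) * (y * z)" for a :: 'a and b :: 'b and y z
    by (induction y rule: tensor_induct) (simp_all add: L0 R0 La Ra a1)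
  have a3: "x * y * z = x * (y * z)" for x y z :: "'a \<otimes> 'b"
    by (induction x rule: tensor_induct) (simp_all add: L0 La a2)
  fix x y z :: "'a \<otimes> 'b" and c :: complex
  show "(x + y) * z = x * z + y * z" by (rule La)
  show "x * (y + z) = x * y + x * z" by (rule Ra)
  show "(c *\<^sub>C x) * y = c *\<^sub>C (x * y)" by (rule Ls)
  show "x * (c *\<^sub>C y) = c *\<^sub>C (x * y)" by (rule Rs)
  show "x * y * z = x * (y * z)" by (rule a3)
qed

end


section \<open>The multiplier algebra\<close>

text \<open>
  A multiplier \<open>m\<close> of \<open>A\<close> is a pair of linear maps \<open>b \<mapsto> m b\<close> and \<open>b \<mapsto> b m\<close> on \<open>A\<close>
  with \<open>a (m b) = (a m) b\<close>.
\<close>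

typedef (overloaded) 'a multiplier =
  "{(l :: 'a::complex_algebra \<Rightarrow> 'a, r :: 'a \<Rightarrow> 'a).
     clinear l \<and> clinear r \<and> (\<forall>a b. a * l b = r a * b)}"
  by (rule exI[of _ "(id, id)"]) (simp add: clinear_iff)

setup_lifting type_definition_multiplier

lift_definition left_act :: "'a::complex_algebra multiplier \<Rightarrow> 'a \<Rightarrow> 'a" is fst .

lift_definition right_act :: "'a::complex_algebra multiplier \<Rightarrow> 'a \<Rightarrow> 'a" is snd .

lemma multiplier_eqI:
  "(\<And>b. left_act m b = left_act m' b) \<Longrightarrow> (\<And>b. right_act m b = right_act m' b) \<Longrightarrow> m = m'"
  by transfer (auto simp: prod_eq_iff fun_eq_iff)

lemma clinear_left_act: "clinear (left_act m)"
  and clinear_right_act: "clinear (right_act m)"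
  and multiplier_assoc: "a * left_act m b = right_act m a * b"
  by (transfer; auto)+

instantiation multiplier :: (complex_algebra) "{complex_algebra, monoid_mult}"
begin

lift_definition zero_multiplier :: "'a multiplier" is "(\<lambda>_. 0, \<lambda>_. 0)"
  by (simp add: clinear_iff)

lift_definition one_multiplier :: "'a multiplier" is "(id, id)"
  by (simp add: clinear_iff)

lift_definition plus_multiplier :: "'a multiplier \<Rightarrow> 'a multiplier \<Rightarrow> 'a multiplier"
  is "\<lambda>m m'. (\<lambda>b. fst m b + fst m' b, \<lambda>b. snd m b + snd m' b)"
  by (auto simp: clinear_iff scaleC_right_distrib distrib_left distrib_right ac_simps)

lift_definition minus_multiplier :: "'a multiplier \<Rightarrow> 'a multiplier \<Rightarrow> 'a multiplier"
  is "\<lambda>m m'. (\<lambda>b. fst m b - fst m' b, \<lambda>b. snd m b - snd m' b)"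
  by (auto simp: clinear_iff cvs.scale_right_diff_distrib left_diff_distrib right_diff_distrib)

lift_definition uminus_multiplier :: "'a multiplier \<Rightarrow> 'a multiplier"
  is "\<lambda>m. (\<lambda>b. - fst m b, \<lambda>b. - snd m b)"
  by (auto simp: clinear_iff)

lift_definition scaleC_multiplier :: "complex \<Rightarrow> 'a multiplier \<Rightarrow> 'a multiplier"
  is "\<lambda>c m. (\<lambda>b. c *\<^sub>C fst m b, \<lambda>b. c *\<^sub>C snd m b)"
  by (auto simp: clinear_iff scaleC_right_distrib scaleC_scaleC mult.commute
      mult_scaleC_left mult_scaleC_right)

lift_definition times_multiplier :: "'a multiplier \<Rightarrow> 'a multiplier \<Rightarrow> 'a multiplier"
  is "\<lambda>m m'. (fst m \<circ> fst m', snd m' \<circ> snd m)"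
  by (auto simp: clinear_iff)

lemma left_act_simps:
  "left_act (0 :: 'a multiplier) b = 0"
  "left_act (1 :: 'a multiplier) b = b"
  "left_act (m + m') b = left_act m b + left_act m' b"
  "left_act (m - m') b = left_act m b - left_act m' b"
  "left_act (- m) b = - left_act m b"
  "left_act (c *\<^sub>C m) b = c *\<^sub>C left_act m b"
  "left_act (m * m') b = left_act m (left_act m' b)"
  by (transfer, simp)+

lemma right_act_simps:
  "right_act (0 :: 'a multiplier) b = 0"
  "right_act (1 :: 'a multiplier) b = b"
  "right_act (m + m') b = right_act m b + right_act m' b"
  "right_act (m - m') b = right_act m b - right_act m' b"
  "right_act (- m) b = - right_act m b"
  "right_act (c *\<^sub>C m) b = c *\<^sub>C right_act m b"
  "right_act (m * m') b = right_act m' (right_act m b)"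
  by (transfer, simp)+

instance
proof intro_classes
  fix x y z :: "'a multiplier" and c d :: complex
  note act = left_act_simps right_act_simps
  have lin: "left_act x (a + b) = left_act x a + left_act x b"
    "right_act x (a + b) = right_act x a + right_act x b"
    "left_act x (c *\<^sub>C a) = c *\<^sub>C left_act x a"
    "right_act x (c *\<^sub>C a) = c *\<^sub>C right_act x a" for x :: "'a multiplier" and a b c
    using clinear_left_act[of x] clinear_right_act[of x] by (simp_all add: clinear_iff)
  show "x + y + z = x + (y + z)" by (rule multiplier_eqI) (simp_all add: act add.assoc)
  show "x + y = y + x" by (rule multiplier_eqI) (simp_all add: act add.commute)
  show "0 + x = x" by (rule multiplier_eqI) (simp_all add: act)
  show "- x + x = 0" by (rule multiplier_eqI) (simp_all add: act)
  show "x - y = x + - y" by (rule multiplier_eqI) (simp_all add: act)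
  show "c *\<^sub>C (x + y) = c *\<^sub>C x + c *\<^sub>C y"
    by (rule multiplier_eqI) (simp_all add: act scaleC_right_distrib)
  show "(c + d) *\<^sub>C x = c *\<^sub>C x + d *\<^sub>C x"
    by (rule multiplier_eqI) (simp_all add: act scaleC_left_distrib)
  show "c *\<^sub>C (d *\<^sub>C x) = (c * d) *\<^sub>C x"
    by (rule multiplier_eqI) (simp_all add: act scaleC_scaleC)
  show "1 *\<^sub>C x = x" by (rule multiplier_eqI) (simp_all add: act scaleC_one)
  show "x * y * z = x * (y * z)" by (rule multiplier_eqI) (simp_all add: act)
  show "(x + y) * z = x * z + y * z" by (rule multiplier_eqI) (simp_all add: act lin)
  show "x * (y + z) = x * y + x * z" by (rule multiplier_eqI) (simp_all add: act lin)
  show "(c *\<^sub>C x) * y = c *\<^sub>C (x * y)" by (rule multiplier_eqI) (simp_all add: act lin)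
  show "x * (c *\<^sub>C y) = c *\<^sub>C (x * y)" by (rule multiplier_eqI) (simp_all add: act lin)
  show "1 * x = x" by (rule multiplier_eqI) (simp_all add: act)
  show "x * 1 = x" by (rule multiplier_eqI) (simp_all add: act)
qed

end

text \<open>The canonical map \<open>A \<rightarrow> M(A)\<close>, injective if the product is non-degenerate, and its inverse.\<close>

lift_definition to_mult :: "'a::complex_algebra \<Rightarrow> 'a multiplier"
  is "\<lambda>a. ((*) a, \<lambda>b. b * a)"
  by (auto simp: clinear_iff distrib_left distrib_right mult_scaleC_left mult_scaleC_right mult.assoc)

definition from_mult :: "'a::complex_algebra multiplier \<Rightarrow> 'a" where
  "from_mult m = (THE a. to_mult a = m)"

lemma left_act_to_mult: "left_act (to_mult a) b = a * b"
  and right_act_to_mult: "right_act (to_mult a) b = b * a"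
  by (transfer, simp)+

lemma inj_to_mult:
  assumes "nondegenerate TYPE('a::complex_algebra)"
  shows "inj (to_mult :: 'a \<Rightarrow> 'a multiplier)"
proof (rule injI)
  fix a a' :: 'a
  assume "to_mult a = to_mult a'"
  then have "(a - a') * b = 0" for b
    using left_act_to_mult[of a b] left_act_to_mult[of a' b] by (simp add: left_diff_distrib)
  then show "a = a'" using assms unfolding nondegenerate_def by (metis right_minus_eq)
qed

lemma from_mult_to_mult:
  "nondegenerate TYPE('a::complex_algebra) \<Longrightarrow> from_mult (to_mult a) = (a :: 'a)"
  unfolding from_mult_def by (rule the_equality) (auto dest: inj_to_mult injD)

text \<open>The multiplier \<open>m \<otimes> n\<close> of \<open>A \<otimes> B\<close> for multipliers \<open>m\<close> of \<open>A\<close> and \<open>n\<close> of \<open>B\<close>.\<close>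

lift_definition mult_tensor ::
  "'a::complex_algebra multiplier \<Rightarrow> 'b::complex_algebra multiplier \<Rightarrow> ('a \<otimes> 'b) multiplier"
  is "\<lambda>m n. (tensor_map (fst m) (fst n), tensor_map (snd m) (snd n))"
proof -
  fix m :: "('a \<Rightarrow> 'a) \<times> ('a \<Rightarrow> 'a)" and n :: "('b \<Rightarrow> 'b) \<times> ('b \<Rightarrow> 'b)"
  obtain l r l' r' where mn: "m = (l, r)" "n = (l', r')" by (cases m; cases n)
  assume "m \<in> {(l, r). clinear l \<and> clinear r \<and> (\<forall>a b. a * l b = r a * b)}"
    and "n \<in> {(l, r). clinear l \<and> clinear r \<and> (\<forall>a b. a * l b = r a * b)}"
  then have lin: "clinear l" "clinear r" "clinear l'" "clinear r'"
    and assoc: "\<And>a b. a * l b = r a * b" "\<And>a b. a * l' b = r' a * b"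
    by (auto simp: mn)
  have L: "clinear (tensor_map l l')" and R: "clinear (tensor_map r r')"
    using lin by (auto intro: clinear_tensor_map)
  note add = L[unfolded clinear_iff, THEN conjunct1, rule_format]
    R[unfolded clinear_iff, THEN conjunct1, rule_format]
  have "(a \<otimes>\<^sub>t b) * tensor_map l l' t = tensor_map r r' (a \<otimes>\<^sub>t b) * t" for a b t
    by (induction t rule: tensor_induct)
       (simp_all add: clinear_zero[OF L] add distrib_left tensor_map_pure lin times_pure_tensor assoc)
  then have "s * tensor_map l l' t = tensor_map r r' s * t" for s t
    by (induction s rule: tensor_induct)
       (simp_all add: clinear_zero[OF R] add distrib_right)
  then show "(tensor_map (fst m) (fst n), tensor_map (snd m) (snd n))
      \<in> {(l, r). clinear l \<and> clinear r \<and> (\<forall>a b. a * l b = r a * b)}"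
    using L R by (simp add: mn)
qed

text \<open>The isomorphism \<open>M(A) \<rightarrow> M(B)\<close> induced by an isomorphism \<open>\<phi>: A \<rightarrow> B\<close> of algebras.\<close>

definition mult_transport ::
  "('a::complex_algebra \<Rightarrow> 'b::complex_algebra) \<Rightarrow> 'a multiplier \<Rightarrow> 'b multiplier" where
  "mult_transport \<phi> m =
     Abs_multiplier (\<phi> \<circ> left_act m \<circ> inv_into UNIV \<phi>, \<phi> \<circ> right_act m \<circ> inv_into UNIV \<phi>)"

lemma mult_transport_act:
  assumes lin: "clinear \<phi>" and bij: "bij \<phi>" and mult: "\<And>a b. \<phi> (a * b) = \<phi> a * \<phi> b"
  shows "left_act (mult_transport \<phi> m) (\<phi> b) = \<phi> (left_act m b)"
    and "right_act (mult_transport \<phi> m) (\<phi> b) = \<phi> (right_act m b)"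
proof -
  let ?i = "inv_into UNIV \<phi>"
  have i: "?i (\<phi> x) = x" "\<phi> (?i y) = y" for x y
    by (rule inv_f_f[OF bij_is_inj[OF bij]], rule surj_f_inv_f[OF bij_is_surj[OF bij]])
  have i_lin: "?i (x + y) = ?i x + ?i y" "?i (c *\<^sub>C x) = c *\<^sub>C ?i x" for x y c
    using lin i(1)[of "?i x + ?i y"] i(1)[of "c *\<^sub>C ?i x"] by (simp_all add: clinear_iff i(2))
  have "clinear (\<phi> \<circ> left_act m \<circ> ?i)" "clinear (\<phi> \<circ> right_act m \<circ> ?i)"
    using lin clinear_left_act[of m] clinear_right_act[of m] by (simp_all add: clinear_iff i_lin)
  moreover have "a * \<phi> (left_act m (?i b)) = \<phi> (right_act m (?i a)) * b" for a b
    using arg_cong[OF multiplier_assoc[of "?i a" m "?i b"], of \<phi>] by (simp add: mult i(2))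
  ultimately have "Rep_multiplier (mult_transport \<phi> m)
      = (\<phi> \<circ> left_act m \<circ> ?i, \<phi> \<circ> right_act m \<circ> ?i)"
    unfolding mult_transport_def by (intro Abs_multiplier_inverse) simp
  then show "left_act (mult_transport \<phi> m) (\<phi> b) = \<phi> (left_act m b)"
    "right_act (mult_transport \<phi> m) (\<phi> b) = \<phi> (right_act m b)"
    by (simp_all add: left_act.rep_eq right_act.rep_eq i)
qed

definition tensor_flip :: "'a::complex_vector \<otimes> 'b::complex_vector \<Rightarrow> 'b \<otimes> 'a" where
  "tensor_flip = tensor_lift (\<lambda>a b. b \<otimes>\<^sub>t a)"

definition tensor_assoc ::
  "('a::complex_vector \<otimes> 'b::complex_vector) \<otimes> 'c::complex_vector \<Rightarrow> 'a \<otimes> ('b \<otimes> 'c)" where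
  "tensor_assoc = tensor_lift (\<lambda>s c. tensor_lift (\<lambda>a b. a \<otimes>\<^sub>t (b \<otimes>\<^sub>t c)) s)"

lemma clinear_tensor_flip: "clinear tensor_flip"
  and tensor_flip_pure [simp]: "tensor_flip (a \<otimes>\<^sub>t b) = b \<otimes>\<^sub>t a"
proof -
  show "clinear (tensor_flip :: 'a \<otimes> 'b \<Rightarrow> _)"
    unfolding tensor_flip_def by (rule clinear_tensor_lift)
      (simp add: cbilinear_def clinear_iff pure_tensor_linear)
  show "tensor_flip (a \<otimes>\<^sub>t b) = b \<otimes>\<^sub>t a"
    unfolding tensor_flip_def by (rule tensor_lift_pure)
      (simp add: cbilinear_def clinear_iff pure_tensor_linear)
qed

lemma cbilinear_tensor_assoc:
  "cbilinear (\<lambda>(s :: 'a::complex_vector \<otimes> 'b::complex_vector) (c :: 'c::complex_vector).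
      tensor_lift (\<lambda>a b. a \<otimes>\<^sub>t (b \<otimes>\<^sub>t c)) s)"
proof -
  define F :: "'c \<Rightarrow> 'a \<otimes> 'b \<Rightarrow> 'a \<otimes> ('b \<otimes> 'c)"
    where "F c = tensor_lift (\<lambda>a b. a \<otimes>\<^sub>t (b \<otimes>\<^sub>t c))" for c
  have bil: "cbilinear (\<lambda>(a :: 'a) (b :: 'b). a \<otimes>\<^sub>t (b \<otimes>\<^sub>t c))" for c :: 'c
    by (simp add: cbilinear_def clinear_iff pure_tensor_linear)
  have pure: "F c (a \<otimes>\<^sub>t b) = a \<otimes>\<^sub>t (b \<otimes>\<^sub>t c)" for a b c
    unfolding F_def by (rule tensor_lift_pure[OF bil])
  have lin: "clinear (F c)" for c
    unfolding F_def by (rule clinear_tensor_lift[OF bil])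
  have F: "F c 0 = 0" "F c (s + t) = F c s + F c t" "F c (r *\<^sub>C s) = r *\<^sub>C F c s" for c s t r
    using lin[of c] by (simp_all add: clinear_zero clinear_iff)
  have "F (c + c') s = F c s + F c' s" for c c' s
    by (induction s rule: tensor_induct) (simp_all add: F pure pure_tensor_linear)
  moreover have "F (r *\<^sub>C c) s = r *\<^sub>C F c s" for r c s
    by (induction s rule: tensor_induct) (simp_all add: F pure pure_tensor_linear scaleC_right_distrib)
  ultimately show ?thesis
    by (simp add: cbilinear_def clinear_iff F flip: F_def)
qed

lemma clinear_tensor_assoc: "clinear tensor_assoc"
  unfolding tensor_assoc_def by (rule clinear_tensor_lift[OF cbilinear_tensor_assoc])

lemma tensor_assoc_pure [simp]: "tensor_assoc ((a \<otimes>\<^sub>t b) \<otimes>\<^sub>t c) = a \<otimes>\<^sub>t (b \<otimes>\<^sub>t c)"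
  unfolding tensor_assoc_def
  by (simp add: tensor_lift_pure[OF cbilinear_tensor_assoc] tensor_lift_pure cbilinear_def
      clinear_iff pure_tensor_linear)


section \<open>Multiplier Hopf algebras\<close>

type_synonym 'a comult = "'a \<Rightarrow> ('a \<otimes> 'a) multiplier"

text \<open>\<open>\<Delta>(a)(1 \<otimes> b)\<close> and \<open>(a \<otimes> 1)\<Delta>(b)\<close> as elements of \<open>A \<otimes> A\<close>.\<close>

definition comult_r :: "'a::complex_algebra comult \<Rightarrow> 'a \<Rightarrow> 'a \<Rightarrow> 'a \<otimes> 'a" where
  "comult_r \<Delta> a b = from_mult (\<Delta> a * mult_tensor 1 (to_mult b))"

definition comult_l :: "'a::complex_algebra comult \<Rightarrow> 'a \<Rightarrow> 'a \<Rightarrow> 'a \<otimes> 'a" where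
  "comult_l \<Delta> a b = from_mult (mult_tensor (to_mult a) 1 * \<Delta> b)"

text \<open>\<open>\<Delta> \<otimes> \<iota>\<close> and \<open>\<iota> \<otimes> \<Delta>\<close> as maps from \<open>A \<otimes> A\<close> to the multipliers of the triple tensor product.\<close>

definition comult_id :: "'a::complex_algebra comult \<Rightarrow> 'a \<otimes> 'a \<Rightarrow> (('a \<otimes> 'a) \<otimes> 'a) multiplier" where
  "comult_id \<Delta> = tensor_lift (\<lambda>x y. mult_tensor (\<Delta> x) (to_mult y))"

definition id_comult :: "'a::complex_algebra comult \<Rightarrow> 'a \<otimes> 'a \<Rightarrow> ('a \<otimes> ('a \<otimes> 'a)) multiplier" where
  "id_comult \<Delta> = tensor_lift (\<lambda>x y. mult_tensor (to_mult x) (\<Delta> y))"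

definition multiplier_hopf_algebra :: "'a::complex_algebra comult \<Rightarrow> bool" where
  "multiplier_hopf_algebra \<Delta> \<longleftrightarrow>
     nondegenerate TYPE('a) \<and>
     clinear \<Delta> \<and> (\<forall>a b. \<Delta> (a * b) = \<Delta> a * \<Delta> b) \<and>
     (\<forall>a b. \<Delta> a * mult_tensor 1 (to_mult b) \<in> range to_mult) \<and>
     (\<forall>a b. mult_tensor (to_mult a) 1 * \<Delta> b \<in> range to_mult) \<and>
     (\<forall>a b c.
        mult_transport tensor_assoc
          (mult_tensor (mult_tensor (to_mult a) 1) 1 * comult_id \<Delta> (comult_r \<Delta> b c))
        = id_comult \<Delta> (comult_l \<Delta> a b) * mult_tensor 1 (mult_tensor 1 (to_mult c))) \<and>
     bij (tensor_lift (comult_r \<Delta>)) \<and> bij (tensor_lift (comult_l \<Delta>))"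

definition co_opposite :: "'a::complex_algebra comult \<Rightarrow> 'a comult" where
  "co_opposite \<Delta> a = mult_transport tensor_flip (\<Delta> a)"

definition regular_multiplier_hopf_algebra :: "'a::complex_algebra comult \<Rightarrow> bool" where
  "regular_multiplier_hopf_algebra \<Delta> \<longleftrightarrow>
     multiplier_hopf_algebra \<Delta> \<and> multiplier_hopf_algebra (co_opposite \<Delta>)"

definition is_counit :: "'a::complex_algebra comult \<Rightarrow> ('a \<Rightarrow> complex) \<Rightarrow> bool" where
  "is_counit \<Delta> \<epsilon> \<longleftrightarrow>
     clinear \<epsilon> \<and> (\<forall>a b. \<epsilon> (a * b) = \<epsilon> a * \<epsilon> b) \<and>
     (\<forall>a b. tensor_lift (\<lambda>x y. \<epsilon> x *\<^sub>C y) (comult_r \<Delta> a b) = a * b) \<and>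
     (\<forall>a b. tensor_lift (\<lambda>x y. \<epsilon> y *\<^sub>C x) (comult_l \<Delta> a b) = a * b)"

definition is_antipode ::
  "'a::complex_algebra comult \<Rightarrow> ('a \<Rightarrow> complex) \<Rightarrow> ('a \<Rightarrow> 'a multiplier) \<Rightarrow> bool" where
  "is_antipode \<Delta> \<epsilon> S \<longleftrightarrow>
     clinear S \<and> (\<forall>a b. S (a * b) = S b * S a) \<and>
     (\<forall>a b. tensor_lift left_act (tensor_map S id (comult_r \<Delta> a b)) = \<epsilon> a *\<^sub>C b) \<and>
     (\<forall>a b. tensor_lift (\<lambda>x m. right_act m x) (tensor_map id S (comult_l \<Delta> b a)) = \<epsilon> a *\<^sub>C b)"

text \<open>For a regular multiplier Hopf algebra the antipode takes values in \<open>A\<close>, so it can be iterated.\<close>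

definition antipode_sq :: "('a::complex_algebra \<Rightarrow> 'a multiplier) \<Rightarrow> 'a \<Rightarrow> 'a" where
  "antipode_sq S x = from_mult (S (from_mult (S x)))"

text \<open>
  The multiplier \<open>(\<iota> \<otimes> \<phi>)\<Delta>(a)\<close>, determined by its left and right action on \<open>A\<close>; the elements
  \<open>\<Delta>(a)(b \<otimes> 1)\<close> and \<open>(b \<otimes> 1)\<Delta>(a)\<close> are in \<open>A \<otimes> A\<close> in the regular case.
\<close>

definition slice_comult :: "'a::complex_algebra comult \<Rightarrow> ('a \<Rightarrow> complex) \<Rightarrow> 'a \<Rightarrow> 'a multiplier" where
  "slice_comult \<Delta> \<phi> a = (THE m. \<forall>b.
     left_act m b = tensor_lift (\<lambda>x y. \<phi> y *\<^sub>C x) (from_mult (\<Delta> a * mult_tensor (to_mult b) 1)) \<and>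
     right_act m b = tensor_lift (\<lambda>x y. \<phi> y *\<^sub>C x) (from_mult (mult_tensor (to_mult b) 1 * \<Delta> a)))"

definition left_invariant :: "'a::complex_algebra comult \<Rightarrow> ('a \<Rightarrow> complex) \<Rightarrow> bool" where
  "left_invariant \<Delta> \<phi> \<longleftrightarrow> clinear \<phi> \<and> (\<forall>a. slice_comult \<Delta> \<phi> a = \<phi> a *\<^sub>C 1)"


section \<open>Group-cograded multiplier Hopf algebras\<close>

definition tensor_sub :: "'a::complex_vector set \<Rightarrow> 'b::complex_vector set \<Rightarrow> ('a \<otimes> 'b) set" where
  "tensor_sub U V = cvs.span {x \<otimes>\<^sub>t y | x y. x \<in> U \<and> y \<in> V}"

definition decomposes :: "'g set \<Rightarrow> ('g \<Rightarrow> 'a::complex_vector set) \<Rightarrow> 'a \<Rightarrow> ('g \<Rightarrow> 'a) \<Rightarrow> bool" where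
  "decomposes I A x c \<longleftrightarrow>
     (\<forall>p\<in>I. c p \<in> A p) \<and> (\<forall>p. p \<notin> I \<longrightarrow> c p = 0) \<and> finite {p. c p \<noteq> 0} \<and> x = Sum_any c"

definition direct_sum :: "'g set \<Rightarrow> ('g \<Rightarrow> 'a::complex_vector set) \<Rightarrow> bool" where
  "direct_sum I A \<longleftrightarrow> (\<forall>p\<in>I. cvs.subspace (A p)) \<and> (\<forall>x. \<exists>!c. decomposes I A x c)"

definition component :: "'g set \<Rightarrow> ('g \<Rightarrow> 'a::complex_vector set) \<Rightarrow> 'g \<Rightarrow> 'a \<Rightarrow> 'a" where
  "component I A p x = (THE c. decomposes I A x c) p"

definition cograded ::
  "('g, 'm) monoid_scheme \<Rightarrow> ('g \<Rightarrow> 'a::complex_algebra set) \<Rightarrow> 'a comult \<Rightarrow> bool" where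
  "cograded G A \<Delta> \<longleftrightarrow>
     direct_sum (carrier G) A \<and>
     (\<forall>p\<in>carrier G. A p \<noteq> {0} \<and> (\<forall>x\<in>A p. \<forall>y\<in>A p. x * y \<in> A p)) \<and>
     (\<forall>p\<in>carrier G. \<forall>q\<in>carrier G. p \<noteq> q \<longrightarrow> (\<forall>x\<in>A p. \<forall>y\<in>A q. x * y = 0)) \<and>
     (\<forall>p\<in>carrier G. \<forall>q\<in>carrier G.
        cvs.span {\<Delta> a * mult_tensor 1 (to_mult b) | a b. a \<in> A (p \<otimes>\<^bsub>G\<^esub> q) \<and> b \<in> A q}
          = to_mult ` tensor_sub (A p) (A q) \<and>
        cvs.span {mult_tensor (to_mult b) 1 * \<Delta> a | a b. a \<in> A (p \<otimes>\<^bsub>G\<^esub> q) \<and> b \<in> A p}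
          = to_mult ` tensor_sub (A p) (A q))"

text \<open>
  The element of \<open>A\<^sub>p \<otimes> A\<^sub>q\<close> that represents the \<open>(p,q)\<close>-component of the multiplier \<open>\<Delta>(x)\<close>,
  that is, its restriction to \<open>A\<^sub>p \<otimes> A\<^sub>q\<close>.
\<close>

definition comult_component ::
  "('g \<Rightarrow> 'a::complex_algebra set) \<Rightarrow> 'a comult \<Rightarrow> 'g \<Rightarrow> 'g \<Rightarrow> 'a \<Rightarrow> 'a \<otimes> 'a" where
  "comult_component A \<Delta> p q x = (THE z. z \<in> tensor_sub (A p) (A q) \<and>
     (\<forall>w\<in>tensor_sub (A p) (A q). left_act (\<Delta> x) w = z * w \<and> right_act (\<Delta> x) w = w * z))"

text \<open>The dual of \<open>A\<^sub>p\<close>; its elements are extended by \<open>0\<close> to the other components.\<close>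

definition component_dual ::
  "'g set \<Rightarrow> ('g \<Rightarrow> 'a::complex_vector set) \<Rightarrow> 'g \<Rightarrow> ('a \<Rightarrow> complex) set" where
  "component_dual I A p = {f. clinear f \<and> (\<forall>q\<in>I. q \<noteq> p \<longrightarrow> (\<forall>x\<in>A q. f x = 0))}"

text \<open>The product of \<open>f \<in> A\<^sub>p'\<close> and \<open>g \<in> A\<^sub>q'\<close> in \<open>A\<^bsub>pq\<^esub>'\<close>.\<close>

definition dual_mult ::
  "('g, 'm) monoid_scheme \<Rightarrow> ('g \<Rightarrow> 'a::complex_algebra set) \<Rightarrow> 'a comult \<Rightarrow> 'g \<Rightarrow> 'g
    \<Rightarrow> ('a \<Rightarrow> complex) \<Rightarrow> ('a \<Rightarrow> complex) \<Rightarrow> 'a \<Rightarrow> complex" where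
  "dual_mult G A \<Delta> p q f g x =
     tensor_lift (\<lambda>y z. f y * g z)
       (comult_component A \<Delta> p q (component (carrier G) A (p \<otimes>\<^bsub>G\<^esub> q) x))"

definition finite_dimensional :: "'a::complex_vector set \<Rightarrow> bool" where
  "finite_dimensional V \<longleftrightarrow> (\<exists>B. finite B \<and> cvs.span B = V)"

definition has_identity :: "'a::complex_algebra set \<Rightarrow> bool" where
  "has_identity V \<longleftrightarrow> (\<exists>u\<in>V. \<forall>x\<in>V. u * x = x \<and> x * u = x)"

definition basis_family :: "'a::complex_vector set \<Rightarrow> nat \<Rightarrow> (nat \<Rightarrow> 'a) \<Rightarrow> bool" where
  "basis_family V n b \<longleftrightarrow>
     inj_on b {..<n} \<and> cvs.independent (b ` {..<n}) \<and> cvs.span (b ` {..<n}) = V"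

text \<open>
  The functional \<open>\<phi>\<^sub>f\<close>, for bases \<open>b p 0, \<dots>, b p (n p - 1)\<close> of the \<open>A\<^sub>p\<close> and dual bases \<open>d p i\<close>.
  Only the finitely many \<open>p\<close> for which \<open>a\<close> has a non-zero \<open>p\<close>-component contribute to the sum,
  because \<open>S\<^sup>2\<close> maps \<open>A\<^sub>p\<close> to itself.
\<close>

definition haar_functional ::
  "('g, 'm) monoid_scheme \<Rightarrow> ('g \<Rightarrow> 'a::complex_algebra set) \<Rightarrow> 'a comult \<Rightarrow> ('a \<Rightarrow> 'a multiplier)
    \<Rightarrow> ('g \<Rightarrow> nat) \<Rightarrow> ('g \<Rightarrow> nat \<Rightarrow> 'a) \<Rightarrow> ('g \<Rightarrow> nat \<Rightarrow> 'a \<Rightarrow> complex)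
    \<Rightarrow> ('a \<Rightarrow> complex) \<Rightarrow> 'a \<Rightarrow> complex" where
  "haar_functional G A \<Delta> S n b d f a =
     Sum_any (\<lambda>(p, i).
       if p \<in> carrier G \<and> i < n p
       then dual_mult G A \<Delta> p \<one>\<^bsub>G\<^esub> (d p i) f (a * antipode_sq S (b p i))
       else 0)"

end

theory Submission
  imports Defs
begin

text \<open>
  Write \<open>\<Delta>\<^bsub>p,q\<^esub>(x) = x\<^sub>1 \<otimes> x\<^sub>2\<close> for the component of the coproduct in \<open>A\<^sub>p \<otimes> A\<^sub>q\<close>, and put
  \<open>R\<^sub>p(x) = x\<^sub>1 f(x\<^sub>2)\<close> with \<open>x\<^sub>1 \<in> A\<^sub>p\<close>, \<open>x\<^sub>2 \<in> A\<^sub>e\<close>. For \<open>a \<in> A\<^sub>p\<close> the value \<open>\<phi>\<^sub>f(a)\<close> is the trace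
  of the operator \<open>T\<^sub>a : x \<mapsto> R\<^sub>p(a S\<^sup>2(x))\<close> on \<open>A\<^sub>p\<close>. Invariance therefore says that for
  \<open>a \<in> A\<^bsub>pq\<^esub>\<close> the \<open>A\<^sub>p\<close>-valued partial trace of \<open>x \<mapsto> a\<^sub>1 \<otimes> T(x)\<close> with \<open>T = T\<^sub>b\<close>, \<open>b = a\<^sub>2\<close>,
  on \<open>A\<^sub>q\<close> equals \<open>Tr(T\<^sub>a) 1\<close>.

  Three facts give this. First, \<open>R\<close> commutes with the coproduct from the left
  (\<open>comult_translate\<close>), by coassociativity. Second, for \<open>x \<in> A\<^sub>q\<close> and
  \<open>\<Delta>(x) = x\<^sub>1 \<otimes> x\<^sub>2\<close> in \<open>A\<^sub>r \<otimes> A\<^bsub>pq\<^esub>\<close>, where \<open>r\<close> is the inverse of \<open>p\<close>,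
  \<open>1 \<otimes> S\<^sup>2(x) = \<Delta>\<^bsub>p,q\<^esub>(S\<^sup>2(x\<^sub>2)) (S(x\<^sub>1) \<otimes> 1)\<close>,
  since \<open>S\<^sup>2\<close> preserves the coproduct (\<open>pure_antipode_sq\<close>). The two facts turn the operator above
  into \<open>x \<mapsto> \<Delta>\<^bsub>p,q\<^esub>(T\<^sub>a(x\<^sub>2)) (S(x\<^sub>1) \<otimes> 1)\<close>. Third, write \<open>T\<^sub>a\<close> as a sum of operators \<open>x \<mapsto> g(x) \<xi>\<close>
  of rank one. Contracting the \<open>A\<^sub>q\<close>-leg of the \<open>\<xi>\<close>-summand with the dual basis gives
  \<open>\<xi>\<^sub>1 S(\<xi>\<^sub>2) g(\<xi>\<^sub>3) = g(\<xi>) 1\<close> (\<open>cancel_antipode_right\<close>), and these values add up to the trace.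
  The factor \<open>S\<^sup>2\<close> in \<open>\<phi>\<^sub>f\<close> is what makes \<open>S(x\<^sub>1)\<close>, rather than \<open>S\<^bsup>-1\<^esup>(x\<^sub>1)\<close>, appear in the second fact,
  so that the products in the third one are in the order in which the antipode cancels.

  The computation uses the components of the coproduct only, so it is carried out in a
  Hopf group-coalgebra. The identities \<open>1\<^sub>p\<close> reduce the multiplier Hopf algebra to such a structure:
  \<open>\<Delta>(x)\<close> acts on \<open>A\<^sub>p \<otimes> A\<^sub>q\<close> as multiplication by the element \<open>\<Delta>(x)(1\<^sub>p \<otimes> 1\<^sub>q)\<close>, and the antipode, which
  is given with values in \<open>M(A)\<close>, takes values in \<open>A\<close> because \<open>S(x)\<close> kills all but one component.
\<close>

section \<open>Multilinear maps and tensors\<close>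

lemma cbilinearI:
  "(\<And>x. clinear (h x)) \<Longrightarrow> (\<And>y. clinear (\<lambda>x. h x y)) \<Longrightarrow> cbilinear h"
  by (simp add: cbilinear_def)

lemma clinear_add: "clinear f \<Longrightarrow> f (x + y) = f x + f y"
  and clinear_scaleC: "clinear f \<Longrightarrow> f (c *\<^sub>C x) = c *\<^sub>C f x"
  by (simp_all add: clinear_iff)

lemma clinear_sum: "clinear f \<Longrightarrow> f (sum g I) = (\<Sum>i\<in>I. f (g i))"
  by (induction I rule: infinite_finite_induct) (simp_all add: clinear_zero clinear_add)

lemma clinear_ident: "clinear (\<lambda>x. x)"
  by (simp add: clinear_iff)

lemma clinear_compose: "clinear g \<Longrightarrow> clinear f \<Longrightarrow> clinear (\<lambda>x. g (f x))"
  by (simp add: clinear_iff)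

lemma clinear_scaleC_fun: "clinear f \<Longrightarrow> clinear (\<lambda>x. c *\<^sub>C f x)"
  by (simp add: clinear_iff scaleC_right_distrib scaleC_scaleC mult.commute)

lemma clinear_scaleC_scalar: "clinear f \<Longrightarrow> clinear (\<lambda>x. f x *\<^sub>C v)"
  by (simp add: clinear_iff scaleC_left_distrib scaleC_complex_def scaleC_scaleC)

lemma clinear_mult_left: "clinear f \<Longrightarrow> clinear (\<lambda>x. f x * (c :: 'a :: complex_algebra))"
  and clinear_mult_right: "clinear f \<Longrightarrow> clinear (\<lambda>x. (c :: 'a :: complex_algebra) * f x)"
  by (simp_all add: clinear_iff distrib_left distrib_right mult_scaleC_left mult_scaleC_right)

lemma clinear_pure_left: "clinear f \<Longrightarrow> clinear (\<lambda>x. f x \<otimes>\<^sub>t c)"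
  and clinear_pure_right: "clinear f \<Longrightarrow> clinear (\<lambda>x. c \<otimes>\<^sub>t f x)"
  by (simp_all add: clinear_iff pure_tensor_linear)

lemma clinear_plus_fun: "clinear f \<Longrightarrow> clinear g \<Longrightarrow> clinear (\<lambda>x. f x + g x)"
  by (simp add: clinear_iff scaleC_right_distrib ac_simps)

lemma clinear_sum_fun: "(\<And>i. i \<in> I \<Longrightarrow> clinear (f i)) \<Longrightarrow> clinear (\<lambda>x. \<Sum>i\<in>I. f i x)"
  by (simp add: clinear_iff sum.distrib cvs.scale_sum_right)

lemma clinear_tensor_lift_arg: "cbilinear h \<Longrightarrow> clinear f \<Longrightarrow> clinear (\<lambda>x. tensor_lift h (f x))"
  by (rule clinear_compose[OF clinear_tensor_lift])

lemma clinear_tensor_lift_param: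
  assumes bil: "\<And>x. cbilinear (h x)" and lin: "\<And>a b. clinear (\<lambda>x. h x a b)"
  shows "clinear (\<lambda>x. tensor_lift (h x) t)"
proof (induction t rule: tensor_induct)
  case zero
  show ?case by (simp add: clinear_zero[OF clinear_tensor_lift[OF bil]] clinear_iff)
next
  case (add s t)
  then show ?case
    by (simp add: clinear_add[OF clinear_tensor_lift[OF bil]] clinear_plus_fun)
next
  case (pure a b)
  show ?case by (simp add: tensor_lift_pure[OF bil] lin)
qed

lemmas multilinear_intros = cbilinearI clinear_ident clinear_scaleC_fun clinear_scaleC_scalar
  clinear_mult_left clinear_mult_right clinear_pure_left clinear_pure_right
  clinear_tensor_lift_arg clinear_tensor_lift_param clinear_sum_fun

text \<open>
  The next lemmas move linear maps and finite sums in and out of \<open>tensor_lift\<close>. Together with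
  \<open>multilinear_intros\<close>, which discharges the linearity conditions from the syntactic form of the
  expression, they replace the choice of a representation \<open>\<Sum> a\<^sub>i \<otimes> b\<^sub>i\<close> of a tensor.
\<close>

lemma linear_of_tensor_lift:
  assumes "clinear g" "cbilinear h"
  shows "g (tensor_lift h t) = tensor_lift (\<lambda>a b. g (h a b)) t"
proof (rule tensor_linear_unique[where g = "\<lambda>t. g (tensor_lift h t)"])
  have bil: "cbilinear (\<lambda>a b. g (h a b))"
    using assms by (simp add: cbilinear_def clinear_iff)
  show "clinear (\<lambda>t. g (tensor_lift h t))"
    by (intro clinear_compose[OF assms(1)] clinear_tensor_lift assms)
  show "clinear (tensor_lift (\<lambda>a b. g (h a b)))" by (rule clinear_tensor_lift[OF bil])
  show "g (tensor_lift h (a \<otimes>\<^sub>t b)) = tensor_lift (\<lambda>a b. g (h a b)) (a \<otimes>\<^sub>t b)" for a b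
    by (simp add: tensor_lift_pure assms bil)
qed

lemma tensor_lift_pure_id: "tensor_lift (\<otimes>\<^sub>t) t = t"
proof (rule tensor_linear_unique[where g' = "\<lambda>t. t"])
  have bil: "cbilinear (\<otimes>\<^sub>t)" by (intro multilinear_intros)
  show "clinear (tensor_lift (\<otimes>\<^sub>t))" by (rule clinear_tensor_lift[OF bil])
  show "tensor_lift (\<otimes>\<^sub>t) (a \<otimes>\<^sub>t b) = a \<otimes>\<^sub>t b" for a b
    by (rule tensor_lift_pure[OF bil])
qed (rule clinear_ident)

lemma linear_as_tensor_lift: "clinear g \<Longrightarrow> g t = tensor_lift (\<lambda>a b. g (a \<otimes>\<^sub>t b)) t"
  using linear_of_tensor_lift[of g "(\<otimes>\<^sub>t)" t]
  by (simp add: tensor_lift_pure_id multilinear_intros)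

lemma tensor_lift_sum:
  assumes "\<And>i. i \<in> I \<Longrightarrow> cbilinear (h i)"
  shows "tensor_lift (\<lambda>a b. \<Sum>i\<in>I. h i a b) t = (\<Sum>i\<in>I. tensor_lift (h i) t)"
proof (rule tensor_linear_unique)
  have bil: "cbilinear (\<lambda>a b. \<Sum>i\<in>I. h i a b)"
    using assms by (auto simp: cbilinear_def intro!: clinear_sum_fun)
  show "clinear (tensor_lift (\<lambda>a b. \<Sum>i\<in>I. h i a b))" by (rule clinear_tensor_lift[OF bil])
  show "clinear (\<lambda>t. \<Sum>i\<in>I. tensor_lift (h i) t)"
    by (intro clinear_sum_fun clinear_tensor_lift assms)
  show "tensor_lift (\<lambda>a b. \<Sum>i\<in>I. h i a b) (a \<otimes>\<^sub>t b) = (\<Sum>i\<in>I. tensor_lift (h i) (a \<otimes>\<^sub>t b))" for a b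
    by (simp add: tensor_lift_pure[OF bil] tensor_lift_pure[OF assms])
qed

lemma tensor_sub_induct [consumes 1, case_names zero add scale pure]:
  assumes "t \<in> tensor_sub U V"
    and "P 0" "\<And>s t. P s \<Longrightarrow> P t \<Longrightarrow> P (s + t)" "\<And>c t. P t \<Longrightarrow> P (c *\<^sub>C t)"
    and "\<And>a b. a \<in> U \<Longrightarrow> b \<in> V \<Longrightarrow> P (a \<otimes>\<^sub>t b)"
  shows "P t"
  using assms(1) unfolding tensor_sub_def
  by (induction rule: cvs.span_induct_alt) (use assms(2-) in auto)

lemma linear_eq_on_tensor_sub:
  assumes "t \<in> tensor_sub U V" "clinear g" "clinear g'"
    and "\<And>a b. a \<in> U \<Longrightarrow> b \<in> V \<Longrightarrow> g (a \<otimes>\<^sub>t b) = g' (a \<otimes>\<^sub>t b)"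
  shows "g t = g' t"
  using assms(1)
  by (induction rule: tensor_sub_induct)
     (simp_all add: assms clinear_zero clinear_add clinear_scaleC)

lemma tensor_lift_cong_on:
  assumes "t \<in> tensor_sub U V" "cbilinear h" "cbilinear h'"
    and "\<And>a b. a \<in> U \<Longrightarrow> b \<in> V \<Longrightarrow> h a b = h' a b"
  shows "tensor_lift h t = tensor_lift h' t"
  by (rule linear_eq_on_tensor_sub[OF assms(1)])
     (simp_all add: assms clinear_tensor_lift tensor_lift_pure)

lemma tensor_sub_mult_left_unit:
  assumes "t \<in> tensor_sub U V" "\<And>a. a \<in> U \<Longrightarrow> e * a = a" "\<And>b. b \<in> V \<Longrightarrow> f * b = b"
  shows "(e \<otimes>\<^sub>t f) * t = t"
  using assms(1)
  by (induction rule: tensor_sub_induct)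
     (simp_all add: assms distrib_left mult_scaleC_right times_pure_tensor)

lemma tensor_sub_mult_right_unit:
  assumes "t \<in> tensor_sub U V" "\<And>a. a \<in> U \<Longrightarrow> a * e = a" "\<And>b. b \<in> V \<Longrightarrow> b * f = b"
  shows "t * (e \<otimes>\<^sub>t f) = t"
  using assms(1)
  by (induction rule: tensor_sub_induct)
     (simp_all add: assms distrib_right mult_scaleC_left times_pure_tensor)

lemma subspace_tensor_sub: "cvs.subspace (tensor_sub U V)"
  unfolding tensor_sub_def by (rule cvs.subspace_span)

lemma pure_in_tensor_sub: "a \<in> U \<Longrightarrow> b \<in> V \<Longrightarrow> a \<otimes>\<^sub>t b \<in> tensor_sub U V"
  unfolding tensor_sub_def by (auto intro: cvs.span_base)

lemma linear_image_tensor_sub: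
  assumes "t \<in> tensor_sub U V" "clinear g" "cvs.subspace W"
    and "\<And>a b. a \<in> U \<Longrightarrow> b \<in> V \<Longrightarrow> g (a \<otimes>\<^sub>t b) \<in> W"
  shows "g t \<in> W"
  using assms(1)
  by (induction rule: tensor_sub_induct)
     (simp_all add: assms clinear_zero clinear_add clinear_scaleC
        cvs.subspace_0 cvs.subspace_add cvs.subspace_scale)

text \<open>
  Evaluating a trilinear map on a tensor of the form \<open>(D \<otimes> \<iota>) t\<close>, rebracketed; with the
  next lemma this translates coassociativity, an equation of tensors, into an
  equation of Sweedler sums.
\<close>

lemma tensor_lift_assoc:
  fixes h :: "'a::complex_vector \<Rightarrow> 'b::complex_vector \<Rightarrow> 'c::complex_vector \<Rightarrow> 'd::complex_vector"
  assumes D: "clinear D"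
    and h: "\<And>b c. clinear (\<lambda>a. h a b c)" "\<And>a c. clinear (\<lambda>b. h a b c)" "\<And>a b. clinear (\<lambda>c. h a b c)"
  shows "tensor_lift (\<lambda>a t. tensor_lift (h a) t) (tensor_assoc (tensor_map D id t))
       = tensor_lift (\<lambda>u c. tensor_lift (\<lambda>a b. h a b c) (D u)) t"
proof (rule tensor_linear_unique[where g = "\<lambda>t. tensor_lift (\<lambda>a t. tensor_lift (h a) t) (tensor_assoc (tensor_map D id t))"])
  have ids: "clinear (id :: 'c \<Rightarrow> 'c)" by (simp add: clinear_iff)
  have b1: "cbilinear (\<lambda>a t. tensor_lift (h a) t)"
    by (intro multilinear_intros h)
  have b2: "cbilinear (\<lambda>u c. tensor_lift (\<lambda>a b. h a b c) (D u))"
    by (intro multilinear_intros h D)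
  have A: "clinear (\<lambda>t. tensor_assoc (tensor_map D (id :: 'c \<Rightarrow> 'c) t))"
    by (intro clinear_compose[OF clinear_tensor_assoc] clinear_tensor_map D ids)
  show "clinear (\<lambda>t. tensor_lift (\<lambda>a t. tensor_lift (h a) t) (tensor_assoc (tensor_map D id t)))"
    by (intro clinear_tensor_lift_arg b1 A)
  show "clinear (tensor_lift (\<lambda>u c. tensor_lift (\<lambda>a b. h a b c) (D u)))"
    by (rule clinear_tensor_lift[OF b2])
  fix u c
  have "tensor_lift (\<lambda>a t. tensor_lift (h a) t) (tensor_assoc (s \<otimes>\<^sub>t c))
      = tensor_lift (\<lambda>a b. h a b c) s" for s
  proof (rule tensor_linear_unique[where g = "\<lambda>s. tensor_lift (\<lambda>a t. tensor_lift (h a) t) (tensor_assoc (s \<otimes>\<^sub>t c))"])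
    show "clinear (\<lambda>s. tensor_lift (\<lambda>a t. tensor_lift (h a) t) (tensor_assoc (s \<otimes>\<^sub>t c)))"
      by (intro clinear_tensor_lift_arg b1 clinear_compose[OF clinear_tensor_assoc] multilinear_intros)
    have b3: "cbilinear (\<lambda>a b. h a b c)" by (intro multilinear_intros h)
    show "clinear (tensor_lift (\<lambda>a b. h a b c))"
      by (rule clinear_tensor_lift[OF b3])
    show "tensor_lift (\<lambda>a t. tensor_lift (h a) t) (tensor_assoc ((a \<otimes>\<^sub>t b) \<otimes>\<^sub>t c))
        = tensor_lift (\<lambda>a b. h a b c) (a \<otimes>\<^sub>t b)" for a b
      by (simp add: tensor_lift_pure[OF b1] tensor_lift_pure[OF b3] tensor_lift_pure[of "h _"] cbilinearI h)
  qed
  then show "tensor_lift (\<lambda>a t. tensor_lift (h a) t) (tensor_assoc (tensor_map D id (u \<otimes>\<^sub>t c)))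
      = tensor_lift (\<lambda>u c. tensor_lift (\<lambda>a b. h a b c) (D u)) (u \<otimes>\<^sub>t c)"
    by (simp add: tensor_map_pure[OF D ids] tensor_lift_pure[OF b2])
qed

lemma tensor_lift_tensor_map_id:
  assumes D: "clinear D" and h: "cbilinear h"
  shows "tensor_lift h (tensor_map id D t) = tensor_lift (\<lambda>a v. h a (D v)) t"
proof (rule tensor_linear_unique[where g = "\<lambda>t. tensor_lift h (tensor_map id D t)"])
  have ids: "clinear id" by (simp add: clinear_iff)
  have b: "cbilinear (\<lambda>a v. h a (D v))" 
    using h D by (simp add: cbilinear_def clinear_iff)
  show "clinear (\<lambda>t. tensor_lift h (tensor_map id D t))"
    by (intro clinear_tensor_lift_arg h clinear_tensor_map ids D)
  show "clinear (tensor_lift (\<lambda>a v. h a (D v)))" by (rule clinear_tensor_lift[OF b])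
  show "tensor_lift h (tensor_map id D (a \<otimes>\<^sub>t b)) = tensor_lift (\<lambda>a v. h a (D v)) (a \<otimes>\<^sub>t b)" for a b
    by (simp add: tensor_map_pure[OF ids D] tensor_lift_pure h b)
qed

section \<open>Hopf group-coalgebras\<close>

text \<open>
  Turaev's Hopf group-coalgebras: unital algebras \<open>A\<^sub>p\<close>, comultiplications
  \<open>\<delta> p q : A\<^bsub>pq\<^esub> \<rightarrow> A\<^sub>p \<otimes> A\<^sub>q\<close>, a counit on \<open>A\<^sub>e\<close> and antipodes from \<open>A\<^sub>p\<close> to the component of the
  inverse of \<open>p\<close>. The components are subspaces of one type, and all structure maps are linear on
  that whole type, so that a linear map never needs a proof that its argument has the right degree.
\<close>

locale hopf_group_coalgebra = group G
  for G :: "('g, 'm) monoid_scheme" (structure) +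
  fixes A :: "'g \<Rightarrow> 'a::complex_algebra set"
    and u :: "'g \<Rightarrow> 'a"
    and \<delta> :: "'g \<Rightarrow> 'g \<Rightarrow> 'a \<Rightarrow> 'a \<otimes> 'a"
    and \<epsilon> :: "'a \<Rightarrow> complex"
    and s :: "'a \<Rightarrow> 'a"
  assumes subspace: "p \<in> carrier G \<Longrightarrow> cvs.subspace (A p)"
    and mult_closed: "p \<in> carrier G \<Longrightarrow> x \<in> A p \<Longrightarrow> y \<in> A p \<Longrightarrow> x * y \<in> A p"
    and unit_closed: "p \<in> carrier G \<Longrightarrow> u p \<in> A p"
    and unit_left: "p \<in> carrier G \<Longrightarrow> x \<in> A p \<Longrightarrow> u p * x = x"
    and unit_right: "p \<in> carrier G \<Longrightarrow> x \<in> A p \<Longrightarrow> x * u p = x"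
    and clinear_comult: "clinear (\<delta> p q)"
    and clinear_counit: "clinear \<epsilon>"
    and clinear_antipode: "clinear s"
    and comult_closed: "p \<in> carrier G \<Longrightarrow> q \<in> carrier G \<Longrightarrow> \<delta> p q x \<in> tensor_sub (A p) (A q)"
    and comult_mult: "p \<in> carrier G \<Longrightarrow> q \<in> carrier G \<Longrightarrow> \<delta> p q (x * y) = \<delta> p q x * \<delta> p q y"
    and comult_unit: "p \<in> carrier G \<Longrightarrow> q \<in> carrier G \<Longrightarrow> \<delta> p q (u (p \<otimes> q)) = u p \<otimes>\<^sub>t u q"
    and comult_assoc: "p \<in> carrier G \<Longrightarrow> q \<in> carrier G \<Longrightarrow> r \<in> carrier G \<Longrightarrow>
      tensor_assoc (tensor_map (\<delta> p q) id (\<delta> (p \<otimes> q) r x)) = tensor_map id (\<delta> q r) (\<delta> p (q \<otimes> r) x)"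
    and counit_left: "p \<in> carrier G \<Longrightarrow> x \<in> A p \<Longrightarrow>
      tensor_lift (\<lambda>a b. \<epsilon> a *\<^sub>C b) (\<delta> \<one> p x) = x"
    and counit_right: "p \<in> carrier G \<Longrightarrow> x \<in> A p \<Longrightarrow>
      tensor_lift (\<lambda>a b. \<epsilon> b *\<^sub>C a) (\<delta> p \<one> x) = x"
    and antipode_closed: "p \<in> carrier G \<Longrightarrow> x \<in> A p \<Longrightarrow> s x \<in> A (inv p)"
    and antipode_mult: "s (x * y) = s y * s x"
    and antipode_left: "p \<in> carrier G \<Longrightarrow> x \<in> A \<one> \<Longrightarrow>
      tensor_lift (\<lambda>a b. s a * b) (\<delta> (inv p) p x) = \<epsilon> x *\<^sub>C u p"
    and antipode_right: "p \<in> carrier G \<Longrightarrow> x \<in> A \<one> \<Longrightarrow>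
      tensor_lift (\<lambda>a b. a * s b) (\<delta> p (inv p) x) = \<epsilon> x *\<^sub>C u p"
    and antipode_unit: "p \<in> carrier G \<Longrightarrow> s (u p) = u (inv p)"
begin

lemmas clinears = clinear_compose[OF clinear_comult] clinear_compose[OF clinear_counit]
  clinear_compose[OF clinear_antipode]

lemmas multilinear = multilinear_intros clinears

text \<open>
  The term \<open>tensor_lift (\<lambda>a b. h a b) (\<delta> p q x)\<close> is the Sweedler sum \<open>h(x\<^sub>1, x\<^sub>2)\<close> with
  \<open>x\<^sub>1 \<in> A\<^sub>p\<close> and \<open>x\<^sub>2 \<in> A\<^sub>q\<close>. The following lemmas are the rules for calculating with such sums;
  the first one says that only the values of \<open>h\<close> on \<open>A\<^sub>p \<times> A\<^sub>q\<close> matter.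
\<close>

lemma sweedler_cong:
  assumes "p \<in> carrier G" "q \<in> carrier G" "cbilinear h" "cbilinear h'"
    and "\<And>a b. a \<in> A p \<Longrightarrow> b \<in> A q \<Longrightarrow> h a b = h' a b"
  shows "tensor_lift h (\<delta> p q x) = tensor_lift h' (\<delta> p q x)"
  by (rule tensor_lift_cong_on[OF comult_closed[OF assms(1,2)] assms(3-)])

lemma sweedler_assoc:
  fixes h :: "'a \<Rightarrow> 'a \<Rightarrow> 'a \<Rightarrow> 'd::complex_vector"
  assumes G: "p \<in> carrier G" "q \<in> carrier G" "r \<in> carrier G"
    and h: "\<And>b c. clinear (\<lambda>a. h a b c)" "\<And>a c. clinear (\<lambda>b. h a b c)" "\<And>a b. clinear (\<lambda>c. h a b c)"
  shows "tensor_lift (\<lambda>v c. tensor_lift (\<lambda>a b. h a b c) (\<delta> p q v)) (\<delta> (p \<otimes> q) r x)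
       = tensor_lift (\<lambda>a w. tensor_lift (\<lambda>b c. h a b c) (\<delta> q r w)) (\<delta> p (q \<otimes> r) x)"
proof -
  have "cbilinear (\<lambda>a t. tensor_lift (h a) t)" by (intro multilinear_intros h)
  then show ?thesis
    by (simp add: tensor_lift_assoc[OF clinear_comult h, symmetric] comult_assoc G
        tensor_lift_tensor_map_id[OF clinear_comult])
qed

lemma sweedler_counit_left:
  assumes "p \<in> carrier G" "x \<in> A p" "clinear g"
  shows "tensor_lift (\<lambda>a b. \<epsilon> a *\<^sub>C g b) (\<delta> \<one> p x) = g x"
proof -
  have "cbilinear (\<lambda>a b. \<epsilon> a *\<^sub>C b)" by (intro multilinear)
  from linear_of_tensor_lift[OF assms(3) this, of "\<delta> \<one> p x"] show ?thesis
    by (simp add: counit_left[OF assms(1,2)] clinear_scaleC assms(3))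
qed

lemma sweedler_counit_right:
  assumes "p \<in> carrier G" "x \<in> A p" "clinear g"
  shows "tensor_lift (\<lambda>a b. \<epsilon> b *\<^sub>C g a) (\<delta> p \<one> x) = g x"
proof -
  have "cbilinear (\<lambda>a b. \<epsilon> b *\<^sub>C a)" by (intro multilinear)
  from linear_of_tensor_lift[OF assms(3) this, of "\<delta> p \<one> x"] show ?thesis
    by (simp add: counit_right[OF assms(1,2)] clinear_scaleC assms(3))
qed

lemma sweedler_antipode_left:
  assumes "p \<in> carrier G" "x \<in> A \<one>" "clinear g"
  shows "tensor_lift (\<lambda>a b. g (s a * b)) (\<delta> (inv p) p x) = \<epsilon> x *\<^sub>C g (u p)"
proof -
  have "cbilinear (\<lambda>a b. s a * b)" by (intro multilinear)
  from linear_of_tensor_lift[OF assms(3) this, of "\<delta> (inv p) p x"] show ?thesis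
    by (simp add: antipode_left[OF assms(1,2)] clinear_scaleC assms(3))
qed

lemma sweedler_antipode_right:
  assumes "p \<in> carrier G" "x \<in> A \<one>" "clinear g"
  shows "tensor_lift (\<lambda>a b. g (a * s b)) (\<delta> p (inv p) x) = \<epsilon> x *\<^sub>C g (u p)"
proof -
  have "cbilinear (\<lambda>a b. a * s b)" by (intro multilinear)
  from linear_of_tensor_lift[OF assms(3) this, of "\<delta> p (inv p) x"] show ?thesis
    by (simp add: antipode_right[OF assms(1,2)] clinear_scaleC assms(3))
qed

text \<open>
  In Sweedler notation \<open>x\<^sub>1 S(x\<^sub>2) \<otimes> x\<^sub>3 = 1 \<otimes> x\<close>, with \<open>x\<^sub>1 \<in> A\<^sub>p\<close>: rebracketing makes \<open>x\<^sub>1 S(x\<^sub>2)\<close>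
  the value of the antipode axiom on an element of \<open>A\<^sub>e\<close>, and the counit absorbs the rest.
\<close>

lemma cancel_antipode_right:
  assumes p: "p \<in> carrier G" and q: "q \<in> carrier G" and x: "x \<in> A (p \<otimes> q)"
    and h: "\<And>b. clinear (\<lambda>a. h a b)" "\<And>a. clinear (h a)"
  shows "tensor_lift (\<lambda>a v. tensor_lift (\<lambda>b c. h (a * s b) c) (\<delta> (inv p) (p \<otimes> q) v)) (\<delta> p q x)
       = h (u p) x"
proof -
  note lin = multilinear clinear_compose[OF h(1)] clinear_compose[OF h(2)]
  have eq: "inv p \<otimes> (p \<otimes> q) = q" using p q by (simp add: m_assoc[symmetric])
  have "tensor_lift (\<lambda>a v. tensor_lift (\<lambda>b c. h (a * s b) c) (\<delta> (inv p) (p \<otimes> q) v)) (\<delta> p q x)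
     = tensor_lift (\<lambda>v c. tensor_lift (\<lambda>a b. h (a * s b) c) (\<delta> p (inv p) v)) (\<delta> \<one> (p \<otimes> q) x)"
  proof -
    have "tensor_lift (\<lambda>v c. tensor_lift (\<lambda>a b. h (a * s b) c) (\<delta> p (inv p) v)) (\<delta> (p \<otimes> inv p) (p \<otimes> q) x)
      = tensor_lift (\<lambda>a v. tensor_lift (\<lambda>b c. h (a * s b) c) (\<delta> (inv p) (p \<otimes> q) v)) (\<delta> p (inv p \<otimes> (p \<otimes> q)) x)"
      by (rule sweedler_assoc) (intro lin p q inv_closed m_closed)+
    then show ?thesis using p by (simp add: eq)
  qed
  also have "\<dots> = tensor_lift (\<lambda>v c. \<epsilon> v *\<^sub>C h (u p) c) (\<delta> \<one> (p \<otimes> q) x)"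
  proof (rule sweedler_cong)
    show "tensor_lift (\<lambda>a b. h (a * s b) c) (\<delta> p (inv p) v) = \<epsilon> v *\<^sub>C h (u p) c"
      if "v \<in> A \<one>" for v c
      by (rule sweedler_antipode_right[where g = "\<lambda>a. h a c", OF p that h(1)])
  qed (intro lin one_closed m_closed p q)+
  also have "\<dots> = h (u p) x"
    by (rule sweedler_counit_left[OF m_closed[OF p q] x h(2)])
  finally show ?thesis .
qed

text \<open>
  The map \<open>c \<mapsto> S(c\<^sub>2) \<otimes> S(c\<^sub>1)\<close> is a right convolution inverse of the comultiplication:
  in \<open>b\<^sub>1 S(c\<^sub>2) \<otimes> b\<^sub>2 S(c\<^sub>1)\<close> the four legs \<open>b\<^sub>1, b\<^sub>2, c\<^sub>1, c\<^sub>2\<close> come in this order from one element, so the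
  inner pair \<open>b\<^sub>2 S(c\<^sub>1)\<close> cancels first and then the outer pair does.
\<close>

lemma comult_antipode_convolution:
  assumes p: "p \<in> carrier G" and q: "q \<in> carrier G" and x: "x \<in> A \<one>"
  shows "tensor_lift (\<lambda>b c. \<delta> (inv q) (inv p) b * tensor_lift (\<lambda>c1 c2. s c2 \<otimes>\<^sub>t s c1) (\<delta> p q c))
           (\<delta> (inv (p \<otimes> q)) (p \<otimes> q) x) = \<epsilon> x *\<^sub>C (u (inv q) \<otimes>\<^sub>t u (inv p))"
proof -
  let ?p = "inv p" and ?q = "inv q" and ?r = "p \<otimes> q"
  have G: "?p \<in> carrier G" "?q \<in> carrier G" "?r \<in> carrier G" using p q by simp_all
  have inv_r: "inv ?r = ?q \<otimes> ?p" using p q by (rule inv_mult_group)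
  have pr: "?p \<otimes> ?r = q" using p q by (simp add: m_assoc[symmetric])
  define F where "F = (\<lambda>b1 b2 c1 c2. (b1 * s c2) \<otimes>\<^sub>t (b2 * s c1))"
  have product: "\<delta> ?q ?p b * tensor_lift (\<lambda>c1 c2. s c2 \<otimes>\<^sub>t s c1) t
      = tensor_lift (\<lambda>b1 b2. tensor_lift (F b1 b2) t) (\<delta> ?q ?p b)" for b t
  proof -
    let ?R = "tensor_lift (\<lambda>c1 c2. s c2 \<otimes>\<^sub>t s c1) t"
    have "\<delta> ?q ?p b * ?R = tensor_lift (\<lambda>b1 b2. (b1 \<otimes>\<^sub>t b2) * ?R) (\<delta> ?q ?p b)"
      by (rule linear_as_tensor_lift[where g = "\<lambda>t. t * ?R"]) (intro multilinear)
    moreover have "w * ?R = tensor_lift (\<lambda>c1 c2. w * (s c2 \<otimes>\<^sub>t s c1)) t" for w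
      by (rule linear_of_tensor_lift[where g = "\<lambda>t. w * t"]) (intro multilinear)+
    ultimately show ?thesis by (simp add: times_pure_tensor F_def)
  qed
  have linF: "clinear f \<Longrightarrow> clinear (\<lambda>x. F (f x) b2 c1 c2)" "clinear f \<Longrightarrow> clinear (\<lambda>x. F b1 (f x) c1 c2)"
    "clinear f \<Longrightarrow> clinear (\<lambda>x. F b1 b2 (f x) c2)" "clinear f \<Longrightarrow> clinear (\<lambda>x. F b1 b2 c1 (f x))"
    for b1 b2 c1 c2 and f :: "'a \<Rightarrow> 'a"
    unfolding F_def by (intro multilinear; assumption)+
  note lin = multilinear linF
  \<comment> \<open>cancellation of the inner pair \<open>b2\<close>, \<open>c1\<close>, after these two legs are brought together\<close>
  have inner: "tensor_lift (\<lambda>b2 c. tensor_lift (\<lambda>c1 c2. F b1 b2 c1 c2) (\<delta> p q c)) (\<delta> ?p ?r v)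
      = (b1 * s v) \<otimes>\<^sub>t u ?p" if v: "v \<in> A q" for b1 v
  proof -
    have "tensor_lift (\<lambda>b2 c. tensor_lift (\<lambda>c1 c2. F b1 b2 c1 c2) (\<delta> p q c)) (\<delta> ?p ?r v)
      = tensor_lift (\<lambda>w c2. tensor_lift (\<lambda>b2 c1. F b1 b2 c1 c2) (\<delta> ?p p w)) (\<delta> (?p \<otimes> p) q v)"
      by (rule sweedler_assoc[symmetric]) (intro lin G p q)+
    also have "?p \<otimes> p = \<one>" using p by simp
    also have "tensor_lift (\<lambda>w c2. tensor_lift (\<lambda>b2 c1. F b1 b2 c1 c2) (\<delta> ?p p w)) (\<delta> \<one> q v)
      = tensor_lift (\<lambda>w c2. \<epsilon> w *\<^sub>C ((b1 * s c2) \<otimes>\<^sub>t u ?p)) (\<delta> \<one> q v)"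
    proof (rule sweedler_cong)
      show "tensor_lift (\<lambda>b2 c1. F b1 b2 c1 c2) (\<delta> ?p p w) = \<epsilon> w *\<^sub>C ((b1 * s c2) \<otimes>\<^sub>t u ?p)"
        if w: "w \<in> A \<one>" for w c2
        using sweedler_antipode_right[where g = "\<lambda>y. (b1 * s c2) \<otimes>\<^sub>t y" and p = ?p, OF G(1) w] p
        by (simp add: F_def multilinear)
    qed (intro lin one_closed q)+
    also have "\<dots> = (b1 * s v) \<otimes>\<^sub>t u ?p"
      by (rule sweedler_counit_left[OF q v]) (intro lin)
    finally show ?thesis .
  qed
  have "tensor_lift (\<lambda>b c. \<delta> ?q ?p b * tensor_lift (\<lambda>c1 c2. s c2 \<otimes>\<^sub>t s c1) (\<delta> p q c)) (\<delta> (inv ?r) ?r x)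
      = tensor_lift (\<lambda>b c. tensor_lift (\<lambda>b1 b2. tensor_lift (F b1 b2) (\<delta> p q c)) (\<delta> ?q ?p b))
          (\<delta> (?q \<otimes> ?p) ?r x)"
    by (simp only: product inv_r)
  also have "\<dots> = tensor_lift (\<lambda>b1 v. tensor_lift (\<lambda>b2 c. tensor_lift (F b1 b2) (\<delta> p q c)) (\<delta> ?p ?r v))
          (\<delta> ?q (?p \<otimes> ?r) x)"
    by (rule sweedler_assoc) (intro lin G)+
  also have "\<dots> = tensor_lift (\<lambda>b1 v. (b1 * s v) \<otimes>\<^sub>t u ?p) (\<delta> ?q q x)"
    unfolding pr by (rule sweedler_cong) (intro lin G q inner | assumption)+
  also have "\<dots> = \<epsilon> x *\<^sub>C (u ?q \<otimes>\<^sub>t u ?p)"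
    using sweedler_antipode_right[where g = "\<lambda>y. y \<otimes>\<^sub>t u ?p" and p = ?q, OF G(2) x] q
    by (simp add: multilinear)
  finally show ?thesis .
qed

text \<open>
  The antipode reverses the comultiplication. Both sides of the equation are convolution inverses of the
  same map: \<open>L = \<delta> \<circ> S\<close> is a left inverse of \<open>\<delta>\<close> because \<open>\<delta>\<close> is multiplicative, and
  \<open>R(x) = S(x\<^sub>2) \<otimes> S(x\<^sub>1)\<close> is a right inverse by the previous lemma. Hence
  \<open>L = L * (\<delta> * R) = (L * \<delta>) * R = R\<close>.
\<close>

lemma comult_antipode:
  assumes p: "p \<in> carrier G" and q: "q \<in> carrier G" and x: "x \<in> A (p \<otimes> q)"
  shows "\<delta> (inv q) (inv p) (s x) = tensor_lift (\<lambda>a b. s b \<otimes>\<^sub>t s a) (\<delta> p q x)"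
proof -
  let ?p = "inv p" and ?q = "inv q" and ?r = "p \<otimes> q"
  let ?U = "u ?q \<otimes>\<^sub>t u ?p"
  have G: "?p \<in> carrier G" "?q \<in> carrier G" "?r \<in> carrier G" "inv ?r \<in> carrier G" using p q by simp_all
  have inv_r: "inv ?r = ?q \<otimes> ?p" using p q by (rule inv_mult_group)
  define L where "L a = \<delta> ?q ?p (s a)" for a
  define R where "R c = tensor_lift (\<lambda>c1 c2. s c2 \<otimes>\<^sub>t s c1) (\<delta> p q c)" for c
  have linL: "clinear f \<Longrightarrow> clinear (\<lambda>x. L (f x))" and linR: "clinear f \<Longrightarrow> clinear (\<lambda>x. R (f x))"
    for f :: "'z::complex_vector \<Rightarrow> 'a"
    unfolding L_def R_def by (intro multilinear; assumption)+
  note lin = multilinear linL linR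
  have unit_r: "t * ?U = t" and unit_l: "?U * t = t" if "t \<in> tensor_sub (A ?q) (A ?p)" for t
    by (rule tensor_sub_mult_right_unit[OF that unit_right unit_right]
        tensor_sub_mult_left_unit[OF that unit_left unit_left]; simp add: G)+
  have R_closed: "R c \<in> tensor_sub (A ?q) (A ?p)" for c
    unfolding R_def
  proof (rule linear_image_tensor_sub[OF comult_closed[OF p q, of c] _ subspace_tensor_sub])
    have bil: "cbilinear (\<lambda>c1 c2. s c2 \<otimes>\<^sub>t s c1)" by (intro multilinear)
    show "clinear (tensor_lift (\<lambda>c1 c2. s c2 \<otimes>\<^sub>t s c1))" by (rule clinear_tensor_lift[OF bil])
    show "tensor_lift (\<lambda>c1 c2. s c2 \<otimes>\<^sub>t s c1) (a \<otimes>\<^sub>t b) \<in> tensor_sub (A ?q) (A ?p)"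
      if "a \<in> A p" "b \<in> A q" for a b
      unfolding tensor_lift_pure[OF bil]
      by (intro pure_in_tensor_sub antipode_closed p q that)
  qed
  have L_closed: "L a \<in> tensor_sub (A ?q) (A ?p)" for a
    unfolding L_def by (rule comult_closed[OF G(2,1)])
  have left: "tensor_lift (\<lambda>a b. L a * \<delta> ?q ?p b) (\<delta> ?r (inv ?r) v) = \<epsilon> v *\<^sub>C ?U"
    if v: "v \<in> A \<one>" for v
  proof -
    have "tensor_lift (\<lambda>a b. L a * \<delta> ?q ?p b) (\<delta> ?r (inv ?r) v)
        = tensor_lift (\<lambda>a b. \<delta> ?q ?p (s a * b)) (\<delta> ?r (inv ?r) v)"
      by (simp add: L_def comult_mult[OF G(2,1)])
    also have "\<dots> = \<epsilon> v *\<^sub>C \<delta> ?q ?p (u (inv ?r))"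
      using sweedler_antipode_left[where p = "inv ?r" and g = "\<delta> ?q ?p", OF G(4) v clinear_comult] G(3)
      by simp
    finally show ?thesis using comult_unit[OF G(2,1)] by (simp add: inv_r)
  qed
  have "L x = tensor_lift (\<lambda>a v. \<epsilon> v *\<^sub>C L a) (\<delta> ?r \<one> x)"
    by (rule sweedler_counit_right[OF G(3) x, symmetric]) (intro lin)
  also have "\<dots> = tensor_lift (\<lambda>a v. tensor_lift (\<lambda>b c. L a * (\<delta> ?q ?p b * R c)) (\<delta> (inv ?r) ?r v)) (\<delta> ?r \<one> x)"
  proof (rule sweedler_cong)
    fix a v assume v: "v \<in> A \<one>"
    have "tensor_lift (\<lambda>b c. L a * (\<delta> ?q ?p b * R c)) (\<delta> (inv ?r) ?r v)
       = L a * tensor_lift (\<lambda>b c. \<delta> ?q ?p b * R c) (\<delta> (inv ?r) ?r v)"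
      by (rule linear_of_tensor_lift[where g = "\<lambda>t. L a * t", symmetric]) (intro lin)+
    also have "\<dots> = \<epsilon> v *\<^sub>C L a"
      unfolding R_def comult_antipode_convolution[OF p q v]
      by (simp add: mult_scaleC_right unit_r L_closed)
    finally show "\<epsilon> v *\<^sub>C L a = tensor_lift (\<lambda>b c. L a * (\<delta> ?q ?p b * R c)) (\<delta> (inv ?r) ?r v)" ..
  qed (intro lin one_closed G)+
  also have "\<dots> = tensor_lift (\<lambda>a v. tensor_lift (\<lambda>b c. L a * (\<delta> ?q ?p b * R c)) (\<delta> (inv ?r) ?r v))
      (\<delta> ?r (inv ?r \<otimes> ?r) x)"
    using G(3) by simp
  also have "\<dots> = tensor_lift (\<lambda>v c. tensor_lift (\<lambda>a b. L a * (\<delta> ?q ?p b * R c)) (\<delta> ?r (inv ?r) v))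
      (\<delta> (?r \<otimes> inv ?r) ?r x)"
    by (rule sweedler_assoc[symmetric]) (intro lin G)+
  also have "\<dots> = tensor_lift (\<lambda>v c. tensor_lift (\<lambda>a b. L a * (\<delta> ?q ?p b * R c)) (\<delta> ?r (inv ?r) v))
      (\<delta> \<one> ?r x)"
    using G(3) by simp
  also have "\<dots> = tensor_lift (\<lambda>v c. \<epsilon> v *\<^sub>C R c) (\<delta> \<one> ?r x)"
  proof (rule sweedler_cong)
    fix v c assume v: "v \<in> A \<one>"
    have "tensor_lift (\<lambda>a b. L a * (\<delta> ?q ?p b * R c)) (\<delta> ?r (inv ?r) v)
       = tensor_lift (\<lambda>a b. L a * \<delta> ?q ?p b) (\<delta> ?r (inv ?r) v) * R c"
      unfolding mult.assoc[symmetric]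
      by (rule linear_of_tensor_lift[where g = "\<lambda>t. t * R c", symmetric]) (intro lin)+
    then show "tensor_lift (\<lambda>a b. L a * (\<delta> ?q ?p b * R c)) (\<delta> ?r (inv ?r) v) = \<epsilon> v *\<^sub>C R c"
      by (simp add: left[OF v] mult_scaleC_left unit_l R_closed)
  qed (intro lin one_closed G)+
  also have "\<dots> = R x"
    by (rule sweedler_counit_left[OF G(3) x]) (intro lin)
  finally show ?thesis by (simp add: L_def R_def)
qed

lemma comult_antipode_sq:
  assumes p: "p \<in> carrier G" and q: "q \<in> carrier G" and x: "x \<in> A (p \<otimes> q)"
  shows "\<delta> p q (s (s x)) = tensor_lift (\<lambda>a b. s (s a) \<otimes>\<^sub>t s (s b)) (\<delta> p q x)"
proof -
  have sx: "s x \<in> A (inv q \<otimes> inv p)"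
    using antipode_closed[OF m_closed[OF p q] x] p q by (simp add: inv_mult_group)
  have bil: "cbilinear (\<lambda>a b. s b \<otimes>\<^sub>t s a)" by (intro multilinear)
  have "\<delta> p q (s (s x)) = tensor_lift (\<lambda>a b. s b \<otimes>\<^sub>t s a) (\<delta> (inv q) (inv p) (s x))"
    using comult_antipode[OF inv_closed[OF q] inv_closed[OF p] sx] p q by simp
  also have "\<dots> = tensor_lift (\<lambda>a b. s b \<otimes>\<^sub>t s a) (tensor_lift (\<lambda>a b. s b \<otimes>\<^sub>t s a) (\<delta> p q x))"
    by (simp add: comult_antipode[OF p q x])
  also have "\<dots> = tensor_lift (\<lambda>a b. s (s a) \<otimes>\<^sub>t s (s b)) (\<delta> p q x)"
    by (simp add: linear_of_tensor_lift[OF clinear_tensor_lift[OF bil] bil] tensor_lift_pure[OF bil])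
  finally show ?thesis .
qed

text \<open>
  Since \<open>S\<^sup>2\<close> is comultiplicative, the left-hand side is
  \<open>S\<^sup>2(x\<^sub>2) S(x\<^sub>1) \<otimes> S\<^sup>2(x\<^sub>3) = S(x\<^sub>1 S(x\<^sub>2)) \<otimes> S\<^sup>2(x\<^sub>3)\<close>, and \<open>x\<^sub>1 S(x\<^sub>2)\<close> cancels. Thus an element
  \<open>1 \<otimes> S\<^sup>2(x)\<close> is expressed through values of the comultiplication; this is where \<open>S\<^sup>2\<close> enters
  the definition of the invariant functional.
\<close>

lemma pure_antipode_sq:
  assumes p: "p \<in> carrier G" and q: "q \<in> carrier G" and x: "x \<in> A q"
  shows "tensor_lift (\<lambda>a b. \<delta> p q (s (s b)) * (s a \<otimes>\<^sub>t u q)) (\<delta> (inv p) (p \<otimes> q) x)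
       = u p \<otimes>\<^sub>t s (s x)"
proof -
  let ?p = "inv p" and ?r = "p \<otimes> q"
  have G: "?p \<in> carrier G" "?r \<in> carrier G" using p q by simp_all
  have ssA: "s (s d) \<in> A q" if "d \<in> A q" for d
    using antipode_closed[OF _ antipode_closed[OF q that]] q by simp
  have "tensor_lift (\<lambda>a b. \<delta> p q (s (s b)) * (s a \<otimes>\<^sub>t u q)) (\<delta> ?p ?r x)
      = tensor_lift (\<lambda>a b. tensor_lift (\<lambda>c d. s (a * s c) \<otimes>\<^sub>t s (s d)) (\<delta> p q b)) (\<delta> ?p ?r x)"
  proof (rule sweedler_cong)
    fix a b assume b: "b \<in> A ?r"
    have "\<delta> p q (s (s b)) * (s a \<otimes>\<^sub>t u q)
        = tensor_lift (\<lambda>c d. s (s c) \<otimes>\<^sub>t s (s d)) (\<delta> p q b) * (s a \<otimes>\<^sub>t u q)"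
      by (simp add: comult_antipode_sq[OF p q b])
    also have "\<dots> = tensor_lift (\<lambda>c d. (s (s c) \<otimes>\<^sub>t s (s d)) * (s a \<otimes>\<^sub>t u q)) (\<delta> p q b)"
      by (rule linear_of_tensor_lift[where g = "\<lambda>t. t * (s a \<otimes>\<^sub>t u q)"]) (intro multilinear)+
    also have "\<dots> = tensor_lift (\<lambda>c d. s (a * s c) \<otimes>\<^sub>t s (s d)) (\<delta> p q b)"
      by (rule sweedler_cong)
         (auto intro!: multilinear p q simp: times_pure_tensor antipode_mult unit_right[OF q] ssA)
    finally show "\<delta> p q (s (s b)) * (s a \<otimes>\<^sub>t u q)
        = tensor_lift (\<lambda>c d. s (a * s c) \<otimes>\<^sub>t s (s d)) (\<delta> p q b)" .
  qed (intro multilinear G)+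
  also have "\<dots> = tensor_lift (\<lambda>v d. tensor_lift (\<lambda>a c. s (a * s c) \<otimes>\<^sub>t s (s d)) (\<delta> ?p p v)) (\<delta> (?p \<otimes> p) q x)"
    by (rule sweedler_assoc[symmetric]) (intro multilinear G p q)+
  also have "?p \<otimes> p = \<one>" using p by simp
  also have "tensor_lift (\<lambda>v d. tensor_lift (\<lambda>a c. s (a * s c) \<otimes>\<^sub>t s (s d)) (\<delta> ?p p v)) (\<delta> \<one> q x)
      = tensor_lift (\<lambda>v d. \<epsilon> v *\<^sub>C (u p \<otimes>\<^sub>t s (s d))) (\<delta> \<one> q x)"
  proof (rule sweedler_cong)
    fix v d assume v: "v \<in> A \<one>"
    have "clinear (\<lambda>y. s y \<otimes>\<^sub>t s (s d))" by (intro multilinear)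
    from sweedler_antipode_right[OF G(1) v this]
    show "tensor_lift (\<lambda>a c. s (a * s c) \<otimes>\<^sub>t s (s d)) (\<delta> ?p p v) = \<epsilon> v *\<^sub>C (u p \<otimes>\<^sub>t s (s d))"
      using p by (simp add: antipode_unit)
  qed (intro multilinear q one_closed)+
  also have "\<dots> = u p \<otimes>\<^sub>t s (s x)"
    by (rule sweedler_counit_left[OF q x]) (intro multilinear)
  finally show ?thesis .
qed

end

section \<open>The trace functional\<close>

context hopf_group_coalgebra
begin

text \<open>
  Right convolution by \<open>f \<in> A\<^sub>e'\<close>. It is the transpose of \<open>g \<mapsto> gf\<close> on \<open>A\<^sub>p'\<close>, that is,
  \<open>(gf)(x) = g (translate f p x)\<close>.
\<close>

definition translate :: "('a \<Rightarrow> complex) \<Rightarrow> 'g \<Rightarrow> 'a \<Rightarrow> 'a" where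
  "translate f p x = tensor_lift (\<lambda>a b. f b *\<^sub>C a) (\<delta> p \<one> x)"

lemma clinear_translate: "clinear f \<Longrightarrow> clinear (translate f p)"
  unfolding translate_def
  by (intro multilinear) (use clinear_compose[of f] in \<open>auto intro: multilinear\<close>)

lemma translate_closed:
  assumes f: "clinear f" and p: "p \<in> carrier G"
  shows "translate f p x \<in> A p"
  unfolding translate_def
proof (rule linear_image_tensor_sub[OF comult_closed[OF p one_closed] _ subspace[OF p]])
  have bil: "cbilinear (\<lambda>a b. f b *\<^sub>C a)" by (intro multilinear f)
  show "clinear (tensor_lift (\<lambda>a b. f b *\<^sub>C a))" by (rule clinear_tensor_lift[OF bil])
  show "tensor_lift (\<lambda>a b. f b *\<^sub>C a) (a \<otimes>\<^sub>t b) \<in> A p" if "a \<in> A p" for a b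
    unfolding tensor_lift_pure[OF bil] by (rule cvs.subspace_scale[OF subspace[OF p] that])
qed

lemma comult_translate:
  assumes f: "clinear f" and p: "p \<in> carrier G" and q: "q \<in> carrier G"
  shows "\<delta> p q (translate f (p \<otimes> q) x) = tensor_lift (\<lambda>a b. a \<otimes>\<^sub>t translate f q b) (\<delta> p q x)"
proof -
  note lin = multilinear clinear_compose[OF f] f
  have "\<delta> p q (translate f (p \<otimes> q) x)
      = tensor_lift (\<lambda>v c. f c *\<^sub>C \<delta> p q v) (\<delta> (p \<otimes> q) \<one> x)"
    unfolding translate_def
    by (subst linear_of_tensor_lift[where g = "\<delta> p q"])
       ((intro lin clinear_comult)+, simp add: clinear_scaleC[OF clinear_comult])
  also have "\<dots> = tensor_lift (\<lambda>v c. tensor_lift (\<lambda>a b. f c *\<^sub>C (a \<otimes>\<^sub>t b)) (\<delta> p q v)) (\<delta> (p \<otimes> q) \<one> x)"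
  proof -
    have "f c *\<^sub>C t = tensor_lift (\<lambda>a b. f c *\<^sub>C (a \<otimes>\<^sub>t b)) t" for c and t :: "'a \<otimes> 'a"
      by (rule linear_as_tensor_lift[where g = "\<lambda>t. f c *\<^sub>C t"]) (intro lin)
    then show ?thesis by metis
  qed
  also have "\<dots> = tensor_lift (\<lambda>a w. tensor_lift (\<lambda>b c. f c *\<^sub>C (a \<otimes>\<^sub>t b)) (\<delta> q \<one> w)) (\<delta> p (q \<otimes> \<one>) x)"
    by (rule sweedler_assoc) (intro lin p q one_closed)+
  also have "(\<lambda>a w. tensor_lift (\<lambda>b c. f c *\<^sub>C (a \<otimes>\<^sub>t b)) (\<delta> q \<one> w)) = (\<lambda>a w. a \<otimes>\<^sub>t translate f q w)"
  proof (intro ext)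
    fix a w
    have "a \<otimes>\<^sub>t translate f q w = tensor_lift (\<lambda>b c. a \<otimes>\<^sub>t (f c *\<^sub>C b)) (\<delta> q \<one> w)"
      unfolding translate_def by (rule linear_of_tensor_lift[where g = "\<lambda>t. a \<otimes>\<^sub>t t"]) (intro lin)+
    then show "tensor_lift (\<lambda>b c. f c *\<^sub>C (a \<otimes>\<^sub>t b)) (\<delta> q \<one> w) = a \<otimes>\<^sub>t translate f q w"
      by (simp add: pure_tensor_linear)
  qed
  finally show ?thesis using q by simp
qed

text \<open>
  If \<open>g p i\<close> is the basis dual to \<open>e p i\<close>, this is the trace of the operator
  \<open>x \<mapsto> translate f p (a * S\<^sup>2(x))\<close> on \<open>A\<^sub>p\<close>.
\<close>

definition trace_functional ::
  "('a \<Rightarrow> complex) \<Rightarrow> ('g \<Rightarrow> nat) \<Rightarrow> ('g \<Rightarrow> nat \<Rightarrow> 'a) \<Rightarrow> ('g \<Rightarrow> nat \<Rightarrow> 'a \<Rightarrow> complex) \<Rightarrow> 'g \<Rightarrow> 'a \<Rightarrow> complex"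
  where "trace_functional f n e g p a = (\<Sum>i<n p. g p i (translate f p (a * s (s (e p i)))))"

text \<open>
  Each summand of the trace over \<open>A\<^sub>q\<close> is rewritten by \<open>pure_antipode_sq\<close> so that \<open>a\<close> enters
  only through the operator \<open>T\<close> on \<open>A\<^bsub>pq\<^esub>\<close> (\<open>summand\<close>). The expansion
  of \<open>T\<close> into operators of rank one, \<open>T(d) = \<Sum>\<^sub>j g\<^sub>j(d) \<xi>\<^sub>j\<close>, leaves for every \<open>j\<close> a sum over the dual
  basis of \<open>A\<^sub>q\<close>, which collapses to \<open>\<xi>\<^sub>1 S(\<xi>\<^sub>2) g\<^sub>j(\<xi>\<^sub>3) = g\<^sub>j(\<xi>) 1\<close> for \<open>\<xi> = \<xi>\<^sub>j\<close> (\<open>contract\<close>).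
\<close>

theorem trace_functional_invariant:
  assumes f: "clinear f"
    and g: "\<And>p i. p \<in> carrier G \<Longrightarrow> i < n p \<Longrightarrow> clinear (g p i)"
    and e: "\<And>p i. p \<in> carrier G \<Longrightarrow> i < n p \<Longrightarrow> e p i \<in> A p"
    and expand: "\<And>p x. p \<in> carrier G \<Longrightarrow> x \<in> A p \<Longrightarrow> (\<Sum>i<n p. g p i x *\<^sub>C e p i) = x"
    and p: "p \<in> carrier G" and q: "q \<in> carrier G"
  shows "tensor_lift (\<lambda>x y. trace_functional f n e g q y *\<^sub>C x) (\<delta> p q a)
    = trace_functional f n e g (p \<otimes> q) a *\<^sub>C u p"
proof -
  let ?r = "p \<otimes> q"
  have r: "?r \<in> carrier G" and pi: "inv p \<in> carrier G" using p q by simp_all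
  define T where "T d = translate f ?r (a * s (s d))" for d
  note lin0 = multilinear clinear_compose[OF clinear_translate[OF f]]
  have linT: "clinear h \<Longrightarrow> clinear (\<lambda>x. T (h x))" for h :: "'a \<Rightarrow> 'a"
    unfolding T_def by (intro lin0)
  note lin1 = lin0 linT
  define \<xi> where "\<xi> j = T (e ?r j)" for j
  have \<xi>: "\<xi> j \<in> A ?r" for j unfolding \<xi>_def T_def by (rule translate_closed[OF f r])
  have T_expand: "T d = (\<Sum>j<n ?r. g ?r j d *\<^sub>C \<xi> j)" if "d \<in> A ?r" for d
  proof -
    have T: "clinear T" using linT[OF clinear_ident] by simp
    have "T d = T (\<Sum>j<n ?r. g ?r j d *\<^sub>C e ?r j)" by (simp add: expand[OF r that])
    also have "\<dots> = (\<Sum>j<n ?r. g ?r j d *\<^sub>C \<xi> j)"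
      by (simp add: clinear_sum[OF T] clinear_scaleC[OF T] \<xi>_def)
    finally show ?thesis .
  qed
  \<comment> \<open>\<open>S(y\<^sub>1) g\<^sub>j(y\<^sub>2)\<close>: what remains of the second and third leg of \<open>\<xi>\<^sub>j\<close> in the contraction\<close>
  define Z where "Z j y = tensor_lift (\<lambda>c d. g ?r j d *\<^sub>C s c) (\<delta> (inv p) ?r y)" for j y
  have linZ: "clinear h \<Longrightarrow> clinear (\<lambda>x. Z j (h x))" if "j < n ?r" for h :: "'a \<Rightarrow> 'a" and j
    unfolding Z_def by (intro lin1 clinear_compose[OF g[OF r that]])
  have summand: "tensor_lift (\<lambda>x y. g q i (translate f q (y * s (s (e q i)))) *\<^sub>C x) (\<delta> p q a)
      = (\<Sum>j<n ?r. tensor_lift (\<lambda>x y. g q i y *\<^sub>C (x * Z j (e q i))) (\<delta> p q (\<xi> j)))"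
    if i: "i < n q" for i
  proof -
    note lin = lin1 clinear_compose[OF g[OF q i]] clinear_compose[OF g[OF r]]
    \<comment> \<open>the \<open>i\<close>-th term of the partial trace applies \<open>g q i \<circ> translate f q\<close> to the second leg\<close>
    define K where "K = tensor_lift (\<lambda>(x :: 'a) y. g q i (translate f q y) *\<^sub>C x)"
    have bilK: "cbilinear (\<lambda>(x :: 'a) y. g q i (translate f q y) *\<^sub>C x)" by (intro lin)
    have K: "clinear K" unfolding K_def by (rule clinear_tensor_lift[OF bilK])
    note linK = lin clinear_compose[OF K]
    have K_pure: "K (x \<otimes>\<^sub>t y) = g q i (translate f q y) *\<^sub>C x" for x y
      unfolding K_def by (rule tensor_lift_pure[OF bilK])
    have K_mult: "K (t * (z \<otimes>\<^sub>t y')) = tensor_lift (\<lambda>x y. g q i (translate f q (y * y')) *\<^sub>C (x * z)) t" for t z y'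
      using linear_as_tensor_lift[where g = "\<lambda>t. K (t * (z \<otimes>\<^sub>t y'))" and t = t]
      by (simp add: linK K_pure times_pure_tensor)
    \<comment> \<open>\<open>K\<close> absorbs the translation into the argument of the comultiplication\<close>
    have K_comult: "K (\<delta> p q w * (z \<otimes>\<^sub>t u q)) = tensor_lift (\<lambda>x y. g q i y *\<^sub>C (x * z)) (\<delta> p q (translate f ?r w))"
      for w z
    proof -
      have bil: "cbilinear (\<lambda>x y. g q i y *\<^sub>C (x * z))" by (intro lin)
      have "K (\<delta> p q w * (z \<otimes>\<^sub>t u q)) = tensor_lift (\<lambda>x y. g q i (translate f q y) *\<^sub>C (x * z)) (\<delta> p q w)"
        unfolding K_mult by (rule sweedler_cong[OF p q]) (intro lin, intro lin, simp add: unit_right[OF q])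
      also have "\<dots> = tensor_lift (\<lambda>x y. g q i y *\<^sub>C (x * z)) (\<delta> p q (translate f ?r w))"
        unfolding comult_translate[OF f p q]
        by (subst linear_of_tensor_lift[where g = "tensor_lift (\<lambda>x y. g q i y *\<^sub>C (x * z))"])
           ((intro clinear_tensor_lift bil lin)+, simp add: tensor_lift_pure[OF bil])
      finally show ?thesis .
    qed
    have "tensor_lift (\<lambda>x y. g q i (translate f q (y * s (s (e q i)))) *\<^sub>C x) (\<delta> p q a)
        = K (\<delta> p q a * (u p \<otimes>\<^sub>t s (s (e q i))))"
      unfolding K_mult by (rule sweedler_cong[OF p q]) (intro lin, intro lin, simp add: unit_right[OF p])
    also have "\<dots> = K (\<delta> p q a * tensor_lift (\<lambda>c d. \<delta> p q (s (s d)) * (s c \<otimes>\<^sub>t u q)) (\<delta> (inv p) ?r (e q i)))"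
      by (simp only: pure_antipode_sq[OF p q e[OF q i]])
    also have "\<dots> = tensor_lift (\<lambda>c d. K (\<delta> p q a * (\<delta> p q (s (s d)) * (s c \<otimes>\<^sub>t u q)))) (\<delta> (inv p) ?r (e q i))"
      by (rule linear_of_tensor_lift[where g = "\<lambda>t. K (\<delta> p q a * t)"]) (intro linK)+
    also have "\<dots> = tensor_lift (\<lambda>c d. tensor_lift (\<lambda>x y. g q i y *\<^sub>C (x * s c)) (\<delta> p q (T d))) (\<delta> (inv p) ?r (e q i))"
      by (simp add: mult.assoc[symmetric] comult_mult[OF p q, symmetric] K_comult T_def)
    also have "\<dots> = tensor_lift (\<lambda>c d. \<Sum>j<n ?r. g ?r j d *\<^sub>C tensor_lift (\<lambda>x y. g q i y *\<^sub>C (x * s c)) (\<delta> p q (\<xi> j)))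
        (\<delta> (inv p) ?r (e q i))"
    proof (rule sweedler_cong[OF pi r])
      fix c d assume d: "d \<in> A ?r"
      have "clinear (\<lambda>v. tensor_lift (\<lambda>x y. g q i y *\<^sub>C (x * s c)) (\<delta> p q v))" by (intro lin)
      then show "tensor_lift (\<lambda>x y. g q i y *\<^sub>C (x * s c)) (\<delta> p q (T d))
          = (\<Sum>j<n ?r. g ?r j d *\<^sub>C tensor_lift (\<lambda>x y. g q i y *\<^sub>C (x * s c)) (\<delta> p q (\<xi> j)))"
        by (simp add: T_expand[OF d] clinear_sum[of "\<lambda>v. tensor_lift (\<lambda>x y. g q i y *\<^sub>C (x * s c)) (\<delta> p q v)"]
            clinear_scaleC[of "\<lambda>v. tensor_lift (\<lambda>x y. g q i y *\<^sub>C (x * s c)) (\<delta> p q v)"])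
    qed (intro lin; simp)+
    also have "\<dots> = (\<Sum>j<n ?r. tensor_lift (\<lambda>c d. g ?r j d *\<^sub>C tensor_lift (\<lambda>x y. g q i y *\<^sub>C (x * s c)) (\<delta> p q (\<xi> j)))
        (\<delta> (inv p) ?r (e q i)))"
      by (rule tensor_lift_sum) (intro lin; simp)
    also have "\<dots> = (\<Sum>j<n ?r. tensor_lift (\<lambda>x y. g q i y *\<^sub>C (x * Z j (e q i))) (\<delta> p q (\<xi> j)))"
    proof (rule sum.cong[OF refl])
      fix j assume "j \<in> {..<n ?r}"
      then have j: "j < n ?r" by simp
      let ?H = "\<lambda>z. tensor_lift (\<lambda>x y. g q i y *\<^sub>C (x * z)) (\<delta> p q (\<xi> j))"
      have H: "clinear ?H" by (intro lin)
      have "?H (Z j (e q i)) = tensor_lift (\<lambda>c d. ?H (g ?r j d *\<^sub>C s c)) (\<delta> (inv p) ?r (e q i))"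
        unfolding Z_def by (rule linear_of_tensor_lift[where g = ?H, OF H]) (intro lin j)
      then show "tensor_lift (\<lambda>c d. g ?r j d *\<^sub>C ?H (s c)) (\<delta> (inv p) ?r (e q i)) = ?H (Z j (e q i))"
        by (simp only: clinear_scaleC[of ?H, OF H])
    qed
    finally show ?thesis .
  qed
  have contract: "(\<Sum>i<n q. tensor_lift (\<lambda>x y. g q i y *\<^sub>C (x * Z j (e q i))) (\<delta> p q (\<xi> j)))
      = g ?r j (\<xi> j) *\<^sub>C u p" if j: "j < n ?r" for j
  proof -
    note lin = lin1 clinear_compose[OF g[OF q]] clinear_compose[OF g[OF r j]] linZ[OF j]
    have "(\<Sum>i<n q. tensor_lift (\<lambda>x y. g q i y *\<^sub>C (x * Z j (e q i))) (\<delta> p q (\<xi> j)))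
        = tensor_lift (\<lambda>x y. \<Sum>i<n q. g q i y *\<^sub>C (x * Z j (e q i))) (\<delta> p q (\<xi> j))"
      by (rule tensor_lift_sum[symmetric]) (intro lin; simp)
    also have "\<dots> = tensor_lift (\<lambda>x y. tensor_lift (\<lambda>c d. g ?r j d *\<^sub>C (x * s c)) (\<delta> (inv p) ?r y)) (\<delta> p q (\<xi> j))"
    proof (rule sweedler_cong[OF p q])
      fix x y assume y: "y \<in> A q"
      have lZ: "clinear (\<lambda>y. x * Z j y)" by (intro lin)
      have "(\<Sum>i<n q. g q i y *\<^sub>C (x * Z j (e q i))) = x * Z j (\<Sum>i<n q. g q i y *\<^sub>C e q i)"
        by (simp only: clinear_sum[of "\<lambda>y. x * Z j y", OF lZ] clinear_scaleC[of "\<lambda>y. x * Z j y", OF lZ])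
      also have "\<dots> = x * Z j y" by (simp only: expand[OF q y])
      also have "\<dots> = tensor_lift (\<lambda>c d. x * (g ?r j d *\<^sub>C s c)) (\<delta> (inv p) ?r y)"
        unfolding Z_def by (rule linear_of_tensor_lift[where g = "\<lambda>z. x * z"]) (intro lin)+
      finally show "(\<Sum>i<n q. g q i y *\<^sub>C (x * Z j (e q i)))
          = tensor_lift (\<lambda>c d. g ?r j d *\<^sub>C (x * s c)) (\<delta> (inv p) ?r y)"
        by (simp only: mult_scaleC_right)
    qed (intro lin; simp)+
    also have "\<dots> = g ?r j (\<xi> j) *\<^sub>C u p"
      by (rule cancel_antipode_right[OF p q \<xi>, where h = "\<lambda>a b. g ?r j b *\<^sub>C a"]) (intro lin)+
    finally show ?thesis .
  qed
  have "tensor_lift (\<lambda>x y. trace_functional f n e g q y *\<^sub>C x) (\<delta> p q a)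
      = (\<Sum>i<n q. tensor_lift (\<lambda>x y. g q i (translate f q (y * s (s (e q i)))) *\<^sub>C x) (\<delta> p q a))"
    unfolding trace_functional_def cvs.scale_sum_left
    by (rule tensor_lift_sum) (intro lin1 clinear_compose[OF g[OF q]]; simp)
  also have "\<dots> = (\<Sum>i<n q. \<Sum>j<n ?r. tensor_lift (\<lambda>x y. g q i y *\<^sub>C (x * Z j (e q i))) (\<delta> p q (\<xi> j)))"
    by (simp add: summand)
  also have "\<dots> = (\<Sum>j<n ?r. g ?r j (\<xi> j) *\<^sub>C u p)"
    by (subst sum.swap) (simp add: contract)
  also have "\<dots> = trace_functional f n e g ?r a *\<^sub>C u p"
    by (simp add: trace_functional_def \<xi>_def T_def cvs.scale_sum_left)
  finally show ?thesis .
qed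

end

section \<open>Multipliers of tensor products\<close>

lemma left_act_mult_tensor: "left_act (mult_tensor m n) t = tensor_map (left_act m) (left_act n) t"
  and right_act_mult_tensor: "right_act (mult_tensor m n) t = tensor_map (right_act m) (right_act n) t"
  by (transfer; simp)+

lemma left_act_mult_tensor_pure [simp]:
    "left_act (mult_tensor m n) (a \<otimes>\<^sub>t b) = left_act m a \<otimes>\<^sub>t left_act n b"
  and right_act_mult_tensor_pure [simp]:
    "right_act (mult_tensor m n) (a \<otimes>\<^sub>t b) = right_act m a \<otimes>\<^sub>t right_act n b"
  by (simp_all add: left_act_mult_tensor right_act_mult_tensor tensor_map_pure
      clinear_left_act clinear_right_act)

lemma clinear_left_act_fun: "clinear f \<Longrightarrow> clinear (\<lambda>x. left_act (f x) b)"
  and clinear_right_act_fun: "clinear f \<Longrightarrow> clinear (\<lambda>x. right_act (f x) b)"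
  by (simp_all add: clinear_iff left_act_simps right_act_simps)

lemmas act_linear = clinear_left_act_fun clinear_right_act_fun
  clinear_compose[OF clinear_left_act] clinear_compose[OF clinear_right_act]

lemma clinear_to_mult: "clinear to_mult"
  by (auto simp: clinear_iff left_act_simps right_act_simps left_act_to_mult right_act_to_mult
      distrib_left distrib_right mult_scaleC_left mult_scaleC_right intro!: multiplier_eqI)

lemma to_mult_mult: "to_mult (a * b) = to_mult a * to_mult b"
  by (rule multiplier_eqI)
     (simp_all add: left_act_simps right_act_simps left_act_to_mult right_act_to_mult mult.assoc)

lemma multiplier_tensor_eqI:
  assumes "\<And>a b. left_act m (a \<otimes>\<^sub>t b) = left_act m' (a \<otimes>\<^sub>t b)"
    and "\<And>a b. right_act m (a \<otimes>\<^sub>t b) = right_act m' (a \<otimes>\<^sub>t b)"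
  shows "m = m'"
  by (rule multiplier_eqI; rule tensor_linear_unique[OF clinear_left_act clinear_left_act]
        tensor_linear_unique[OF clinear_right_act clinear_right_act]; rule assms)

lemma clinear_mult_tensor_left: "clinear f \<Longrightarrow> clinear (\<lambda>x. mult_tensor (f x) n)"
  and clinear_mult_tensor_right: "clinear f \<Longrightarrow> clinear (\<lambda>x. mult_tensor n (f x))"
  unfolding clinear_iff
  by (auto intro!: multiplier_tensor_eqI simp: left_act_simps right_act_simps pure_tensor_linear)

lemma left_act_mult:
  assumes "nondegenerate TYPE('b::complex_algebra)"
  shows "left_act m (a * b) = left_act m a * (b :: 'b)"
proof -
  have "c * (left_act m (a * b) - left_act m a * b) = 0" for c
    by (simp add: right_diff_distrib multiplier_assoc mult.assoc[symmetric])
  then show ?thesis using assms unfolding nondegenerate_def by (metis right_minus_eq)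
qed

text \<open>
  For a non-degenerate product the left action determines the right one, because
  \<open>a (m b) = (a m) b\<close>. Hence equations of multipliers are checked on one side only.
\<close>

lemma multiplier_eq_leftI:
  assumes "nondegenerate TYPE('b::complex_algebra)" "\<And>b. left_act m b = left_act m' (b :: 'b)"
  shows "m = m'"
proof (rule multiplier_eqI[OF assms(2)])
  fix b
  have "(right_act m b - right_act m' b) * c = 0" for c
    by (simp add: left_diff_distrib multiplier_assoc[symmetric] assms(2))
  then show "right_act m b = right_act m' b"
    using assms(1) unfolding nondegenerate_def by (metis right_minus_eq)
qed

text \<open>
  This and the next lemma make \<open>tensor_assoc\<close> an isomorphism of algebras, so that
  \<open>mult_transport\<close> along it acts as expected in the coassociativity axiom.
\<close>

lemma bij_tensor_assoc: "bij (tensor_assoc :: ('a::complex_vector \<otimes> 'b::complex_vector) \<otimes> 'c::complex_vector \<Rightarrow> _)"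
proof (rule o_bij)
  let ?I = "\<lambda>a t. tensor_lift (\<lambda>(b :: 'b) (c :: 'c). ((a :: 'a) \<otimes>\<^sub>t b) \<otimes>\<^sub>t c) t"
  have bil: "cbilinear (\<lambda>b c. (a \<otimes>\<^sub>t b) \<otimes>\<^sub>t c)" for a :: 'a
    by (intro multilinear_intros)
  have bilI: "cbilinear ?I" by (intro multilinear_intros)
  note pure = tensor_lift_pure[OF bil] tensor_lift_pure[OF bilI]
  have linI: "clinear (tensor_lift ?I)" by (rule clinear_tensor_lift[OF bilI])
  have 1: "tensor_lift ?I (tensor_assoc (s \<otimes>\<^sub>t c)) = s \<otimes>\<^sub>t c" for s c
    by (rule tensor_linear_unique[where g = "\<lambda>s. tensor_lift ?I (tensor_assoc (s \<otimes>\<^sub>t c))"])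
       (intro clinear_compose[OF linI] clinear_compose[OF clinear_tensor_assoc] multilinear_intros
        | simp add: pure)+
  have "tensor_lift ?I (tensor_assoc t) = t" for t
    by (rule tensor_linear_unique[where g = "\<lambda>s. tensor_lift ?I (tensor_assoc s)" and g' = "\<lambda>t. t"])
       (intro clinear_compose[OF linI] clinear_tensor_assoc multilinear_intros
        | simp add: 1)+
  then show "tensor_lift ?I \<circ> tensor_assoc = id" by auto
  have 2: "tensor_assoc (tensor_lift ?I (a \<otimes>\<^sub>t t)) = a \<otimes>\<^sub>t t" for a t
    by (rule tensor_linear_unique[where g = "\<lambda>t. tensor_assoc (tensor_lift ?I (a \<otimes>\<^sub>t t))"])
       (intro clinear_compose[OF linI] clinear_compose[OF clinear_tensor_assoc] multilinear_intros
        | simp add: pure)+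
  have "tensor_assoc (tensor_lift ?I t) = t" for t
    by (rule tensor_linear_unique[where g = "\<lambda>s. tensor_assoc (tensor_lift ?I s)" and g' = "\<lambda>t. t"])
       (intro clinear_compose[OF clinear_tensor_assoc] linI multilinear_intros
        | simp add: 2)+
  then show "tensor_assoc \<circ> tensor_lift ?I = id" by auto
qed

lemma tensor_assoc_mult: "tensor_assoc (s * t) = tensor_assoc s * tensor_assoc t"
  for s t :: "('a::complex_algebra \<otimes> 'b::complex_algebra) \<otimes> 'c::complex_algebra"
proof -
  note lin = clinear_compose[OF clinear_tensor_assoc] clinear_tensor_assoc multilinear_intros
  have 1: "tensor_assoc (((a \<otimes>\<^sub>t b) \<otimes>\<^sub>t c) * (t' \<otimes>\<^sub>t c')) = tensor_assoc ((a \<otimes>\<^sub>t b) \<otimes>\<^sub>t c) * tensor_assoc (t' \<otimes>\<^sub>t c')"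
    for a :: 'a and b :: 'b and c c' :: 'c and t'
    by (rule tensor_linear_unique[where t = t'
          and g = "\<lambda>t'. tensor_assoc (((a \<otimes>\<^sub>t b) \<otimes>\<^sub>t c) * (t' \<otimes>\<^sub>t c'))"
          and g' = "\<lambda>t'. tensor_assoc ((a \<otimes>\<^sub>t b) \<otimes>\<^sub>t c) * tensor_assoc (t' \<otimes>\<^sub>t c')"])
       (intro lin | simp add: times_pure_tensor)+
  have 2: "tensor_assoc (((a \<otimes>\<^sub>t b) \<otimes>\<^sub>t c) * t) = tensor_assoc ((a \<otimes>\<^sub>t b) \<otimes>\<^sub>t c) * tensor_assoc t"
    for a :: 'a and b :: 'b and c :: 'c and t
    by (rule tensor_linear_unique[where t = t
          and g = "\<lambda>t. tensor_assoc (((a \<otimes>\<^sub>t b) \<otimes>\<^sub>t c) * t)"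
          and g' = "\<lambda>t. tensor_assoc ((a \<otimes>\<^sub>t b) \<otimes>\<^sub>t c) * tensor_assoc t"])
       (intro lin | simp only: 1)+
  have 3: "tensor_assoc ((s' \<otimes>\<^sub>t c) * t) = tensor_assoc (s' \<otimes>\<^sub>t c) * tensor_assoc t"
    for c :: 'c and s' :: "'a \<otimes> 'b" and t
    by (rule tensor_linear_unique[where t = s'
          and g = "\<lambda>s'. tensor_assoc ((s' \<otimes>\<^sub>t c) * t)"
          and g' = "\<lambda>s'. tensor_assoc (s' \<otimes>\<^sub>t c) * tensor_assoc t"])
       (intro lin | simp only: 2)+
  show ?thesis
    by (rule tensor_linear_unique[where t = s
          and g = "\<lambda>s. tensor_assoc (s * t)"
          and g' = "\<lambda>s. tensor_assoc s * tensor_assoc t"])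
       (intro lin | simp only: 3)+
qed

section \<open>Cograded multiplier Hopf algebras with unital components\<close>

locale cograded_multiplier_hopf_algebra = group G
  for G :: "('g, 'm) monoid_scheme" (structure) +
  fixes A :: "'g \<Rightarrow> 'a::complex_algebra set"
    and \<Delta> :: "'a comult"
    and \<epsilon> :: "'a \<Rightarrow> complex"
    and S :: "'a \<Rightarrow> 'a multiplier"
  assumes multiplier_hopf: "multiplier_hopf_algebra \<Delta>"
    and cograded: "cograded G A \<Delta>"
    and has_unit: "p \<in> carrier G \<Longrightarrow> has_identity (A p)"
    and counit: "is_counit \<Delta> \<epsilon>"
    and antipode: "is_antipode \<Delta> \<epsilon> S"
begin

definition unit :: "'g \<Rightarrow> 'a" where
  "unit p = (SOME v. v \<in> A p \<and> (\<forall>x\<in>A p. v * x = x \<and> x * v = x))"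

text \<open>
  The \<open>(p,q)\<close>-component of \<open>\<Delta>(x)\<close>, obtained by applying the multiplier to the identity of
  \<open>A\<^sub>p \<otimes> A\<^sub>q\<close>. This is linear in \<open>x\<close> and defined for every \<open>x\<close>; it vanishes on \<open>A\<^sub>r\<close> for \<open>r \<noteq> pq\<close>.
\<close>

definition \<delta> :: "'g \<Rightarrow> 'g \<Rightarrow> 'a \<Rightarrow> 'a \<otimes> 'a" where
  "\<delta> p q x = left_act (\<Delta> x) (unit p \<otimes>\<^sub>t unit q)"

definition s :: "'a \<Rightarrow> 'a" where
  "s x = from_mult (S x)"

lemma unit_props:
  assumes "p \<in> carrier G"
  shows "unit p \<in> A p" "x \<in> A p \<Longrightarrow> unit p * x = x" "x \<in> A p \<Longrightarrow> x * unit p = x"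
proof -
  have "unit p \<in> A p \<and> (\<forall>x\<in>A p. unit p * x = x \<and> x * unit p = x)"
    unfolding unit_def by (rule someI_ex) (use has_unit[OF assms] in \<open>auto simp: has_identity_def\<close>)
  then show "unit p \<in> A p" "x \<in> A p \<Longrightarrow> unit p * x = x" "x \<in> A p \<Longrightarrow> x * unit p = x" by auto
qed

lemma subspace_component: "p \<in> carrier G \<Longrightarrow> cvs.subspace (A p)"
  using cograded by (auto simp: cograded_def direct_sum_def)

lemma component_mult_closed: "p \<in> carrier G \<Longrightarrow> x \<in> A p \<Longrightarrow> y \<in> A p \<Longrightarrow> x * y \<in> A p"
  using cograded by (auto simp: cograded_def)

lemma component_mult_other:
  "p \<in> carrier G \<Longrightarrow> q \<in> carrier G \<Longrightarrow> p \<noteq> q \<Longrightarrow> x \<in> A p \<Longrightarrow> y \<in> A q \<Longrightarrow> x * y = 0"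
  using cograded by (auto simp: cograded_def)

lemma unit_nonzero: assumes "p \<in> carrier G" shows "unit p \<noteq> 0"
proof
  assume "unit p = 0"
  then have "x = 0" if "x \<in> A p" for x using unit_props(2)[OF assms that] by simp
  moreover have "A p \<noteq> {0}" using cograded assms by (auto simp: cograded_def)
  ultimately show False using cvs.subspace_0[OF subspace_component[OF assms]] by auto
qed

lemma unit_mult_Sum_any:
  assumes c: "decomposes (carrier G) A x c" and p: "p \<in> carrier G"
  shows "unit p * x = c p" "x * unit p = c p"
proof -
  have fin: "finite {q. c q \<noteq> 0}" and mem: "\<And>q. q \<in> carrier G \<Longrightarrow> c q \<in> A q"
    and off: "\<And>q. q \<notin> carrier G \<Longrightarrow> c q = 0" and x: "x = Sum_any c"
    using c by (auto simp: decomposes_def)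
  let ?F = "insert p {q. c q \<noteq> 0}"
  have xF: "x = sum c ?F" 
    unfolding x Sum_any.expand_set using fin by (intro sum.mono_neutral_left) auto
  have 1: "unit p * c q = (if q = p then c p else 0)" "c q * unit p = (if q = p then c p else 0)" for q
    using unit_props[OF p] mem[of q] off[of q] p component_mult_other[OF p, of q "unit p" "c q"]
      component_mult_other[OF _ p, of q "c q" "unit p"] mem[OF p]
    by (cases "q \<in> carrier G"; auto)+
  show "unit p * x = c p" "x * unit p = c p"
    unfolding xF sum_distrib_left sum_distrib_right using fin by (simp_all add: 1)
qed

lemma unique_decomposition: "\<exists>!c. decomposes (carrier G) A x c"
proof -
  have "direct_sum (carrier G) A" using cograded unfolding cograded_def by (rule conjunct1)
  then show ?thesis by (simp add: direct_sum_def)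
qed

lemma decomposition: obtains c where "decomposes (carrier G) A x c"
  using unique_decomposition[of x] by blast

lemma component_eq: "p \<in> carrier G \<Longrightarrow> component (carrier G) A p x = unit p * x"
proof -
  assume p: "p \<in> carrier G"
  obtain c where c: "decomposes (carrier G) A x c" by (rule decomposition)
  then have "(THE c. decomposes (carrier G) A x c) = c"
    by (rule the1_equality[OF unique_decomposition])
  then show ?thesis using unit_mult_Sum_any(1)[OF c p] by (simp add: component_def)
qed

lemma finite_support: "finite {p \<in> carrier G. unit p * x \<noteq> 0}"
proof -
  obtain c where c: "decomposes (carrier G) A x c" by (rule decomposition)
  then have "{p \<in> carrier G. unit p * x \<noteq> 0} \<subseteq> {p. c p \<noteq> 0}"
    using unit_mult_Sum_any(1)[OF c] by auto
  then show ?thesis using c by (auto simp: decomposes_def intro: finite_subset)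
qed

lemma graded_induct [case_names zero add homogeneous]:
  assumes "P 0" "\<And>x y. P x \<Longrightarrow> P y \<Longrightarrow> P (x + y)" "\<And>p x. p \<in> carrier G \<Longrightarrow> x \<in> A p \<Longrightarrow> P x"
  shows "P x"
proof -
  obtain c where c: "decomposes (carrier G) A x c" by (rule decomposition)
  have "P (c q)" for q using c assms(1,3) by (cases "q \<in> carrier G") (auto simp: decomposes_def)
  then have "P (sum c F)" for F
    by (induction F rule: infinite_finite_induct) (simp_all add: assms)
  then show ?thesis using c by (metis decomposes_def Sum_any.expand_set)
qed

lemma homogeneous_linear_unique:
  assumes g: "clinear g" "clinear g'"
    and eq: "\<And>p x. p \<in> carrier G \<Longrightarrow> x \<in> A p \<Longrightarrow> g x = g' x"
  shows "g x = g' x"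
  by (induction x rule: graded_induct) (simp_all add: eq clinear_zero clinear_add g)

lemma homogeneous_tensor_linear_unique:
  assumes g: "clinear g" "clinear g'"
    and eq: "\<And>p q a b. p \<in> carrier G \<Longrightarrow> q \<in> carrier G \<Longrightarrow> a \<in> A p \<Longrightarrow> b \<in> A q
      \<Longrightarrow> g (a \<otimes>\<^sub>t b) = g' (a \<otimes>\<^sub>t b)"
  shows "g t = g' t"
proof (rule tensor_linear_unique[OF g])
  note lin = clinear_compose[OF g(1)] clinear_compose[OF g(2)] multilinear_intros
  have 1: "g (a \<otimes>\<^sub>t b) = g' (a \<otimes>\<^sub>t b)" if "p \<in> carrier G" "a \<in> A p" for p a b
    by (rule homogeneous_linear_unique[where g = "\<lambda>b. g (a \<otimes>\<^sub>t b)" and g' = "\<lambda>b. g' (a \<otimes>\<^sub>t b)"])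
       (intro lin | rule eq[OF that(1) _ that(2)])+
  show "g (a \<otimes>\<^sub>t b) = g' (a \<otimes>\<^sub>t b)" for a b
    by (rule homogeneous_linear_unique[where g = "\<lambda>a. g (a \<otimes>\<^sub>t b)" and g' = "\<lambda>a. g' (a \<otimes>\<^sub>t b)"])
       (intro lin | rule 1)+
qed

lemma tensor_sub_mult_other:
  assumes pq: "p \<in> carrier G" "q \<in> carrier G" "p' \<in> carrier G" "q' \<in> carrier G"
    and ne: "p \<noteq> p' \<or> q \<noteq> q'"
    and z: "z \<in> tensor_sub (A p) (A q)" and w: "w \<in> tensor_sub (A p') (A q')"
  shows "z * w = 0"
proof -
  have "(a \<otimes>\<^sub>t b) * w = 0" if "a \<in> A p" "b \<in> A q" for a b
    using w
  proof (rule linear_eq_on_tensor_sub[where g' = "\<lambda>_. 0" and g = "\<lambda>w. (a \<otimes>\<^sub>t b) * w"])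
    show "(a \<otimes>\<^sub>t b) * (a' \<otimes>\<^sub>t b') = 0" if "a' \<in> A p'" "b' \<in> A q'" for a' b'
      using ne component_mult_other[OF pq(1,3) _ \<open>a \<in> A p\<close> that(1)]
        component_mult_other[OF pq(2,4) _ \<open>b \<in> A q\<close> that(2)]
      by (auto simp: times_pure_tensor clinear_zero[OF clinear_pure_left[OF clinear_ident]]
          clinear_zero[OF clinear_pure_right[OF clinear_ident]])
  qed (intro multilinear_intros | simp add: clinear_iff)+
  then show ?thesis
    by (intro linear_eq_on_tensor_sub[OF z, where g' = "\<lambda>_. 0" and g = "\<lambda>z. z * w"])
       (intro multilinear_intros | simp add: clinear_iff)+
qed

text \<open>
  The algebra \<open>A\<close> has an identity only if \<open>G\<close> is finite, but every element is fixed by the finite sum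
  of sufficiently many of the identities \<open>1\<^sub>p\<close>. Such local units also exist in \<open>A \<otimes> A\<close> and make its
  product non-degenerate.
\<close>

definition local_unit :: "'g set \<Rightarrow> 'a" where
  "local_unit F = (\<Sum>p\<in>F. unit p)"

lemma local_units: "\<exists>F0. finite F0 \<and> F0 \<subseteq> carrier G \<and>
  (\<forall>F. finite F \<and> F0 \<subseteq> F \<and> F \<subseteq> carrier G \<longrightarrow> x * local_unit F = x \<and> local_unit F * x = x)"
  (is "\<exists>F0. ?P x F0")
proof (induction x rule: graded_induct)
  case zero
  show ?case by (intro exI[of _ "{}"]) simp
next
  case (add x y)
  obtain F1 where "?P x F1" using add(1) by (rule exE)
  moreover obtain F2 where "?P y F2" using add(2) by (rule exE)
  ultimately have "?P (x + y) (F1 \<union> F2)" by (simp add: distrib_left distrib_right)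
  then show ?case by (rule exI)
next
  case (homogeneous p x)
  have unit: "x * unit q = (if q = p then x else 0)" "unit q * x = (if q = p then x else 0)"
    if "q \<in> carrier G" for q
    using that homogeneous unit_props[OF that] component_mult_other[of p q x "unit q"]
      component_mult_other[of q p "unit q" x] by auto
  have "x * local_unit F = x \<and> local_unit F * x = x"
    if F: "finite F" "{p} \<subseteq> F" "F \<subseteq> carrier G" for F
  proof -
    have "(\<Sum>q\<in>F. x * unit q) = (\<Sum>q\<in>F. if q = p then x else 0)"
      "(\<Sum>q\<in>F. unit q * x) = (\<Sum>q\<in>F. if q = p then x else 0)"
      by (rule sum.cong; use unit F in auto)+
    then show ?thesis using F by (simp add: local_unit_def sum_distrib_left sum_distrib_right)
  qed
  then have "?P x {p}" using homogeneous by simp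
  then show ?case by (rule exI)
qed

lemma tensor_local_unit: "\<exists>w. t * w = t \<and> w * t = t" for t :: "'a \<otimes> 'a"
proof -
  have "\<exists>F0. finite F0 \<and> F0 \<subseteq> carrier G \<and>
    (\<forall>F. finite F \<and> F0 \<subseteq> F \<and> F \<subseteq> carrier G \<longrightarrow>
      t * (local_unit F \<otimes>\<^sub>t local_unit F) = t \<and> (local_unit F \<otimes>\<^sub>t local_unit F) * t = t)"
    (is "\<exists>F0. ?P t F0")
  proof (induction t rule: tensor_induct)
    case zero
    show ?case by (intro exI[of _ "{}"]) simp
  next
    case (add x y)
    obtain F1 where "?P x F1" using add(1) by (rule exE)
    moreover obtain F2 where "?P y F2" using add(2) by (rule exE)
    ultimately have "?P (x + y) (F1 \<union> F2)" by (simp add: distrib_left distrib_right)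
    then show ?case by (rule exI)
  next
    case (pure x y)
    let ?Q = "\<lambda>x F0. finite F0 \<and> F0 \<subseteq> carrier G \<and>
      (\<forall>F. finite F \<and> F0 \<subseteq> F \<and> F \<subseteq> carrier G \<longrightarrow> x * local_unit F = x \<and> local_unit F * x = x)"
    obtain F1 where "?Q x F1" using local_units[of x] by (rule exE)
    moreover obtain F2 where "?Q y F2" using local_units[of y] by (rule exE)
    ultimately have "?P (x \<otimes>\<^sub>t y) (F1 \<union> F2)" by (simp add: times_pure_tensor)
    then show ?case by (rule exI)
  qed
  then show ?thesis by blast
qed

lemma nondegenerate_tensor: "nondegenerate TYPE('a \<otimes> 'a)"
  unfolding nondegenerate_def
proof (intro conjI allI impI)
  fix t :: "'a \<otimes> 'a"
  obtain w where "t * w = t" "w * t = t" using tensor_local_unit[of t] by blast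
  then show "\<forall>w. t * w = 0 \<Longrightarrow> t = 0" "\<forall>w. w * t = 0 \<Longrightarrow> t = 0" by metis+
qed

lemma nondegenerate: "nondegenerate TYPE('a)"
  and clinear_Delta: "clinear \<Delta>" and Delta_mult: "\<Delta> (a * b) = \<Delta> a * \<Delta> b"
  and coassociative: "mult_transport tensor_assoc
          (mult_tensor (mult_tensor (to_mult a) 1) 1 * comult_id \<Delta> (comult_r \<Delta> b c))
        = id_comult \<Delta> (comult_l \<Delta> a b) * mult_tensor 1 (mult_tensor 1 (to_mult c))"
  using multiplier_hopf by (auto simp: multiplier_hopf_algebra_def)

end

context cograded_multiplier_hopf_algebra
begin

lemma tensor_units:
  assumes "p \<in> carrier G" "q \<in> carrier G" "t \<in> tensor_sub (A p) (A q)"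
  shows "(unit p \<otimes>\<^sub>t unit q) * t = t" "t * (unit p \<otimes>\<^sub>t unit q) = t"
  by (rule tensor_sub_mult_left_unit[OF assms(3)] tensor_sub_mult_right_unit[OF assms(3)];
      simp add: unit_props assms)+

lemma units_in_tensor_sub:
  "p \<in> carrier G \<Longrightarrow> q \<in> carrier G \<Longrightarrow> unit p \<otimes>\<^sub>t unit q \<in> tensor_sub (A p) (A q)"
  by (intro pure_in_tensor_sub unit_props)

lemma act_on_tensor_sub:
  assumes "p \<in> carrier G" "q \<in> carrier G" "t \<in> tensor_sub (A p) (A q)"
  shows "left_act (mult_tensor 1 (to_mult (unit q))) t = t"
    and "left_act (mult_tensor (to_mult (unit p)) 1) t = t"
    and "right_act (mult_tensor (to_mult (unit p)) 1) t = t"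
  by (rule linear_eq_on_tensor_sub[OF assms(3), where g' = "\<lambda>t. t"];
      simp add: clinear_left_act clinear_right_act clinear_ident left_act_simps right_act_simps
        left_act_to_mult right_act_to_mult unit_props assms)+

lemma cograded_spans:
  assumes "p \<in> carrier G" "q \<in> carrier G"
  shows "cvs.span {\<Delta> a * mult_tensor 1 (to_mult b) | a b. a \<in> A (p \<otimes> q) \<and> b \<in> A q}
      = to_mult ` tensor_sub (A p) (A q)"
    and "cvs.span {mult_tensor (to_mult b) 1 * \<Delta> a | a b. a \<in> A (p \<otimes> q) \<and> b \<in> A p}
      = to_mult ` tensor_sub (A p) (A q)"
proof -
  note spans = cograded[unfolded cograded_def, THEN conjunct2, THEN conjunct2, THEN conjunct2,
      THEN bspec, OF assms(1), THEN bspec, OF assms(2)]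
  show "cvs.span {\<Delta> a * mult_tensor 1 (to_mult b) | a b. a \<in> A (p \<otimes> q) \<and> b \<in> A q}
      = to_mult ` tensor_sub (A p) (A q)" by (rule spans[THEN conjunct1])
  show "cvs.span {mult_tensor (to_mult b) 1 * \<Delta> a | a b. a \<in> A (p \<otimes> q) \<and> b \<in> A p}
      = to_mult ` tensor_sub (A p) (A q)" by (rule spans[THEN conjunct2])
qed

lemma Delta_mult_right:
  assumes "p \<in> carrier G" "q \<in> carrier G" "x \<in> A (p \<otimes> q)" "b \<in> A q"
  obtains z where "z \<in> tensor_sub (A p) (A q)" "\<Delta> x * mult_tensor 1 (to_mult b) = to_mult z"
proof -
  have "\<Delta> x * mult_tensor 1 (to_mult b)
      \<in> cvs.span {\<Delta> a * mult_tensor 1 (to_mult b) | a b. a \<in> A (p \<otimes> q) \<and> b \<in> A q}"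
    using assms by (intro cvs.span_base) blast
  also have "\<dots> = to_mult ` tensor_sub (A p) (A q)"
    by (rule cograded_spans(1)[OF assms(1,2)])
  finally show ?thesis using that by blast
qed

lemma Delta_mult_left:
  assumes "p \<in> carrier G" "q \<in> carrier G" "x \<in> A (p \<otimes> q)" "b \<in> A p"
  obtains z where "z \<in> tensor_sub (A p) (A q)" "mult_tensor (to_mult b) 1 * \<Delta> x = to_mult z"
proof -
  have "mult_tensor (to_mult b) 1 * \<Delta> x
      \<in> cvs.span {mult_tensor (to_mult b) 1 * \<Delta> a | a b. a \<in> A (p \<otimes> q) \<and> b \<in> A p}"
    using assms by (intro cvs.span_base) blast
  also have "\<dots> = to_mult ` tensor_sub (A p) (A q)"
    by (rule cograded_spans(2)[OF assms(1,2)])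
  finally show ?thesis using that by blast
qed

lemma clinear_\<delta>: "clinear (\<delta> p q)"
  unfolding \<delta>_def by (intro act_linear clinear_Delta)

text \<open>
  The cograding says that \<open>\<Delta>(x)(1 \<otimes> 1\<^sub>q)\<close> is an element \<open>z\<close> of \<open>A\<^sub>t \<otimes> A\<^sub>q\<close>, where \<open>t = rq\<^bsup>-1\<^esup>\<close>. On
  \<open>A\<^sub>p \<otimes> A\<^sub>q\<close> the multiplier \<open>\<Delta>(x)\<close> therefore acts as multiplication by \<open>z\<close>, which is zero
  unless \<open>t = p\<close>.
\<close>

lemma delta_homogeneous:
  assumes G: "p \<in> carrier G" "q \<in> carrier G" "r \<in> carrier G"
    and x: "x \<in> A r" and w: "w \<in> tensor_sub (A p) (A q)"
  shows "\<delta> p q x \<in> tensor_sub (A p) (A q)" "left_act (\<Delta> x) w = \<delta> p q x * w"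
    "r \<noteq> p \<otimes> q \<Longrightarrow> \<delta> p q x = 0"
proof -
  let ?p = "r \<otimes> inv q"
  have p': "?p \<in> carrier G" and "x \<in> A (?p \<otimes> q)" using G x by (simp_all add: m_assoc)
  then obtain z where z: "z \<in> tensor_sub (A ?p) (A q)" "\<Delta> x * mult_tensor 1 (to_mult (unit q)) = to_mult z"
    using Delta_mult_right[OF _ G(2) _ unit_props(1)[OF G(2)]] by blast
  have act: "left_act (\<Delta> x) w = z * w" if "w \<in> tensor_sub (A p) (A q)" for w
    using arg_cong[OF z(2), of "\<lambda>m. left_act m w"] act_on_tensor_sub(1)[OF G(1,2) that]
    by (simp add: left_act_simps left_act_to_mult)
  have \<delta>: "\<delta> p q x = z * (unit p \<otimes>\<^sub>t unit q)"
    unfolding \<delta>_def by (rule act[OF units_in_tensor_sub[OF G(1,2)]])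
  have "r = p \<otimes> q" if "?p = p" using that G by (metis inv_solve_right)
  moreover have zero: "z * w = 0" if "?p \<noteq> p" "w \<in> tensor_sub (A p) (A q)" for w
    by (rule tensor_sub_mult_other[OF p' G(2) G(1,2) _ z(1) that(2)]) (simp add: that)
  ultimately show off: "r \<noteq> p \<otimes> q \<Longrightarrow> \<delta> p q x = 0"
    using \<delta> units_in_tensor_sub[OF G(1,2)] G by (metis inv_closed m_assoc l_inv r_one m_closed)
  show "\<delta> p q x \<in> tensor_sub (A p) (A q)" 
    using \<delta> z(1) tensor_units[OF G(1,2)] zero[OF _ units_in_tensor_sub[OF G(1,2)]]
      cvs.subspace_0[OF subspace_tensor_sub] by (cases "?p = p") simp_all
  show "left_act (\<Delta> x) w = \<delta> p q x * w"
    using act[OF w] \<delta> z(1) tensor_units[OF G(1,2)] zero[OF _ w] zero[OF _ units_in_tensor_sub[OF G(1,2)]]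
    by (cases "?p = p") simp_all
qed

lemma delta_closed:
  assumes "p \<in> carrier G" "q \<in> carrier G"
  shows "\<delta> p q x \<in> tensor_sub (A p) (A q)"
proof (induction x rule: graded_induct)
  case (add x y)
  then show ?case by (simp add: clinear_add[OF clinear_\<delta>] cvs.subspace_add subspace_tensor_sub)
next
  case (homogeneous r x)
  show ?case by (rule delta_homogeneous(1)[OF assms homogeneous units_in_tensor_sub[OF assms]])
qed (simp add: clinear_zero[OF clinear_\<delta>] cvs.subspace_0 subspace_tensor_sub)

lemma left_act_Delta:
  assumes "p \<in> carrier G" "q \<in> carrier G" "w \<in> tensor_sub (A p) (A q)"
  shows "left_act (\<Delta> x) w = \<delta> p q x * w"
  by (rule homogeneous_linear_unique[where g = "\<lambda>x. left_act (\<Delta> x) w" and g' = "\<lambda>x. \<delta> p q x * w"])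
     (intro act_linear clinear_Delta multilinear_intros clinear_\<delta>
       | rule delta_homogeneous(2)[OF assms(1,2) _ _ assms(3)])+

text \<open>
  The right action is multiplication by an element \<open>z\<close> of \<open>A\<^sub>p \<otimes> A\<^sub>t\<close>, where \<open>t = p\<^bsup>-1\<^esup>r\<close>,
  obtained from the other half of the cograding; the compatibility of the two actions of a multiplier
  identifies \<open>z\<close> with the element that describes the left action.
\<close>

lemma right_act_Delta:
  assumes G: "p \<in> carrier G" "q \<in> carrier G" and w: "w \<in> tensor_sub (A p) (A q)"
  shows "right_act (\<Delta> x) w = w * \<delta> p q x"
proof (rule homogeneous_linear_unique[where g = "\<lambda>x. right_act (\<Delta> x) w" and g' = "\<lambda>x. w * \<delta> p q x"])
  fix r x assume r: "r \<in> carrier G" and x: "x \<in> A r"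
  let ?q = "inv p \<otimes> r" and ?U = "unit p \<otimes>\<^sub>t unit q"
  have q': "?q \<in> carrier G" and "x \<in> A (p \<otimes> ?q)" using G r x by (simp_all add: m_assoc[symmetric])
  then obtain z where z: "z \<in> tensor_sub (A p) (A ?q)" "mult_tensor (to_mult (unit p)) 1 * \<Delta> x = to_mult z"
    using Delta_mult_left[OF G(1) _ _ unit_props(1)[OF G(1)]] by blast
  have act: "right_act (\<Delta> x) w = w * z"
    using arg_cong[OF z(2), of "\<lambda>m. right_act m w"] act_on_tensor_sub(3)[OF G w]
    by (simp add: right_act_simps right_act_to_mult)
  have "w * \<delta> p q x = right_act (\<Delta> x) w * ?U"
    unfolding \<delta>_def by (rule multiplier_assoc)
  also have "\<dots> = w * (z * ?U)" by (simp add: act mult.assoc)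
  also have "\<dots> = w * z"
  proof (cases "?q = q")
    case True
    then show ?thesis using tensor_units(2)[OF G, of z] z(1) by simp
  next
    case False
    have "w * z = 0" by (rule tensor_sub_mult_other[OF G G(1) q' _ w z(1)]) (use False in auto)
    then show ?thesis by (simp add: mult.assoc[symmetric])
  qed
  finally show "right_act (\<Delta> x) w = w * \<delta> p q x" by (simp add: act)
qed (intro act_linear clinear_Delta multilinear_intros clinear_\<delta>)+

lemma delta_off_degree:
  "p \<in> carrier G \<Longrightarrow> q \<in> carrier G \<Longrightarrow> r \<in> carrier G \<Longrightarrow> r \<noteq> p \<otimes> q \<Longrightarrow> x \<in> A r \<Longrightarrow> \<delta> p q x = 0"
  using delta_homogeneous(3)[OF _ _ _ _ units_in_tensor_sub] by blast

lemma delta_mult: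
  assumes "p \<in> carrier G" "q \<in> carrier G"
  shows "\<delta> p q (x * y) = \<delta> p q x * \<delta> p q y"
  using left_act_Delta[OF assms delta_closed[OF assms]]
  by (simp add: \<delta>_def Delta_mult left_act_simps)

lemma comult_r_eq:
  assumes G: "p \<in> carrier G" "q \<in> carrier G" and a: "a \<in> A (p \<otimes> q)" and b: "b \<in> A q"
  shows "to_mult (comult_r \<Delta> a b) = \<Delta> a * mult_tensor 1 (to_mult b)"
    and "comult_r \<Delta> a b = \<delta> p q a * (unit p \<otimes>\<^sub>t b)"
proof -
  obtain z where z: "z \<in> tensor_sub (A p) (A q)" "\<Delta> a * mult_tensor 1 (to_mult b) = to_mult z"
    by (rule Delta_mult_right[OF G a b])
  have eq: "comult_r \<Delta> a b = z"
    by (simp add: comult_r_def z(2) from_mult_to_mult nondegenerate_tensor)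
  show "to_mult (comult_r \<Delta> a b) = \<Delta> a * mult_tensor 1 (to_mult b)" by (simp add: eq z)
  have "z = left_act (\<Delta> a * mult_tensor 1 (to_mult b)) (unit p \<otimes>\<^sub>t unit q)"
    by (simp add: z(2) left_act_to_mult tensor_units[OF G z(1)])
  also have "\<dots> = left_act (\<Delta> a) (unit p \<otimes>\<^sub>t b)"
    using G b by (simp add: left_act_simps left_act_to_mult unit_props)
  also have "\<dots> = \<delta> p q a * (unit p \<otimes>\<^sub>t b)"
    by (rule left_act_Delta[OF G pure_in_tensor_sub[OF unit_props(1)[OF G(1)] b]])
  finally show "comult_r \<Delta> a b = \<delta> p q a * (unit p \<otimes>\<^sub>t b)" by (simp add: eq)
qed

lemma comult_l_eq:
  assumes G: "p \<in> carrier G" "q \<in> carrier G" and a: "a \<in> A (p \<otimes> q)" and b: "b \<in> A p"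
  shows "to_mult (comult_l \<Delta> b a) = mult_tensor (to_mult b) 1 * \<Delta> a"
    and "comult_l \<Delta> b a = (b \<otimes>\<^sub>t unit q) * \<delta> p q a"
proof -
  obtain z where z: "z \<in> tensor_sub (A p) (A q)" "mult_tensor (to_mult b) 1 * \<Delta> a = to_mult z"
    by (rule Delta_mult_left[OF G a b])
  have eq: "comult_l \<Delta> b a = z"
    by (simp add: comult_l_def z(2) from_mult_to_mult nondegenerate_tensor)
  show "to_mult (comult_l \<Delta> b a) = mult_tensor (to_mult b) 1 * \<Delta> a" by (simp add: eq z)
  have "z = right_act (mult_tensor (to_mult b) 1 * \<Delta> a) (unit p \<otimes>\<^sub>t unit q)"
    by (simp add: z(2) right_act_to_mult tensor_units[OF G z(1)])
  also have "\<dots> = right_act (\<Delta> a) (b \<otimes>\<^sub>t unit q)"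
    using G b by (simp add: right_act_simps right_act_to_mult unit_props)
  also have "\<dots> = (b \<otimes>\<^sub>t unit q) * \<delta> p q a"
    by (rule right_act_Delta[OF G pure_in_tensor_sub[OF b unit_props(1)[OF G(2)]]])
  finally show "comult_l \<Delta> b a = (b \<otimes>\<^sub>t unit q) * \<delta> p q a" by (simp add: eq)
qed

lemma comult_unit_eq:
  assumes G: "p \<in> carrier G" "q \<in> carrier G" and a: "a \<in> A (p \<otimes> q)"
  shows "comult_r \<Delta> a (unit q) = \<delta> p q a" "comult_l \<Delta> (unit p) a = \<delta> p q a"
  using comult_r_eq(2)[OF G a unit_props(1)[OF G(2)]] comult_l_eq(2)[OF G a unit_props(1)[OF G(1)]]
    tensor_units[OF G delta_closed[OF G]] by simp_all

lemma to_mult_span: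
  assumes "to_mult t \<in> cvs.span (to_mult ` C)" and nd: "nondegenerate TYPE('b::complex_algebra)"
  shows "(t :: 'b) \<in> cvs.span C"
proof -
  have "\<exists>t\<in>cvs.span C. m = to_mult t" if "m \<in> cvs.span (to_mult ` C)" for m :: "'b multiplier"
    using that
  proof (induction rule: cvs.span_induct_alt)
    case base
    show ?case using cvs.span_zero clinear_zero[OF clinear_to_mult] by metis
  next
    case (step c m m')
    then obtain x y where "x \<in> C" "m = to_mult x" "y \<in> cvs.span C" "m' = to_mult y" by blast
    then show ?case
      by (intro bexI[of _ "c *\<^sub>C x + y"])
         (auto simp: clinear_add[OF clinear_to_mult] clinear_scaleC[OF clinear_to_mult]
           intro: cvs.span_add cvs.span_scale cvs.span_base)
  qed
  then show ?thesis using assms(1) inj_to_mult[OF nd] by (metis injD)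
qed

text \<open>
  The spanning condition of the cograding, transferred from multipliers to elements. Through it the
  axioms for the counit and the antipode, which speak of \<open>\<Delta>(a)(1 \<otimes> b)\<close>, give
  information on all of \<open>A\<^sub>p \<otimes> A\<^sub>q\<close>.
\<close>

lemma tensor_sub_span_comult_r:
  assumes G: "p \<in> carrier G" "q \<in> carrier G" and t: "t \<in> tensor_sub (A p) (A q)"
  shows "t \<in> cvs.span {comult_r \<Delta> a b | a b. a \<in> A (p \<otimes> q) \<and> b \<in> A q}"
proof (rule to_mult_span[OF _ nondegenerate_tensor])
  have "to_mult t \<in> cvs.span {\<Delta> a * mult_tensor 1 (to_mult b) | a b. a \<in> A (p \<otimes> q) \<and> b \<in> A q}"
    using t by (simp only: cograded_spans(1)[OF G] imageI)
  also have "{\<Delta> a * mult_tensor 1 (to_mult b) | a b. a \<in> A (p \<otimes> q) \<and> b \<in> A q}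
      = {to_mult (comult_r \<Delta> a b) | a b. a \<in> A (p \<otimes> q) \<and> b \<in> A q}"
    using comult_r_eq(1)[OF G] by metis
  also have "\<dots> = to_mult ` {comult_r \<Delta> a b | a b. a \<in> A (p \<otimes> q) \<and> b \<in> A q}" by blast
  finally show "to_mult t \<in> cvs.span (to_mult ` {comult_r \<Delta> a b | a b. a \<in> A (p \<otimes> q) \<and> b \<in> A q})" .
qed

lemma linear_image_comult_r:
  assumes "p \<in> carrier G" "q \<in> carrier G" "t \<in> tensor_sub (A p) (A q)" "clinear g" "cvs.subspace W"
    and "\<And>a b. a \<in> A (p \<otimes> q) \<Longrightarrow> b \<in> A q \<Longrightarrow> g (comult_r \<Delta> a b) \<in> W"
  shows "g t \<in> W"
  using tensor_sub_span_comult_r[OF assms(1-3)]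
  by (induction rule: cvs.span_induct_alt)
     (auto simp: assms clinear_zero clinear_add clinear_scaleC
        cvs.subspace_0 cvs.subspace_add cvs.subspace_scale)

text \<open>
  Multiplication by \<open>\<delta> p q (1\<^bsub>pq\<^esub>)\<close> fixes every \<open>\<Delta>(a)(1 \<otimes> b)\<close> with \<open>a \<in> A\<^bsub>pq\<^esub>\<close>, \<open>b \<in> A\<^sub>q\<close>. These elements
  span \<open>A\<^sub>p \<otimes> A\<^sub>q\<close>, so it fixes the identity of \<open>A\<^sub>p \<otimes> A\<^sub>q\<close>.
\<close>

lemma delta_unit:
  assumes G: "p \<in> carrier G" "q \<in> carrier G"
  shows "\<delta> p q (unit (p \<otimes> q)) = unit p \<otimes>\<^sub>t unit q"
proof -
  let ?D = "\<delta> p q (unit (p \<otimes> q))"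
  have "clinear (\<lambda>t. ?D * t - t)"
    by (simp add: clinear_iff distrib_left mult_scaleC_right cvs.scale_right_diff_distrib)
  then have "?D * (unit p \<otimes>\<^sub>t unit q) - unit p \<otimes>\<^sub>t unit q \<in> {0}"
  proof (rule linear_image_comult_r[OF G units_in_tensor_sub[OF G]])
    show "?D * comult_r \<Delta> a b - comult_r \<Delta> a b \<in> {0}" if "a \<in> A (p \<otimes> q)" "b \<in> A q" for a b
      using that G by (simp add: comult_r_eq(2)[OF G that] mult.assoc[symmetric]
          delta_mult[OF G, symmetric] unit_props)
  qed simp
  then show ?thesis by (simp add: tensor_units[OF G delta_closed[OF G]])
qed

lemma clinear_counit': "clinear \<epsilon>" and counit_mult: "\<epsilon> (a * b) = \<epsilon> a * \<epsilon> b"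
  and counit_comult_r: "tensor_lift (\<lambda>x y. \<epsilon> x *\<^sub>C y) (comult_r \<Delta> a b) = a * b"
  and counit_comult_l: "tensor_lift (\<lambda>x y. \<epsilon> y *\<^sub>C x) (comult_l \<Delta> a b) = a * b"
  using counit by (auto simp: is_counit_def)

lemma clinear_S: "clinear S" and S_mult: "S (a * b) = S b * S a"
  and S_comult_r: "tensor_lift left_act (tensor_map S id (comult_r \<Delta> a b)) = \<epsilon> a *\<^sub>C b"
  and S_comult_l: "tensor_lift (\<lambda>x m. right_act m x) (tensor_map id S (comult_l \<Delta> b a)) = \<epsilon> a *\<^sub>C b"
  using antipode by (auto simp: is_antipode_def)

text \<open>
  Since \<open>(\<epsilon> \<otimes> \<iota>)(\<Delta>(a)(1 \<otimes> b)) = ab\<close>, and \<open>ab = 0\<close> for \<open>a \<in> A\<^bsub>pp\<^esub>\<close>, \<open>b \<in> A\<^sub>p\<close> unless \<open>p\<close> is the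
  neutral element, \<open>\<epsilon> \<otimes> \<iota>\<close> vanishes on \<open>A\<^sub>p \<otimes> A\<^sub>p\<close>.
\<close>

lemma counit_off_degree:
  assumes p: "p \<in> carrier G" "p \<noteq> \<one>" and x: "x \<in> A p"
  shows "\<epsilon> x = 0"
proof -
  have bil: "cbilinear (\<lambda>x y. \<epsilon> x *\<^sub>C y)"
    by (intro multilinear_intros clinear_counit' clinear_compose[OF clinear_counit'])
  have "tensor_lift (\<lambda>x y. \<epsilon> x *\<^sub>C y) (x \<otimes>\<^sub>t unit p) \<in> {0}"
  proof (rule linear_image_comult_r[OF p(1) p(1) pure_in_tensor_sub[OF x unit_props(1)[OF p(1)]]
        clinear_tensor_lift[OF bil]])
    show "tensor_lift (\<lambda>x y. \<epsilon> x *\<^sub>C y) (comult_r \<Delta> a b) \<in> {0}" if "a \<in> A (p \<otimes> p)" "b \<in> A p" for a b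
      using component_mult_other[OF _ p(1) _ that] p by (simp add: counit_comult_r)
  qed simp
  then show ?thesis using unit_nonzero[OF p(1)] by (simp add: tensor_lift_pure[OF bil])
qed

text \<open>
  The element \<open>x \<otimes> y\<close> is a combination of elements \<open>\<Delta>(a)(1 \<otimes> b)\<close> with \<open>a \<in> A\<^bsub>pq\<^esub>\<close> and \<open>b \<in> A\<^sub>q\<close>,
  so \<open>S(x)y\<close> is a combination of elements \<open>\<epsilon>(a)b\<close>, and \<open>\<epsilon>\<close> vanishes on \<open>A\<^bsub>pq\<^esub>\<close> unless \<open>pq = e\<close>.
\<close>

lemma S_act:
  assumes p: "p \<in> carrier G" and q: "q \<in> carrier G" and x: "x \<in> A p" and y: "y \<in> A q"
  shows "left_act (S x) y \<in> (if p \<otimes> q = \<one> then A q else {0})" (is "_ \<in> ?W")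
proof -
  have bil: "cbilinear (left_act :: 'a multiplier \<Rightarrow> _)"
    by (intro cbilinearI clinear_left_act act_linear clinear_ident)
  have ids: "clinear id" by (simp add: clinear_iff)
  have W: "cvs.subspace ?W" using subspace_component[OF q] by simp
  have "tensor_lift left_act (tensor_map S id (x \<otimes>\<^sub>t y)) \<in> ?W"
  proof (rule linear_image_comult_r[OF p q pure_in_tensor_sub[OF x y] _ W,
        where g = "\<lambda>t. tensor_lift left_act (tensor_map S id t)"])
    show "clinear (\<lambda>t. tensor_lift left_act (tensor_map S id t))"
      by (intro clinear_tensor_lift_arg bil clinear_tensor_map clinear_S ids)
    show "tensor_lift left_act (tensor_map S id (comult_r \<Delta> a b)) \<in> ?W" if "a \<in> A (p \<otimes> q)" "b \<in> A q" for a b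
      using counit_off_degree[OF m_closed[OF p q] _ that(1)] that(2)
        cvs.subspace_scale[OF subspace_component[OF q]]
      by (auto simp: S_comult_r)
  qed
  then show ?thesis by (simp add: tensor_map_pure clinear_S ids tensor_lift_pure[OF bil])
qed

lemma S_homogeneous:
  assumes p: "p \<in> carrier G" and x: "x \<in> A p"
  shows "\<exists>y\<in>A (inv p). S x = to_mult y"
proof
  let ?y = "left_act (S x) (unit (inv p))"
  have ip: "inv p \<in> carrier G" using p by simp
  show y: "?y \<in> A (inv p)" using S_act[OF p ip x unit_props(1)[OF ip]] p by simp
  show "S x = to_mult ?y"
  proof (rule multiplier_eq_leftI[OF nondegenerate],
      rule homogeneous_linear_unique[OF clinear_left_act clinear_left_act])
    fix q b assume q: "q \<in> carrier G" and b: "b \<in> A q"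
    show "left_act (S x) b = left_act (to_mult ?y) b"
    proof (cases "q = inv p")
      case True
      then show ?thesis
        using b by (simp add: left_act_to_mult left_act_mult[OF nondegenerate, symmetric] unit_props[OF ip])
    next
      case False
      then have "p \<otimes> q \<noteq> \<one>" using inv_equality[of q p] p q by (metis inv_unique' l_inv r_inv inv_comm)
      then have "left_act (S x) b = 0" using S_act[OF p q x b] by simp
      moreover have "?y * b = 0" using component_mult_other[OF ip q _ y b] False by auto
      ultimately show ?thesis by (simp add: left_act_to_mult)
    qed
  qed
qed

lemma to_mult_s: "to_mult (s x) = S x"
proof -
  have "\<exists>y. S x = to_mult y"
  proof (induction x rule: graded_induct)
    case zero
    show ?case using clinear_zero[OF clinear_S] clinear_zero[OF clinear_to_mult] by metis
  next
    case (add x y)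
    then show ?case by (metis clinear_add[OF clinear_S] clinear_add[OF clinear_to_mult])
  next
    case (homogeneous p x)
    then show ?case using S_homogeneous by blast
  qed
  then show ?thesis by (auto simp: s_def from_mult_to_mult nondegenerate)
qed

lemma act_S: "left_act (S x) b = s x * b" "right_act (S x) b = b * s x"
  using left_act_to_mult[of "s x" b] right_act_to_mult[of "s x" b] by (simp_all add: to_mult_s)

lemma to_mult_eq_iff: "to_mult x = to_mult y \<longleftrightarrow> x = (y :: 'a)"
  using inj_to_mult[OF nondegenerate] by (auto dest: injD)

lemma clinear_s: "clinear s"
  unfolding clinear_iff to_mult_eq_iff[symmetric]
  by (simp add: to_mult_s clinear_add[OF clinear_S] clinear_scaleC[OF clinear_S]
      clinear_add[OF clinear_to_mult] clinear_scaleC[OF clinear_to_mult])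

lemma s_mult: "s (x * y) = s y * s x"
  unfolding to_mult_eq_iff[symmetric] by (simp add: to_mult_s to_mult_mult S_mult)

lemma s_closed: "p \<in> carrier G \<Longrightarrow> x \<in> A p \<Longrightarrow> s x \<in> A (inv p)"
  using S_homogeneous to_mult_s to_mult_eq_iff by metis

lemma delta_counit_left:
  assumes "p \<in> carrier G" "x \<in> A p"
  shows "tensor_lift (\<lambda>a b. \<epsilon> a *\<^sub>C b) (\<delta> \<one> p x) = x"
  using counit_comult_r[of x "unit p"] assms comult_unit_eq(1)[of "\<one>" p x] by (simp add: unit_props)

lemma delta_counit_right:
  assumes "p \<in> carrier G" "x \<in> A p"
  shows "tensor_lift (\<lambda>a b. \<epsilon> b *\<^sub>C a) (\<delta> p \<one> x) = x"
  using counit_comult_l[of "unit p" x] assms comult_unit_eq(2)[of p "\<one>" x] by (simp add: unit_props)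

lemma delta_antipode_left:
  assumes p: "p \<in> carrier G" and x: "x \<in> A \<one>"
  shows "tensor_lift (\<lambda>a b. s a * b) (\<delta> (inv p) p x) = \<epsilon> x *\<^sub>C unit p"
proof -
  have bil: "cbilinear (left_act :: 'a multiplier \<Rightarrow> _)"
    by (intro cbilinearI clinear_left_act act_linear clinear_ident)
  have bil': "cbilinear (\<lambda>a b. s a * b)" by (intro multilinear_intros clinear_s)
  have ids: "clinear id" by (simp add: clinear_iff)
  have "tensor_lift left_act (tensor_map S id t) = tensor_lift (\<lambda>a b. s a * b) t" for t
    by (rule tensor_linear_unique[where g = "\<lambda>t. tensor_lift left_act (tensor_map S id t)"])
       (intro clinear_tensor_lift_arg bil clinear_tensor_map clinear_S ids clinear_ident bil'
         | simp add: tensor_map_pure clinear_S ids tensor_lift_pure[OF bil] tensor_lift_pure[OF bil']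
             act_S)+
  then show ?thesis
    using S_comult_r[of x "unit p"] comult_unit_eq(1)[of "inv p" p x] p x by simp
qed

lemma delta_antipode_right:
  assumes p: "p \<in> carrier G" and x: "x \<in> A \<one>"
  shows "tensor_lift (\<lambda>a b. a * s b) (\<delta> p (inv p) x) = \<epsilon> x *\<^sub>C unit p"
proof -
  have bil: "cbilinear (\<lambda>x (m :: 'a multiplier). right_act m x)"
    by (intro cbilinearI clinear_right_act act_linear clinear_ident)
  have bil': "cbilinear (\<lambda>a b. a * s b)"
    by (intro multilinear_intros clinear_s clinear_compose[OF clinear_s])
  have ids: "clinear id" by (simp add: clinear_iff)
  have "tensor_lift (\<lambda>x m. right_act m x) (tensor_map id S t) = tensor_lift (\<lambda>a b. a * s b) t" for t
    by (rule tensor_linear_unique[where g = "\<lambda>t. tensor_lift (\<lambda>x m. right_act m x) (tensor_map id S t)"])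
       (intro clinear_tensor_lift_arg bil clinear_tensor_map clinear_S ids clinear_ident bil'
         | simp add: tensor_map_pure clinear_S ids tensor_lift_pure[OF bil] tensor_lift_pure[OF bil']
             act_S)+
  then show ?thesis
    using S_comult_l[of "unit p" x] comult_unit_eq(2)[of p "inv p" x] p x by simp
qed

text \<open>
  The number \<open>\<epsilon>(1\<^sub>e)\<close> is idempotent, and it is not \<open>0\<close> because \<open>\<epsilon>\<close> would vanish on \<open>A\<^sub>e\<close>.
\<close>

lemma counit_unit: "\<epsilon> (unit \<one>) = 1"
proof -
  have "\<epsilon> (unit \<one>) \<noteq> 0"
  proof
    assume 0: "\<epsilon> (unit \<one>) = 0"
    have bil: "cbilinear (\<lambda>x y. \<epsilon> x *\<^sub>C y)"
      by (intro multilinear_intros clinear_counit' clinear_compose[OF clinear_counit'])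
    have "\<epsilon> x = 0" if "x \<in> A \<one>" for x
      using counit_mult[of "unit \<one>" x] that 0 by (simp add: unit_props)
    then have "tensor_lift (\<lambda>a b. \<epsilon> a *\<^sub>C b) (\<delta> \<one> \<one> (unit \<one>)) \<in> {0}"
      by (intro linear_image_tensor_sub[OF delta_closed[OF one_closed one_closed] clinear_tensor_lift[OF bil]])
         (simp_all add: tensor_lift_pure[OF bil])
    then show False
      using delta_counit_left[OF one_closed unit_props(1)[OF one_closed]] unit_nonzero[OF one_closed] by simp
  qed
  moreover have "\<epsilon> (unit \<one>) * \<epsilon> (unit \<one>) = \<epsilon> (unit \<one>)"
    using counit_mult[of "unit \<one>" "unit \<one>"] by (simp add: unit_props)
  ultimately show ?thesis by simp
qed

lemma s_unit:
  assumes p: "p \<in> carrier G"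
  shows "s (unit p) = unit (inv p)"
proof -
  have bil: "cbilinear (\<lambda>a b. s a * b)" by (intro multilinear_intros clinear_s)
  have ip: "inv p \<in> carrier G" using p by simp
  have "tensor_lift (\<lambda>a b. s a * b) (\<delta> p (inv p) (unit \<one>)) = unit (inv p)"
    using delta_antipode_left[OF ip unit_props(1)[OF one_closed]] p
    by (simp add: counit_unit scaleC_one)
  moreover have "\<delta> p (inv p) (unit \<one>) = unit p \<otimes>\<^sub>t unit (inv p)"
    using delta_unit[OF p ip] p by simp
  ultimately show ?thesis
    using unit_props(3)[OF ip s_closed[OF p unit_props(1)[OF p]]]
    by (simp add: tensor_lift_pure[OF bil])
qed

text \<open>
  Both sides vanish on components of the wrong degree. For the right degree, take \<open>a = 1\<^sub>p\<close> and
  \<open>c = 1\<^sub>r\<close> in the coassociativity axiom and apply the resulting multipliers to the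
  identity of \<open>A\<^sub>p \<otimes> A\<^sub>q \<otimes> A\<^sub>r\<close>.
\<close>

lemma delta_assoc:
  assumes p: "p \<in> carrier G" and q: "q \<in> carrier G" and r: "r \<in> carrier G"
  shows "tensor_assoc (tensor_map (\<delta> p q) id (\<delta> (p \<otimes> q) r x)) = tensor_map id (\<delta> q r) (\<delta> p (q \<otimes> r) x)"
proof -
  have ids: "clinear (id :: 'a \<Rightarrow> 'a)" by (simp add: clinear_iff)
  have lin: "clinear (\<lambda>x. tensor_assoc (tensor_map (\<delta> p q) (id :: 'a \<Rightarrow> 'a) (\<delta> (p \<otimes> q) r x)))"
    "clinear (\<lambda>x. tensor_map (id :: 'a \<Rightarrow> 'a) (\<delta> q r) (\<delta> p (q \<otimes> r) x))"
    by (intro clinear_compose[OF clinear_tensor_assoc] clinear_compose[OF clinear_tensor_map]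
        clinear_\<delta> ids)+
  show ?thesis
  proof (rule homogeneous_linear_unique[OF lin])
    fix k x assume k: "k \<in> carrier G" and x: "x \<in> A k"
    show "tensor_assoc (tensor_map (\<delta> p q) id (\<delta> (p \<otimes> q) r x)) = tensor_map id (\<delta> q r) (\<delta> p (q \<otimes> r) x)"
    proof (cases "k = p \<otimes> q \<otimes> r")
      case False
      then have "\<delta> (p \<otimes> q) r x = 0" "\<delta> p (q \<otimes> r) x = 0"
        using delta_off_degree[OF _ _ k _ x] p q r by (auto simp: m_assoc)
      then show ?thesis
        by (simp add: clinear_zero[OF clinear_tensor_map] clinear_zero[OF clinear_tensor_assoc]
            clinear_\<delta> ids)
    next
      case True
      let ?U = "(unit p \<otimes>\<^sub>t unit q) \<otimes>\<^sub>t unit r"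
      let ?ml = "mult_tensor (mult_tensor (to_mult (unit p)) 1) (1 :: 'a multiplier)"
      let ?mr = "mult_tensor (1 :: 'a multiplier) (mult_tensor 1 (to_mult (unit r)))"
      have xl: "x \<in> A ((p \<otimes> q) \<otimes> r)" and xr: "x \<in> A (p \<otimes> (q \<otimes> r))"
        using x True p q r by (simp_all add: m_assoc)
      note cr = comult_unit_eq(1)[OF m_closed[OF p q] r xl]
      note cl = comult_unit_eq(2)[OF p m_closed[OF q r] xr]
      have bil1: "cbilinear (\<lambda>x y. mult_tensor (\<Delta> x) (to_mult y))"
        by (intro cbilinearI clinear_mult_tensor_left clinear_mult_tensor_right clinear_Delta clinear_to_mult)
      have bil2: "cbilinear (\<lambda>x y. mult_tensor (to_mult x) (\<Delta> y))"
        by (intro cbilinearI clinear_mult_tensor_left clinear_mult_tensor_right clinear_Delta clinear_to_mult)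
      have left: "left_act (?ml * comult_id \<Delta> t) ?U = tensor_map (\<delta> p q) id t"
        if "t \<in> tensor_sub (A (p \<otimes> q)) (A r)" for t
      proof (rule linear_eq_on_tensor_sub[OF that, where g = "\<lambda>t. left_act (?ml * comult_id \<Delta> t) ?U"])
        show "clinear (\<lambda>t. left_act (?ml * comult_id \<Delta> t) ?U)"
          unfolding comult_id_def by (intro act_linear multilinear_intros clinear_tensor_lift bil1)
        show "clinear (tensor_map (\<delta> p q) (id :: 'a \<Rightarrow> 'a))" by (intro clinear_tensor_map clinear_\<delta> ids)
        show "left_act (?ml * comult_id \<Delta> (a \<otimes>\<^sub>t b)) ?U = tensor_map (\<delta> p q) id (a \<otimes>\<^sub>t b)"
          if "b \<in> A r" for a b
          using that r by (simp add: comult_id_def tensor_lift_pure[OF bil1] left_act_simps left_act_to_mult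
              tensor_map_pure[OF clinear_\<delta> ids] unit_props \<delta>_def[symmetric]
              act_on_tensor_sub[OF p q delta_closed[OF p q]])
      qed
      have right: "left_act (id_comult \<Delta> t) (unit p \<otimes>\<^sub>t (unit q \<otimes>\<^sub>t unit r)) = tensor_map id (\<delta> q r) t"
        if "t \<in> tensor_sub (A p) (A (q \<otimes> r))" for t
      proof (rule linear_eq_on_tensor_sub[OF that, where g = "\<lambda>t. left_act (id_comult \<Delta> t) (unit p \<otimes>\<^sub>t (unit q \<otimes>\<^sub>t unit r))"])
        show "clinear (\<lambda>t. left_act (id_comult \<Delta> t) (unit p \<otimes>\<^sub>t (unit q \<otimes>\<^sub>t unit r)))"
          unfolding id_comult_def by (intro act_linear clinear_tensor_lift bil2)
        show "clinear (tensor_map (id :: 'a \<Rightarrow> 'a) (\<delta> q r))" by (intro clinear_tensor_map clinear_\<delta> ids)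
        show "left_act (id_comult \<Delta> (a \<otimes>\<^sub>t b)) (unit p \<otimes>\<^sub>t (unit q \<otimes>\<^sub>t unit r)) = tensor_map id (\<delta> q r) (a \<otimes>\<^sub>t b)"
          if "a \<in> A p" for a b
          using that p by (simp add: id_comult_def tensor_lift_pure[OF bil2] left_act_to_mult
              tensor_map_pure[OF ids clinear_\<delta>] unit_props \<delta>_def[symmetric])
      qed
      have "tensor_assoc (tensor_map (\<delta> p q) id (\<delta> (p \<otimes> q) r x))
          = tensor_assoc (left_act (?ml * comult_id \<Delta> (comult_r \<Delta> x (unit r))) ?U)"
        by (simp add: cr left[OF delta_closed[OF m_closed[OF p q] r]])
      also have "\<dots> = left_act (mult_transport tensor_assoc (?ml * comult_id \<Delta> (comult_r \<Delta> x (unit r)))) (tensor_assoc ?U)"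
        by (rule mult_transport_act(1)[OF clinear_tensor_assoc bij_tensor_assoc tensor_assoc_mult, symmetric])
      also have "\<dots> = left_act (id_comult \<Delta> (comult_l \<Delta> (unit p) x) * ?mr) (unit p \<otimes>\<^sub>t (unit q \<otimes>\<^sub>t unit r))"
        by (simp add: coassociative)
      also have "\<dots> = left_act (id_comult \<Delta> (\<delta> p (q \<otimes> r) x)) (unit p \<otimes>\<^sub>t (unit q \<otimes>\<^sub>t unit r))"
        using unit_props[OF r] by (simp add: cl left_act_simps left_act_to_mult)
      also have "\<dots> = tensor_map id (\<delta> q r) (\<delta> p (q \<otimes> r) x)"
        by (rule right[OF delta_closed[OF p m_closed[OF q r]]])
      finally show ?thesis .
    qed
  qed
qed

sublocale hopf_group_coalgebra G A unit \<delta> \<epsilon> s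
  by (rule hopf_group_coalgebra.intro[OF group_axioms hopf_group_coalgebra_axioms.intro])
     (fact subspace_component component_mult_closed unit_props clinear_\<delta> clinear_counit'
       clinear_s delta_closed delta_mult delta_unit delta_assoc delta_counit_left delta_counit_right
       s_closed s_mult delta_antipode_left delta_antipode_right s_unit)+

end

section \<open>Left invariance\<close>

lemma dual_basis_expansion:
  assumes basis: "basis_family V n e" and g: "\<And>i. i < n \<Longrightarrow> clinear (g i)"
    and dual: "\<And>i j. i < n \<Longrightarrow> j < n \<Longrightarrow> g i (e j) = (if i = j then 1 else 0)"
    and x: "x \<in> V"
  shows "(\<Sum>i<n. g i x *\<^sub>C e i) = x"
proof -
  have lin: "clinear (\<lambda>x. \<Sum>i<n. g i x *\<^sub>C e i)"
    by (intro clinear_sum_fun clinear_scaleC_scalar g) simp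
  have "x \<in> cvs.span (e ` {..<n})" using basis x by (simp add: basis_family_def)
  then show ?thesis
  proof (induction rule: cvs.span_induct_alt)
    case base
    show ?case by (rule clinear_zero[OF lin])
  next
    case (step c y z)
    then obtain j where j: "j < n" "y = e j" by auto
    have "(\<Sum>i<n. g i (e j) *\<^sub>C e i) = (\<Sum>i<n. if i = j then e i else 0)"
      by (rule sum.cong) (simp_all add: dual j scaleC_one)
    then have "(\<Sum>i<n. g i y *\<^sub>C e i) = y" using j by simp
    then show ?case using step.IH by (simp add: clinear_add[OF lin] clinear_scaleC[OF lin])
  qed
qed

context cograded_multiplier_hopf_algebra
begin

lemma comult_component_eq:
  assumes G: "p \<in> carrier G" "q \<in> carrier G"
  shows "comult_component A \<Delta> p q x = \<delta> p q x"
  unfolding comult_component_def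
proof (rule the_equality)
  show "\<delta> p q x \<in> tensor_sub (A p) (A q) \<and>
    (\<forall>w\<in>tensor_sub (A p) (A q). left_act (\<Delta> x) w = \<delta> p q x * w \<and> right_act (\<Delta> x) w = w * \<delta> p q x)"
    using delta_closed[OF G] left_act_Delta[OF G] right_act_Delta[OF G] by simp
  fix z assume z: "z \<in> tensor_sub (A p) (A q) \<and>
    (\<forall>w\<in>tensor_sub (A p) (A q). left_act (\<Delta> x) w = z * w \<and> right_act (\<Delta> x) w = w * z)"
  then have "\<delta> p q x = z * (unit p \<otimes>\<^sub>t unit q)"
    using units_in_tensor_sub[OF G] by (simp add: \<delta>_def)
  then show "z = \<delta> p q x" using z tensor_units(2)[OF G] by simp
qed

lemma delta_unit_mult:
  assumes G: "p \<in> carrier G" "q \<in> carrier G"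
  shows "\<delta> p q (unit (p \<otimes> q) * x) = \<delta> p q x"
  by (simp add: delta_mult[OF G] delta_unit[OF G] tensor_units[OF G delta_closed[OF G]])

lemma dual_mult_eq:
  assumes p: "p \<in> carrier G" and g: "clinear g" and f: "clinear f"
  shows "dual_mult G A \<Delta> p \<one> g f x = g (translate f p x)"
proof -
  have "dual_mult G A \<Delta> p \<one> g f x = tensor_lift (\<lambda>y z. g y * f z) (\<delta> p \<one> x)"
    using p delta_unit_mult[OF p one_closed]
    by (simp add: dual_mult_def comult_component_eq component_eq)
  also have "\<dots> = g (translate f p x)"
    unfolding translate_def
    by (subst linear_of_tensor_lift[where g = g, OF g])
       (intro multilinear_intros f, simp add: clinear_scaleC[OF g] scaleC_complex_def mult.commute)
  finally show ?thesis .
qed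

context
  fixes n :: "'g \<Rightarrow> nat" and e :: "'g \<Rightarrow> nat \<Rightarrow> 'a" and g :: "'g \<Rightarrow> nat \<Rightarrow> 'a \<Rightarrow> complex"
    and f :: "'a \<Rightarrow> complex"
  assumes f: "clinear f"
    and g: "\<And>p i. p \<in> carrier G \<Longrightarrow> i < n p \<Longrightarrow> clinear (g p i)"
begin

lemma translate_off_support:
  assumes "p \<in> carrier G" "unit p * x = 0"
  shows "translate f p (x * y) = 0"
proof -
  have "unit p * (x * y) = 0" using assms(2) by (simp add: mult.assoc[symmetric])
  then have "\<delta> p \<one> (x * y) = 0"
    using delta_unit_mult[OF assms(1) one_closed, of "x * y"] assms(1)
    by (simp add: clinear_zero[OF clinear_\<delta>])
  moreover have "clinear (tensor_lift (\<lambda>(a :: 'a) b. f b *\<^sub>C a))"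
    by (intro clinear_tensor_lift multilinear_intros f)
  ultimately show ?thesis by (simp add: translate_def clinear_zero)
qed

text \<open>
  The flexible index set \<open>P\<close> allows one to expand \<open>\<phi>(x)\<close>, \<open>\<phi>(y)\<close> and \<open>\<phi>(x + y)\<close> over the same set.
\<close>

lemma haar_functional_eq_sum:
  assumes P: "finite P" "P \<subseteq> carrier G" and supp: "\<And>p. p \<in> carrier G \<Longrightarrow> p \<notin> P \<Longrightarrow> unit p * a = 0"
  shows "haar_functional G A \<Delta> S n e g f a = (\<Sum>p\<in>P. trace_functional f n e g p a)"
proof -
  let ?\<phi> = "haar_functional G A \<Delta> S n e g f" and ?\<tau> = "trace_functional f n e g"
  let ?h = "\<lambda>(p, i). if p \<in> carrier G \<and> i < n p
      then dual_mult G A \<Delta> p \<one> (g p i) f (a * antipode_sq S (e p i)) else 0"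
  have h: "?h (p, i) = g p i (translate f p (a * s (s (e p i))))" if "p \<in> carrier G" "i < n p" for p i
    using that by (simp add: dual_mult_eq g f antipode_sq_def s_def)
  have off: "?h (p, i) = 0" if "(p, i) \<notin> Sigma P (\<lambda>p. {..<n p})" for p i
  proof (cases "p \<in> carrier G \<and> i < n p")
    case True
    then have "translate f p (a * s (s (e p i))) = 0"
      using that by (intro translate_off_support supp) auto
    then show ?thesis using True h clinear_zero[OF g] by simp
  qed auto
  have "?\<phi> a = sum ?h (Sigma P (\<lambda>p. {..<n p}))"
    unfolding haar_functional_def
  proof (rule Sum_any.expand_superset)
    show "finite (Sigma P (\<lambda>p. {..<n p}))" using P by simp
    show "{x. ?h x \<noteq> 0} \<subseteq> Sigma P (\<lambda>p. {..<n p})" using off by fast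
  qed
  also have "\<dots> = (\<Sum>p\<in>P. \<Sum>i<n p. ?h (p, i))"
    using P by (subst sum.Sigma[symmetric]) auto
  also have "\<dots> = (\<Sum>p\<in>P. ?\<tau> p a)"
    unfolding trace_functional_def using P h by (intro sum.cong refl) auto
  finally show ?thesis .
qed

lemma clinear_trace_functional: "p \<in> carrier G \<Longrightarrow> clinear (trace_functional f n e g p)"
  unfolding trace_functional_def
  by (intro clinear_sum_fun clinear_compose[OF g] clinear_compose[OF clinear_translate[OF f]]
      multilinear_intros) auto

lemma clinear_haar_functional: "clinear (haar_functional G A \<Delta> S n e g f)"
  unfolding clinear_iff
proof (intro conjI allI)
  let ?\<phi> = "haar_functional G A \<Delta> S n e g f" and ?\<tau> = "trace_functional f n e g"
  let ?supp = "\<lambda>x. {p \<in> carrier G. unit p * x \<noteq> 0}"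
  fix x y :: 'a and c
  let ?P = "?supp x \<union> ?supp y"
  have P: "finite ?P" "?P \<subseteq> carrier G" using finite_support by auto
  have "?\<phi> (x + y) = (\<Sum>p\<in>?P. ?\<tau> p (x + y))"
    by (rule haar_functional_eq_sum[OF P]) (auto simp: distrib_left)
  also have "\<dots> = (\<Sum>p\<in>?P. ?\<tau> p x) + (\<Sum>p\<in>?P. ?\<tau> p y)"
    unfolding sum.distrib[symmetric]
    by (rule sum.cong[OF refl]) (rule clinear_add[OF clinear_trace_functional], blast)
  also have "(\<Sum>p\<in>?P. ?\<tau> p x) = ?\<phi> x" by (rule haar_functional_eq_sum[OF P, symmetric]) auto
  also have "(\<Sum>p\<in>?P. ?\<tau> p y) = ?\<phi> y" by (rule haar_functional_eq_sum[OF P, symmetric]) auto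
  finally show "?\<phi> (x + y) = ?\<phi> x + ?\<phi> y" .
  have "?\<phi> (c *\<^sub>C x) = (\<Sum>p\<in>?P. ?\<tau> p (c *\<^sub>C x))"
    by (rule haar_functional_eq_sum[OF P]) (auto simp: mult_scaleC_right)
  also have "\<dots> = (\<Sum>p\<in>?P. c *\<^sub>C ?\<tau> p x)"
    by (rule sum.cong[OF refl]) (rule clinear_scaleC[OF clinear_trace_functional], blast)
  also have "\<dots> = c *\<^sub>C ?\<phi> x"
    unfolding cvs.scale_sum_right[symmetric]
    by (subst haar_functional_eq_sum[OF P, of x]) auto
  finally show "?\<phi> (c *\<^sub>C x) = c *\<^sub>C ?\<phi> x" .
qed

lemma haar_functional_homogeneous:
  assumes "p \<in> carrier G" "x \<in> A p"
  shows "haar_functional G A \<Delta> S n e g f x = trace_functional f n e g p x"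
  using haar_functional_eq_sum[of "{p}" x] component_mult_other[OF _ assms(1) _ _ assms(2)]
    unit_props(1) assms(1) by auto

end

lemma delta_slice_left:
  assumes p: "p \<in> carrier G" and q: "q \<in> carrier G" and a: "a \<in> A (p \<otimes> q)" and b: "b \<in> A p"
  shows "\<Delta> a * mult_tensor (to_mult b) 1 = to_mult (\<delta> p q a * (b \<otimes>\<^sub>t unit q))"
proof (rule multiplier_eq_leftI[OF nondegenerate_tensor],
    rule homogeneous_tensor_linear_unique[OF clinear_left_act clinear_left_act])
  fix p' q' x y assume G: "p' \<in> carrier G" "q' \<in> carrier G" and x: "x \<in> A p'" and y: "y \<in> A q'"
  let ?t = "\<delta> p q a * (b \<otimes>\<^sub>t unit q)"
  have eq: "?t * (x \<otimes>\<^sub>t y) = \<delta> p q a * ((b * x) \<otimes>\<^sub>t (unit q * y))"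
    by (simp add: mult.assoc times_pure_tensor)
  have z: "0 \<otimes>\<^sub>t v = (0 :: 'a \<otimes> 'a)" "v \<otimes>\<^sub>t 0 = (0 :: 'a \<otimes> 'a)" for v :: 'a
    by (rule clinear_zero[OF clinear_pure_left[OF clinear_ident]]
        clinear_zero[OF clinear_pure_right[OF clinear_ident]])+
  have "left_act (\<Delta> a) ((b * x) \<otimes>\<^sub>t y) = ?t * (x \<otimes>\<^sub>t y)"
  proof (cases "p' = p")
    case False
    then have "b * x = 0" using component_mult_other[OF p G(1) _ b x] by auto
    then show ?thesis unfolding eq by (simp add: z clinear_zero[OF clinear_left_act])
  next
    case True
    have bx: "b * x \<in> A p" using component_mult_closed[OF p b] x True by simp
    have act: "left_act (\<Delta> a) ((b * x) \<otimes>\<^sub>t y) = \<delta> p q' a * ((b * x) \<otimes>\<^sub>t y)"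
      by (rule left_act_Delta[OF p G(2) pure_in_tensor_sub[OF bx y]])
    show ?thesis
    proof (cases "q' = q")
      case True
      then show ?thesis using y q by (simp add: act eq unit_props)
    next
      case False
      have "\<delta> p q' a = 0"
        using delta_off_degree[OF p G(2) m_closed[OF p q] _ a] False p q G by auto
      moreover have "unit q * y = 0" 
        using component_mult_other[OF q G(2) _ unit_props(1)[OF q] y] False by auto
      ultimately show ?thesis by (simp add: act eq z)
    qed
  qed
  then show "left_act (\<Delta> a * mult_tensor (to_mult b) 1) (x \<otimes>\<^sub>t y) = left_act (to_mult ?t) (x \<otimes>\<^sub>t y)"
    by (simp add: left_act_simps left_act_to_mult)
qed

text \<open>
  Invariance need only be checked on the components of the coproduct. The operator \<open>from_mult\<close> in
  \<open>slice_comult\<close> has a meaning on the image of \<open>A \<otimes> A\<close> only, so the extension from homogeneous to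
  arbitrary elements carries along the representing tensors.
\<close>

lemma left_invariantI:
  assumes \<phi>: "clinear \<phi>"
    and inv: "\<And>p q a. p \<in> carrier G \<Longrightarrow> q \<in> carrier G \<Longrightarrow> a \<in> A (p \<otimes> q) \<Longrightarrow>
      tensor_lift (\<lambda>x y. \<phi> y *\<^sub>C x) (\<delta> p q a) = \<phi> a *\<^sub>C unit p"
  shows "left_invariant \<Delta> \<phi>"
proof -
  let ?slice = "tensor_lift (\<lambda>(x :: 'a) y. \<phi> y *\<^sub>C x)"
  note lin = multilinear_intros \<phi> clinear_compose[OF \<phi>]
  have bil: "cbilinear (\<lambda>(x :: 'a) y. \<phi> y *\<^sub>C x)" by (intro lin)
  have slice: "clinear ?slice" by (rule clinear_tensor_lift[OF bil])
  let ?good = "\<lambda>m v. \<exists>t. m = to_mult t \<and> ?slice t = v"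
  have good_zero: "?good 0 0"
    by (intro exI[of _ 0]) (simp add: clinear_zero[OF slice] clinear_zero[OF clinear_to_mult])
  have good_add: "?good (m + m') (v + v')" if "?good m v" "?good m' v'" for m m' v v'
  proof -
    from that obtain t t' where "m = to_mult t" "?slice t = v" "m' = to_mult t'" "?slice t' = v'" by blast
    then show ?thesis
      by (intro exI[of _ "t + t'"]) (simp add: clinear_add[OF slice] clinear_add[OF clinear_to_mult])
  qed
  have factors: "?good (\<Delta> a * mult_tensor (to_mult b) 1) (\<phi> a *\<^sub>C b)"
    "?good (mult_tensor (to_mult b) 1 * \<Delta> a) (\<phi> a *\<^sub>C b)"
    if r: "r \<in> carrier G" and a: "a \<in> A r" and p: "p \<in> carrier G" and b: "b \<in> A p" for a b r p
  proof -
    let ?q = "inv p \<otimes> r"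
    have q: "?q \<in> carrier G" and r_eq: "r = p \<otimes> ?q" using p r by (simp_all add: m_assoc[symmetric])
    have a': "a \<in> A (p \<otimes> ?q)" using a r_eq by simp
    let ?d = "\<delta> p ?q a"
    have "?slice (?d * (b \<otimes>\<^sub>t unit ?q)) = tensor_lift (\<lambda>x y. \<phi> (y * unit ?q) *\<^sub>C (x * b)) ?d"
      using linear_as_tensor_lift[where g = "\<lambda>t. ?slice (t * (b \<otimes>\<^sub>t unit ?q))" and t = ?d]
      by (simp add: times_pure_tensor tensor_lift_pure[OF bil] clinear_compose[OF slice] multilinear_intros)
    also have "\<dots> = tensor_lift (\<lambda>x y. (\<phi> y *\<^sub>C x) * b) ?d"
      by (rule sweedler_cong[OF p q]) (intro lin, intro lin, simp add: unit_props[OF q] mult_scaleC_left)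
    also have "\<dots> = ?slice ?d * b"
      by (rule linear_of_tensor_lift[where g = "\<lambda>v. v * b", symmetric]) (intro lin bil)+
    also have "\<dots> = \<phi> a *\<^sub>C b" by (simp add: inv[OF p q a'] mult_scaleC_left unit_props[OF p] b)
    finally show "?good (\<Delta> a * mult_tensor (to_mult b) 1) (\<phi> a *\<^sub>C b)"
      using delta_slice_left[OF p q a' b] by blast
    have "?slice ((b \<otimes>\<^sub>t unit ?q) * ?d) = tensor_lift (\<lambda>x y. \<phi> (unit ?q * y) *\<^sub>C (b * x)) ?d"
      using linear_as_tensor_lift[where g = "\<lambda>t. ?slice ((b \<otimes>\<^sub>t unit ?q) * t)" and t = ?d]
      by (simp add: times_pure_tensor tensor_lift_pure[OF bil] clinear_compose[OF slice] multilinear_intros)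
    also have "\<dots> = tensor_lift (\<lambda>x y. b * (\<phi> y *\<^sub>C x)) ?d"
      by (rule sweedler_cong[OF p q]) (intro lin, intro lin, simp add: unit_props[OF q] mult_scaleC_right)
    also have "\<dots> = b * ?slice ?d"
      by (rule linear_of_tensor_lift[where g = "\<lambda>v. b * v", symmetric]) (intro lin bil)+
    also have "\<dots> = \<phi> a *\<^sub>C b" by (simp add: inv[OF p q a'] mult_scaleC_right unit_props[OF p] b)
    finally show "?good (mult_tensor (to_mult b) 1 * \<Delta> a) (\<phi> a *\<^sub>C b)"
      using comult_l_eq[OF p q a' b] by metis
  qed
  have right_factor: "?good (\<Delta> a * mult_tensor (to_mult b) 1) (\<phi> a *\<^sub>C b) \<and>
      ?good (mult_tensor (to_mult b) 1 * \<Delta> a) (\<phi> a *\<^sub>C b)" if r: "r \<in> carrier G" and a: "a \<in> A r" for a b r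
  proof (induction b rule: graded_induct)
    case zero
    have "mult_tensor (to_mult 0) 1 = (0 :: ('a \<otimes> 'a) multiplier)"
      by (rule clinear_zero[OF clinear_mult_tensor_left[OF clinear_to_mult]])
    then show ?case using good_zero by simp
  next
    case (add x y)
    have "mult_tensor (to_mult (x + y)) 1 = mult_tensor (to_mult x) 1 + (mult_tensor (to_mult y) 1 :: ('a \<otimes> 'a) multiplier)"
      by (rule clinear_add[OF clinear_mult_tensor_left[OF clinear_to_mult]])
    then show ?case
      using good_add[OF conjunct1[OF add(1)] conjunct1[OF add(2)]]
        good_add[OF conjunct2[OF add(1)] conjunct2[OF add(2)]]
      by (simp add: distrib_left distrib_right scaleC_right_distrib)
  next
    case (homogeneous p b)
    show ?case using factors[OF r a homogeneous] by (rule conjI)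
  qed
  have good: "?good (\<Delta> a * mult_tensor (to_mult b) 1) (\<phi> a *\<^sub>C b) \<and>
      ?good (mult_tensor (to_mult b) 1 * \<Delta> a) (\<phi> a *\<^sub>C b)" for a b
  proof (induction a rule: graded_induct)
    case zero
    then show ?case using good_zero by (simp add: clinear_zero[OF clinear_Delta] clinear_zero[OF \<phi>])
  next
    case (add x y)
    then show ?case
      using good_add[OF conjunct1[OF add(1)] conjunct1[OF add(2)]]
        good_add[OF conjunct2[OF add(1)] conjunct2[OF add(2)]]
      by (simp add: distrib_left distrib_right scaleC_left_distrib clinear_add[OF clinear_Delta] clinear_add[OF \<phi>])
  next
    case (homogeneous r a)
    then show ?case by (rule right_factor)
  qed
  have slices: "?slice (from_mult (\<Delta> a * mult_tensor (to_mult b) 1)) = \<phi> a *\<^sub>C b"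
    "?slice (from_mult (mult_tensor (to_mult b) 1 * \<Delta> a)) = \<phi> a *\<^sub>C b" for a b
    using good[of a b] by (auto simp: from_mult_to_mult[OF nondegenerate_tensor])
  have "slice_comult \<Delta> \<phi> a = \<phi> a *\<^sub>C 1" for a
    unfolding slice_comult_def
  proof (rule the_equality)
    show "\<forall>b. left_act (\<phi> a *\<^sub>C 1) b = ?slice (from_mult (\<Delta> a * mult_tensor (to_mult b) 1)) \<and>
      right_act (\<phi> a *\<^sub>C 1) b = ?slice (from_mult (mult_tensor (to_mult b) 1 * \<Delta> a))"
      by (simp add: slices left_act_simps right_act_simps)
    show "m = \<phi> a *\<^sub>C 1"
      if "\<forall>b. left_act m b = ?slice (from_mult (\<Delta> a * mult_tensor (to_mult b) 1)) \<and>
        right_act m b = ?slice (from_mult (mult_tensor (to_mult b) 1 * \<Delta> a))" for m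
      using that by (intro multiplier_eqI) (simp_all add: slices left_act_simps right_act_simps)
  qed
  then show ?thesis using \<phi> by (simp add: left_invariant_def)
qed

end

theorem theorem3p9:
  fixes G :: "('g, 'm) monoid_scheme"
    and A :: "'g \<Rightarrow> 'a::complex_algebra set"
    and \<Delta> :: "'a comult"
    and \<epsilon> :: "'a \<Rightarrow> complex"
    and S :: "'a \<Rightarrow> 'a multiplier"
    and n :: "'g \<Rightarrow> nat"
    and e :: "'g \<Rightarrow> nat \<Rightarrow> 'a"
    and f_dual :: "'g \<Rightarrow> nat \<Rightarrow> 'a \<Rightarrow> complex"
    and f :: "'a \<Rightarrow> complex"
  assumes "group G"
    and "regular_multiplier_hopf_algebra \<Delta>"
    and "cograded G A \<Delta>"
    and "\<And>p. p \<in> carrier G \<Longrightarrow> finite_dimensional (A p) \<and> has_identity (A p)"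
    and "is_counit \<Delta> \<epsilon>"
    and "is_antipode \<Delta> \<epsilon> S"
    and "\<And>p. p \<in> carrier G \<Longrightarrow> basis_family (A p) (n p) (e p)"
    and "\<And>p i. p \<in> carrier G \<Longrightarrow> i < n p \<Longrightarrow> f_dual p i \<in> component_dual (carrier G) A p"
    and "\<And>p i j. p \<in> carrier G \<Longrightarrow> i < n p \<Longrightarrow> j < n p \<Longrightarrow>
           f_dual p i (e p j) = (if i = j then 1 else 0)"
    and "f \<in> component_dual (carrier G) A \<one>\<^bsub>G\<^esub>"
  shows "left_invariant \<Delta> (haar_functional G A \<Delta> S n e f_dual f)"
proof -
  interpret cograded_multiplier_hopf_algebra G A \<Delta> \<epsilon> S
    using assms(1-6)
    by (intro cograded_multiplier_hopf_algebra.intro cograded_multiplier_hopf_algebra_axioms.intro)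
       (auto simp: regular_multiplier_hopf_algebra_def)
  have f: "clinear f" using assms(10) by (simp add: component_dual_def)
  have dual: "clinear (f_dual p i)" if "p \<in> carrier G" "i < n p" for p i
    using assms(8)[OF that] by (simp add: component_dual_def)
  have e: "e p i \<in> A p" if "p \<in> carrier G" "i < n p" for p i
    using assms(7)[OF that(1)] that(2) by (auto simp: basis_family_def intro: cvs.span_base)
  have expand: "(\<Sum>i<n p. f_dual p i x *\<^sub>C e p i) = x" if "p \<in> carrier G" "x \<in> A p" for p x
    by (rule dual_basis_expansion[OF assms(7)[OF that(1)] dual[OF that(1)] assms(9)[OF that(1)] that(2)])
  let ?\<phi> = "haar_functional G A \<Delta> S n e f_dual f" and ?\<tau> = "trace_functional f n e f_dual"
  note lin = clinear_haar_functional[OF f dual]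
  note homogeneous = haar_functional_homogeneous[OF f dual]
  show ?thesis
  proof (rule left_invariantI)
    show "clinear ?\<phi>" by (rule lin)
    fix p q a assume p: "p \<in> carrier G" and q: "q \<in> carrier G" and a: "a \<in> A (p \<otimes>\<^bsub>G\<^esub> q)"
    have "tensor_lift (\<lambda>x y. ?\<phi> y *\<^sub>C x) (\<delta> p q a) = tensor_lift (\<lambda>x y. ?\<tau> q y *\<^sub>C x) (\<delta> p q a)"
      by (rule sweedler_cong[OF p q])
         (intro multilinear_intros clinear_compose[OF lin] clinear_compose[OF clinear_trace_functional[OF f dual q]]
           | simp add: homogeneous[OF _ _ q])+
    also have "\<dots> = ?\<tau> (p \<otimes>\<^bsub>G\<^esub> q) a *\<^sub>C unit p"
      by (rule trace_functional_invariant[OF f dual e expand p q])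
    also have "?\<tau> (p \<otimes>\<^bsub>G\<^esub> q) a = ?\<phi> a"
      using homogeneous[OF _ _ m_closed[OF p q] a] by simp
    finally show "tensor_lift (\<lambda>x y. ?\<phi> y *\<^sub>C x) (\<delta> p q a) = ?\<phi> a *\<^sub>C unit p" .
  qed
qed

end
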